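(* Suppose $n$ is an even integer with $n\geq t_1+t_2+t_3$, and put $K=k_1+k_2+k_3$, $N=\tfrac{n+1}{2}$, $\mathscr M=\mathscr M_n(x_1)\cap\mathscr M_n(x_2)\cap\mathscr M_n(x_3)$. Let $W_0=E_{n-t_1-t_2-t_3}(k_1+N,\,k_2+N,\,k_3+N)$, $A=O_{t_1-1}(K+n+1,\,k_3,\,k_2)$, $B=O_{t_2-1}(k_3,\,K+n+1,\,k_1)$, $C=O_{t_3-1}(k_2,\,k_1,\,K+n+1)$. Then, as $\mathfrak{BI}$-modules: (i) $\mathscr M\cong W_0\oplus W_0$; (ii) $\mathscr M_n/\mathscr M_n(x_1)\cong A\oplus A$; (iii) $\mathscr M_n/\mathscr M_n(x_2)\cong B\oplus B$; (iv) $\mathscr M_n/\mathscr M_n(x_3)\cong C\oplus C$; (v) $\mathscr M_n(x_1)/\mathscr M\cong B\oplus B\oplus C\oplus C$; (vi) $\mathscr M_n(x_2)/\mathscr M\cong A\oplus A\oplus C\oplus C$; (vii) $\mathscr M_n(x_3)/\mathscr M\cong A\oplus A\oplus B\oplus B$. Moreover, $W_0,A,B,C$ are irreducible.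
   Context: Fix real numbers $k_1,k_2,k_3$. For $i=1,2,3$ let $R_i$ be the operator on functions on $\mathbb R^3$ replacing $x_i$ by $-x_i$, and $T_if=\frac{\partial f}{\partial x_i}+k_i\frac{f-R_if}{x_i}$ (Dunkl operators). Let $\sigma_1=\begin{pmatrix}0&1\\1&0\end{pmatrix}$, $\sigma_2=\begin{pmatrix}0&-\sqrt{-1}\\ \sqrt{-1}&0\end{pmatrix}$, $\sigma_3=\begin{pmatrix}1&0\\0&-1\end{pmatrix}$, and let $e_i$ act on $\mathbb C^2$ by $\sigma_i$. Tensor products are over $\mathbb R$; $\mathbb R[\cdots]_m$ denotes homogeneous polynomials of degree $m$. Let $\mathbf D=e_1\otimes T_1+e_2\otimes T_2+e_3\otimes T_3$ and $\mathscr M_n=\ker(\mathbf D|_{\mathbb C^2\otimes\mathbb R[x_1,x_2,x_3]_n})$. For $i=1,2,3$ set $t_i=-2k_i$ if $2k_i$ is an odd negative integer, and $t_i=\infty$ otherwise. For $i=1,2,3$, $\mathscr M_n(x_i)=\mathscr M_n\cap\bigoplus_{j=t_i}^n\mathbb C^2\otimes(x_i^j\cdot\mathbb R[x_p,x_q]_{n-j})$ where $\{p,q\}=\{1,2,3\}\setminus\{i\}$ (it is $\{0\}$ if $n<t_i$); it is a $\mathfrak{BI}$-submodule of $\mathscr M_n$. $\mathfrak{BI}$ is the unital associative $\mathbb C$-algebra generated by $X,Y,Z$ with relations saying that $\{X,Y\}-Z$, $\{Y,Z\}-X$, $\{Z,X\}-Y$ commute with $X,Y,Z$ ($\{A,B\}=AB+BA$).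 $\mathscr M_n$ is a $\mathfrak{BI}$-module via $X=(\sqrt{-1}\,e_1\otimes(x_3T_2-x_2T_3)+\tfrac12)R_2R_3+k_2R_3+k_3R_2$, $Y=(\sqrt{-1}\,e_2\otimes(x_1T_3-x_3T_1)+\tfrac12)R_1R_3+k_3R_1+k_1R_3$, $Z=(\sqrt{-1}\,e_3\otimes(x_2T_1-x_1T_2)+\tfrac12)R_1R_2+k_1R_2+k_2R_1$, operators composed right to left, $R_i$ acting on the polynomial factor. For $a,b,c\in\mathbb C$ and an integer $d\geq0$, let $\theta_i=\frac{(-1)^i(2a-d+2i)}{2}$, $\theta^*_i=\frac{(-1)^i(2b-d+2i)}{2}$ ($0\le i\le d$). For odd $d$, $E_d(a,b,c)$ is the $\mathfrak{BI}$-module $\mathbb C^{d+1}$ in which, w.r.t. a basis $v_0,\dots,v_d$, $X$ acts by the lower bidiagonal matrix with diagonal $(\theta_i)$ and subdiagonal entries $1$, $Y$ by the upper bidiagonal matrix with diagonal $(\theta^*_i)$ and superdiagonal $(\varphi_1,\dots,\varphi_d)$ with $\varphi_i=i(d-i+1)$ ($i$ even), $\varphi_i=c^2-\frac{(2a+2b-d+2i-1)^2}{4}$ ($i$ odd), and $Z=\{X,Y\}-\big(c^2-a^2-b^2+\frac{(d+1)^2}{4}\big)$. For even $d$, $O_d(a,b,c)$ is defined in the same way but with $\varphi_i=\frac{i(d+1-2i-2a-2b-2c)}{2}$ ($i$ even), $\varphi_i=\frac{(i-d-1)(d+1-2i-2a-2b+2c)}{2}$ ($i$ odd), and $Z=\{X,Y\}-(2ab-c(d+1))$.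 *)

theory Defs
  imports Complex_Main "HOL-Library.Extended_Nat"
begin

definition vzero :: "'i \<Rightarrow> complex" where "vzero = (\<lambda>i. 0)"
definition vadd :: "('i \<Rightarrow> complex) \<Rightarrow> ('i \<Rightarrow> complex) \<Rightarrow> 'i \<Rightarrow> complex"
  where "vadd u v = (\<lambda>i. u i + v i)"
definition vsub :: "('i \<Rightarrow> complex) \<Rightarrow> ('i \<Rightarrow> complex) \<Rightarrow> 'i \<Rightarrow> complex"
  where "vsub u v = (\<lambda>i. u i - v i)"
definition smul :: "complex \<Rightarrow> ('i \<Rightarrow> complex) \<Rightarrow> 'i \<Rightarrow> complex"
  where "smul c v = (\<lambda>i. c * v i)"

text \<open>A BI-module: a carrier (a complex subspace of a function space) with the
  actions of the generators X, Y, Z.\<close>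
record 'i bimod =
  car :: "('i \<Rightarrow> complex) set"
  opX :: "('i \<Rightarrow> complex) \<Rightarrow> 'i \<Rightarrow> complex"
  opY :: "('i \<Rightarrow> complex) \<Rightarrow> 'i \<Rightarrow> complex"
  opZ :: "('i \<Rightarrow> complex) \<Rightarrow> 'i \<Rightarrow> complex"

definition restrict_mod :: "'i bimod \<Rightarrow> ('i \<Rightarrow> complex) set \<Rightarrow> 'i bimod" where
  "restrict_mod M S = M\<lparr>car := S\<rparr>"

definition clin_on :: "('i \<Rightarrow> complex) set \<Rightarrow> (('i \<Rightarrow> complex) \<Rightarrow> 'j \<Rightarrow> complex) \<Rightarrow> bool" where
  "clin_on S f \<longleftrightarrow> (\<forall>u\<in>S. \<forall>v\<in>S. f (vadd u v) = vadd (f u) (f v))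
                   \<and> (\<forall>c. \<forall>u\<in>S. f (smul c u) = smul c (f u))"

definition intertwines :: "'i bimod \<Rightarrow> 'j bimod \<Rightarrow> (('i \<Rightarrow> complex) \<Rightarrow> 'j \<Rightarrow> complex) \<Rightarrow> bool" where
  "intertwines U V f \<longleftrightarrow> (\<forall>u\<in>car U. f (opX U u) = opX V (f u) \<and> f (opY U u) = opY V (f u)
                                     \<and> f (opZ U u) = opZ V (f u))"

definition bi_iso :: "'i bimod \<Rightarrow> 'j bimod \<Rightarrow> bool" where
  "bi_iso U V \<longleftrightarrow> (\<exists>f. clin_on (car U) f \<and> bij_betw f (car U) (car V) \<and> intertwines U V f)"

text \<open>The quotient module U/S is isomorphic to V: by the first isomorphism theorem
  this means there is a surjective module homomorphism from U onto V with kernel S.\<close>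
definition quot_iso :: "'i bimod \<Rightarrow> ('i \<Rightarrow> complex) set \<Rightarrow> 'j bimod \<Rightarrow> bool" where
  "quot_iso U S V \<longleftrightarrow> (\<exists>f. clin_on (car U) f \<and> f ` car U = car V
                          \<and> {u \<in> car U. f u = vzero} = S \<and> intertwines U V f)"

definition subspace_in :: "('i \<Rightarrow> complex) set \<Rightarrow> bool" where
  "subspace_in S \<longleftrightarrow> vzero \<in> S \<and> (\<forall>u\<in>S. \<forall>v\<in>S. vadd u v \<in> S) \<and> (\<forall>c. \<forall>u\<in>S. smul c u \<in> S)"

definition irreducible_mod :: "'i bimod \<Rightarrow> bool" where
  "irreducible_mod V \<longleftrightarrow> car V \<noteq> {vzero} \<and>
     (\<forall>S. S \<subseteq> car V \<and> subspace_in S \<and> (\<forall>u\<in>S. opX V u \<in> S \<and> opY V u \<in> S \<and> opZ V u \<in> S)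
          \<longrightarrow> S = {vzero} \<or> S = car V)"

definition dsum :: "'i bimod list \<Rightarrow> (nat \<times> 'i) bimod" where
  "dsum L = \<lparr> car = {v. (\<forall>j<length L. (\<lambda>i. v (j, i)) \<in> car (L ! j))
                        \<and> (\<forall>j i. j \<ge> length L \<longrightarrow> v (j, i) = 0)},
             opX = (\<lambda>v (j, i). if j < length L then opX (L ! j) (\<lambda>i'. v (j, i')) i else 0),
             opY = (\<lambda>v (j, i). if j < length L then opY (L ! j) (\<lambda>i'. v (j, i')) i else 0),
             opZ = (\<lambda>v (j, i). if j < length L then opZ (L ! j) (\<lambda>i'. v (j, i')) i else 0) \<rparr>"

definition theta :: "nat \<Rightarrow> complex \<Rightarrow> nat \<Rightarrow> complex" where
  "theta d a i = (-1) ^ i * (2 * a - of_nat d + 2 * of_nat i) / 2"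

text \<open>Leonard-pair type module on coordinate vectors: X lower bidiagonal with diagonal
  theta_i (parameter a) and subdiagonal 1, Y upper bidiagonal with diagonal
  theta*_i (parameter b) and superdiagonal phi_1..phi_d, Z = {X,Y} - const.\<close>
definition bimat :: "nat \<Rightarrow> complex \<Rightarrow> complex \<Rightarrow> (nat \<Rightarrow> complex) \<Rightarrow> complex \<Rightarrow> nat bimod" where
  "bimat d a b phi cst =
    (let X = (\<lambda>v i. if i \<le> d then theta d a i * v i + (if 1 \<le> i then v (i - 1) else 0) else 0);
         Y = (\<lambda>v i. if i \<le> d then theta d b i * v i + (if i + 1 \<le> d then phi (i + 1) * v (i + 1) else 0) else 0)
     in \<lparr> car = {v. \<forall>i>d. v i = 0}, opX = X, opY = Y,
          opZ = (\<lambda>v. vsub (vadd (X (Y v)) (Y (X v))) (smul cst v)) \<rparr>)"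

definition Emod :: "nat \<Rightarrow> complex \<Rightarrow> complex \<Rightarrow> complex \<Rightarrow> nat bimod" where
  "Emod d a b c = bimat d a b
     (\<lambda>i. if even i then of_nat i * (of_nat d - of_nat i + 1)
          else c ^ 2 - (2 * a + 2 * b - of_nat d + 2 * of_nat i - 1) ^ 2 / 4)
     (c ^ 2 - a ^ 2 - b ^ 2 + (of_nat d + 1) ^ 2 / 4)"

definition Omod :: "nat \<Rightarrow> complex \<Rightarrow> complex \<Rightarrow> complex \<Rightarrow> nat bimod" where
  "Omod d a b c = bimat d a b
     (\<lambda>i. if even i then of_nat i * (of_nat d + 1 - 2 * of_nat i - 2 * a - 2 * b - 2 * c) / 2
          else (of_nat i - of_nat d - 1) * (of_nat d + 1 - 2 * of_nat i - 2 * a - 2 * b + 2 * c) / 2)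
     (2 * a * b - c * (of_nat d + 1))"

text \<open>An element of C^2 (x) R[x1,x2,x3] is a function f with f (s, (a1,a2,a3)) the
  s-th component (s = 0, 1) of the coefficient of x1^a1 x2^a2 x3^a3.\<close>
type_synonym pv = "nat \<times> (nat \<times> nat \<times> nat) \<Rightarrow> complex"

definition ex :: "nat \<Rightarrow> nat \<times> nat \<times> nat \<Rightarrow> nat" where
  "ex i \<alpha> = (case \<alpha> of (a1, a2, a3) \<Rightarrow> if i = 1 then a1 else if i = 2 then a2 else a3)"

definition incr :: "nat \<Rightarrow> nat \<times> nat \<times> nat \<Rightarrow> nat \<times> nat \<times> nat" where
  "incr i \<alpha> = (case \<alpha> of (a1, a2, a3) \<Rightarrow>
     if i = 1 then (a1 + 1, a2, a3) else if i = 2 then (a1, a2 + 1, a3) else (a1, a2, a3 + 1))"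

definition decr :: "nat \<Rightarrow> nat \<times> nat \<times> nat \<Rightarrow> nat \<times> nat \<times> nat" where
  "decr i \<alpha> = (case \<alpha> of (a1, a2, a3) \<Rightarrow>
     if i = 1 then (a1 - 1, a2, a3) else if i = 2 then (a1, a2 - 1, a3) else (a1, a2, a3 - 1))"

text \<open>Dunkl operator T_i: it maps x^beta to (beta_i + 2 k_i [beta_i odd]) x^(beta - e_i).\<close>
definition Tdk :: "(nat \<Rightarrow> real) \<Rightarrow> nat \<Rightarrow> pv \<Rightarrow> pv" where
  "Tdk k i f = (\<lambda>(s, \<alpha>). (of_nat (ex i \<alpha> + 1)
        + (if odd (ex i \<alpha> + 1) then 2 * complex_of_real (k i) else 0)) * f (s, incr i \<alpha>))"

definition mulx :: "nat \<Rightarrow> pv \<Rightarrow> pv" where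
  "mulx i f = (\<lambda>(s, \<alpha>). if 1 \<le> ex i \<alpha> then f (s, decr i \<alpha>) else 0)"

definition Rf :: "nat \<Rightarrow> pv \<Rightarrow> pv" where
  "Rf i f = (\<lambda>(s, \<alpha>). (-1) ^ (ex i \<alpha>) * f (s, \<alpha>))"

text \<open>Action of e_i by the Pauli matrix sigma_i on the C^2 factor.\<close>
definition sig :: "nat \<Rightarrow> pv \<Rightarrow> pv" where
  "sig i f = (\<lambda>(s, \<alpha>).
     if i = 1 then (if s = 0 then f (1, \<alpha>) else if s = 1 then f (0, \<alpha>) else 0)
     else if i = 2 then (if s = 0 then - \<i> * f (1, \<alpha>) else if s = 1 then \<i> * f (0, \<alpha>) else 0)
     else (if s = 0 then f (0, \<alpha>) else if s = 1 then - f (1, \<alpha>) else 0))"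

definition Dirac :: "(nat \<Rightarrow> real) \<Rightarrow> pv \<Rightarrow> pv" where
  "Dirac k f = vadd (sig 1 (Tdk k 1 f)) (vadd (sig 2 (Tdk k 2 f)) (sig 3 (Tdk k 3 f)))"

definition homog :: "nat \<Rightarrow> pv set" where
  "homog n = {f. \<forall>s \<alpha>. f (s, \<alpha>) \<noteq> 0 \<longrightarrow> s < 2 \<and> ex 1 \<alpha> + ex 2 \<alpha> + ex 3 \<alpha> = n}"

definition Mn :: "(nat \<Rightarrow> real) \<Rightarrow> nat \<Rightarrow> pv set" where
  "Mn k n = {f \<in> homog n. Dirac k f = vzero}"

definition tt :: "real \<Rightarrow> enat" where
  "tt r = (if \<exists>m::nat. odd m \<and> 2 * r = - real m then enat (nat \<lfloor>- 2 * r\<rfloor>) else \<infinity>)"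

definition Mx :: "(nat \<Rightarrow> real) \<Rightarrow> nat \<Rightarrow> nat \<Rightarrow> pv set" where
  "Mx k n i = {f \<in> Mn k n. \<forall>s \<alpha>. f (s, \<alpha>) \<noteq> 0 \<longrightarrow> tt (k i) \<le> enat (ex i \<alpha>)}"

definition opG :: "(nat \<Rightarrow> real) \<Rightarrow> nat \<Rightarrow> nat \<Rightarrow> nat \<Rightarrow> pv \<Rightarrow> pv" where
  "opG k a p q f = (let g = Rf p (Rf q f) in
     vadd (smul \<i> (sig a (vsub (mulx q (Tdk k p g)) (mulx p (Tdk k q g)))))
      (vadd (smul (1/2) g)
        (vadd (smul (complex_of_real (k p)) (Rf q f)) (smul (complex_of_real (k q)) (Rf p f)))))"

definition Mmod :: "(nat \<Rightarrow> real) \<Rightarrow> nat \<Rightarrow> (nat \<times> (nat \<times> nat \<times> nat)) bimod" where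
  "Mmod k n = \<lparr> car = Mn k n, opX = opG k 1 2 3, opY = opG k 2 3 1, opZ = opG k 3 1 2 \<rparr>"

end

(* Consider a polynomial of degree n killed by the Dirac operator. The Dirac equation
   recovers all rows x3^c with c > t3 from the row x3^t3, and any such row extends
   (Cauchy-Kovalevskaya extension in x3) because the Dunkl factor of x3^t3 vanishes. A
   coefficient with two small exponents is zero. Hence the part of the row x3^t3 with small
   x1-exponent carries M_n / M_n(x1), the part with large x1- and x2-exponents carries M, and
   on both the Dirac equation turns X and Y into bidiagonal operators, once for each of the
   two components of the spinor. This gives A + A directly and E(a,-b,c) + E(a,-b,c) for M.
   Transposing variables, with a reflection of the spinors, yields the other two quotients as
   the modules A with permuted generators.

   It remains to compare bidiagonal modules. An eigenvector of Y which satisfies the split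
   relation in degree one generates a split basis, by induction from the relations of the
   algebra; running through the eigenvalues of X in the reversed order, or through those of
   Z instead of X, gives the required isomorphisms. The reversed basis also shows
   irreducibility when the first eigenvalue of X is simple. *)

theory Submission
  imports Defs
begin

section \<open>Modules and homomorphisms\<close>

text \<open>Comparing two bidiagonal modules starts from their central scalars. For E these are even
  in each of a, b, c; for O they are permuted together with a, b, c. Hence the candidates agree, and
  only the start and the end of a chain remain to be checked. For the reversed X the end is visible,
  since a product of all factors X - theta_i kills the first basis vector. For C the chain belongs
  to Z, which is tridiagonal in the split basis, and nothing similar is visible. There the end is
  proved for generic second parameter, when the eigenvalue of Y on the next vector is not in the
  spectrum, and carried over by continuity. The sign in E(a,-b,c) is removed by reversing the
  eigenvalues of Y: exchange X and Y, reverse X, exchange back. The exchange rescales by products of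
  split entries, so these must be nonzero; with k_i = -t_i/2 they factor into integers whose signs
  are controlled by n >= t1 + t2 + t3. Parts (v) to (vii) need the maps for two variables to be
  jointly onto. This holds because data with small x_1-exponent extend to polynomials in M_n(x_2)
  and M_n(x_3), on which the maps for x_2 and x_3 vanish.\<close>

lemmas vec_defs = vzero_def vadd_def vsub_def smul_def

definition bimodule :: "'i bimod \<Rightarrow> bool" where
  "bimodule U \<longleftrightarrow> subspace_in (car U)
     \<and> clin_on (car U) (opX U) \<and> clin_on (car U) (opY U) \<and> clin_on (car U) (opZ U)
     \<and> (\<forall>u\<in>car U. opX U u \<in> car U \<and> opY U u \<in> car U \<and> opZ U u \<in> car U)"

text \<open>The relations of the algebra for a module on which the central elements {Y,Z} - X, {Z,X}
  - Y and {X,Y} - Z act by the scalars \<open>\<kappa>\<close>, \<open>\<nu>\<close> and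
  \<open>\<mu>\<close>. They are written coordinatewise because the calculations below fix a
  coordinate.\<close>

definition bi_rel :: "'i bimod \<Rightarrow> complex \<Rightarrow> complex \<Rightarrow> complex \<Rightarrow> bool" where
  "bi_rel U \<kappa> \<nu> \<mu> \<longleftrightarrow> (\<forall>v\<in>car U. \<forall>j.
       opX U (opY U v) j + opY U (opX U v) j = opZ U v j + \<mu> * v j
     \<and> opX U (opZ U v) j + opZ U (opX U v) j = opY U v j + \<nu> * v j
     \<and> opY U (opZ U v) j + opZ U (opY U v) j = opX U v j + \<kappa> * v j)"

definition bi_hom :: "'i bimod \<Rightarrow> 'j bimod \<Rightarrow> (('i \<Rightarrow> complex) \<Rightarrow> 'j \<Rightarrow> complex) \<Rightarrow> bool" where
  "bi_hom U V f \<longleftrightarrow> clin_on (car U) f \<and> f ` car U \<subseteq> car V \<and> intertwines U V f"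

lemma subspace_lin:
  assumes "subspace_in S" "u \<in> S" "v \<in> S"
  shows "(\<lambda>j. a * u j + b * v j) \<in> S"
proof -
  have "vadd (smul a u) (smul b v) \<in> S"
    using assms unfolding subspace_in_def by blast
  then show ?thesis by (simp add: vec_defs)
qed

lemma clin_onD:
  assumes "clin_on S f" "subspace_in S" "u \<in> S" "v \<in> S"
  shows "f (\<lambda>j. a * u j + b * v j) = (\<lambda>j. a * f u j + b * f v j)"
proof -
  have "smul a u \<in> S" "smul b v \<in> S" using assms unfolding subspace_in_def by blast+
  then have "f (vadd (smul a u) (smul b v)) = vadd (smul a (f u)) (smul b (f v))"
    using assms unfolding clin_on_def by metis
  then show ?thesis by (simp add: vec_defs)
qed

lemma clin_on_zero:
  assumes "clin_on S f" "subspace_in S"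
  shows "f vzero = vzero"
proof -
  have "vzero \<in> S" using assms(2) unfolding subspace_in_def by blast
  then have "f (smul 0 vzero) = smul 0 (f vzero)" using assms(1) unfolding clin_on_def by blast
  then show ?thesis by (simp add: vec_defs)
qed

lemma clin_onI:
  assumes "\<And>a b u v. u \<in> S \<Longrightarrow> v \<in> S \<Longrightarrow> f (\<lambda>j. a * u j + b * v j) = (\<lambda>j. a * f u j + b * f v j)"
  shows "clin_on S f"
  unfolding clin_on_def
proof (intro conjI ballI allI)
  fix u v assume "u \<in> S" "v \<in> S"
  then show "f (vadd u v) = vadd (f u) (f v)"
    using assms[of u v 1 1] by (simp add: vec_defs)
next
  fix c u assume "u \<in> S"
  then show "f (smul c u) = smul c (f u)"
    using assms[of u u c 0] by (simp add: vec_defs)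
qed

lemma subspace_inI:
  assumes "S \<noteq> {}"
    and "\<And>a b u v. u \<in> S \<Longrightarrow> v \<in> S \<Longrightarrow> (\<lambda>j. a * u j + b * v j) \<in> S"
  shows "subspace_in S"
proof -
  obtain w where w: "w \<in> S" using assms(1) by blast
  show ?thesis
    unfolding subspace_in_def
    using assms(2)[OF w w, of 0 0] assms(2)[of _ _ 1 1] assms(2)[of _ _ _ 0]
    by (auto simp: vec_defs)
qed

lemma bimoduleD:
  assumes "bimodule U"
  shows "subspace_in (car U)" "clin_on (car U) (opX U)" "clin_on (car U) (opY U)"
    "clin_on (car U) (opZ U)"
    "u \<in> car U \<Longrightarrow> opX U u \<in> car U" "u \<in> car U \<Longrightarrow> opY U u \<in> car U"
    "u \<in> car U \<Longrightarrow> opZ U u \<in> car U"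
  using assms unfolding bimodule_def by blast+

lemma bi_homD:
  assumes "bi_hom U V f"
  shows "clin_on (car U) f" "u \<in> car U \<Longrightarrow> f u \<in> car V"
    "u \<in> car U \<Longrightarrow> f (opX U u) = opX V (f u)" "u \<in> car U \<Longrightarrow> f (opY U u) = opY V (f u)"
    "u \<in> car U \<Longrightarrow> f (opZ U u) = opZ V (f u)"
  using assms unfolding bi_hom_def intertwines_def by blast+

lemma bi_iso_alt:
  "bi_iso U V \<longleftrightarrow> (\<exists>f. bi_hom U V f \<and> bij_betw f (car U) (car V))"
  unfolding bi_iso_def bi_hom_def bij_betw_def by blast

lemma bi_hom_comp:
  assumes "bi_hom U V f" "bi_hom V W g"
  shows "bi_hom U W (\<lambda>u. g (f u))"
  using assms unfolding bi_hom_def intertwines_def clin_on_def by (auto simp: image_subset_iff)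

lemma bi_iso_trans [trans]:
  assumes "bi_iso U V" "bi_iso V W"
  shows "bi_iso U W"
proof -
  obtain f g where f: "bi_hom U V f" "bij_betw f (car U) (car V)"
    and g: "bi_hom V W g" "bij_betw g (car V) (car W)"
    using assms unfolding bi_iso_alt by blast
  have "bij_betw (\<lambda>u. g (f u)) (car U) (car W)"
    using bij_betw_trans[OF f(2) g(2)] by (simp add: comp_def)
  with bi_hom_comp[OF f(1) g(1)] show ?thesis unfolding bi_iso_alt by blast
qed

lemma bi_iso_sym:
  assumes "bi_iso U V" "bimodule U"
  shows "bi_iso V U"
proof -
  obtain f where f: "bi_hom U V f" "bij_betw f (car U) (car V)"
    using assms unfolding bi_iso_alt by blast
  note U = bimoduleD[OF assms(2)] and F = bi_homD[OF f(1)]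
  let ?g = "the_inv_into (car U) f"
  have inj: "inj_on f (car U)" and img: "f ` car U = car V" using f(2) unfolding bij_betw_def by auto
  have inv: "?g (f u) = u" if "u \<in> car U" for u using the_inv_into_f_f[OF inj that] .
  have ex: "\<exists>u\<in>car U. f u = v" if "v \<in> car V" for v using img that by (metis imageE)
  have add: "vadd u v \<in> car U" and mul: "smul c u \<in> car U" if "u \<in> car U" "v \<in> car U" for u v c
    using U(1) that unfolding subspace_in_def by blast+
  have "clin_on (car V) ?g"
    unfolding clin_on_def
  proof (intro conjI ballI allI)
    fix x y assume "x \<in> car V" "y \<in> car V"
    then obtain u v where uv: "u \<in> car U" "x = f u" "v \<in> car U" "y = f v" using ex by metis
    then have "vadd x y = f (vadd u v)" using F(1) unfolding clin_on_def by metis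
    then show "?g (vadd x y) = vadd (?g x) (?g y)" using uv inv add by simp
  next
    fix c x assume "x \<in> car V"
    then obtain u where u: "u \<in> car U" "x = f u" using ex by metis
    then have "smul c x = f (smul c u)" using F(1) unfolding clin_on_def by metis
    then show "?g (smul c x) = smul c (?g x)" using u inv mul by simp
  qed
  moreover have "bij_betw ?g (car V) (car U)" using bij_betw_the_inv_into[OF f(2)] .
  moreover have "intertwines V U ?g"
    unfolding intertwines_def
  proof
    fix x assume "x \<in> car V"
    then obtain u where u: "u \<in> car U" "x = f u" using ex by metis
    then have "opX V x = f (opX U u)" "opY V x = f (opY U u)" "opZ V x = f (opZ U u)"
      using F by auto
    then show "?g (opX V x) = opX U (?g x) \<and> ?g (opY V x) = opY U (?g x) \<and> ?g (opZ V x) = opZ U (?g x)"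
      using u inv U by simp
  qed
  ultimately show ?thesis unfolding bi_iso_def by blast
qed

text \<open>The compatibility of the diagonals t, s and the split sequence phi with the scalars
  by which the three central elements act.  The number zeta encodes the diagonal
  (-1)^i zeta - 1/2 of Z in the split basis.\<close>
definition bi_sys :: "(nat \<Rightarrow> complex) \<Rightarrow> (nat \<Rightarrow> complex) \<Rightarrow> (nat \<Rightarrow> complex) \<Rightarrow>
    complex \<Rightarrow> complex \<Rightarrow> complex \<Rightarrow> complex \<Rightarrow> bool" where
  "bi_sys t s \<phi> \<kappa> \<nu> \<mu> \<zeta> \<longleftrightarrow> \<phi> 0 = 0 \<and> (\<forall>i.
       t i + t (Suc i) = - ((-1) ^ i) \<and> s i + s (Suc i) = - ((-1) ^ i)
     \<and> 2 * t i * s i + \<phi> i + \<phi> (Suc i) - \<mu> = (-1) ^ i * \<zeta> - 1/2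
     \<and> 2 * t i * ((-1) ^ i * \<zeta> - 1/2) - (-1) ^ i * (\<phi> (Suc i) - \<phi> i) = s i + \<nu>
     \<and> 2 * s i * ((-1) ^ i * \<zeta> - 1/2) - (-1) ^ i * (\<phi> (Suc i) - \<phi> i) = t i + \<kappa>)"

text \<open>Once Y is known on w_i and w_(i+1), the relation for {X,Y} on w_i gives Z w_i, the
  relation for {X,Z} on w_i gives Z w_(i+1), and {X,Y} on w_(i+1) gives Y w_(i+2). So the formula
  for Y propagates from degrees zero and one along the whole infinite chain.\<close>

lemma split_chain:
  assumes U: "bimodule U" and rel: "bi_rel U \<kappa>' \<nu> \<mu>"
    and sys: "bi_sys t s \<phi> \<kappa> \<nu> \<mu> \<zeta>"
    and w0: "w 0 \<in> car U"
    and wS: "\<And>i j. w (Suc i) j = opX U (w i) j - t i * w i j"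
    and Y0: "\<And>j. opY U (w 0) j = s 0 * w 0 j"
    and Y1: "\<And>j. opY U (w 1) j = s 1 * w 1 j + \<phi> 1 * w 0 j"
  shows "w i \<in> car U" and "opY U (w i) = (\<lambda>j. s i * w i j + \<phi> i * w (i - 1) j)"
proof -
  note D = bimoduleD[OF U]
  have wU: "w i \<in> car U" for i
  proof (induction i)
    case (Suc i)
    have "w (Suc i) = (\<lambda>j. 1 * opX U (w i) j + (- t i) * w i j)" by (auto simp: wS)
    with subspace_lin[OF D(1) D(5)[OF Suc] Suc] show ?case by metis
  qed (rule w0)
  then show "w i \<in> car U" .
  have X: "opX U (w i) = (\<lambda>j. t i * w i j + 1 * w (Suc i) j)" for i by (auto simp: wS)
  have \<phi>0: "\<phi> 0 = 0"
    and ts: "t i + t (Suc i) = - ((-1) ^ i)" "s i + s (Suc i) = - ((-1) ^ i)"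
    and z: "2 * t i * s i + \<phi> i + \<phi> (Suc i) - \<mu> = (-1) ^ i * \<zeta> - 1/2"
    and l: "2 * t i * ((-1) ^ i * \<zeta> - 1/2) - (-1) ^ i * (\<phi> (Suc i) - \<phi> i) = s i + \<nu>" for i
    using sys unfolding bi_sys_def by blast+
  have t: "t (Suc i) = - ((-1) ^ i) - t i" and s: "s (Suc i) = - ((-1) ^ i) - s i" for i
    using ts[of i] by (metis add_diff_cancel_left')+
  define P where "P i \<longleftrightarrow> opY U (w i) = (\<lambda>j. s i * w i j + \<phi> i * w (i - 1) j)" for i
  \<comment> \<open>At i = 0 the truncated index i - 1 is again 0. Facts about w (i - 1) therefore
    carry the factor \<open>\<phi> i\<close>, which vanishes there.\<close>
  have \<phi>X: "\<phi> i * opX U (w (i - 1)) j = \<phi> i * (t (i - 1) * w (i - 1) j + w i j)" for i j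
    using X \<phi>0 by (cases i) auto
  have \<phi>t: "\<phi> i * t (i - 1) = \<phi> i * ((-1) ^ i - t i)" for i
    using t[of "i - 1"] \<phi>0 by (cases i) auto
  have XY: "opX U (opY U (w i)) j = s i * opX U (w i) j + \<phi> i * opX U (w (i - 1)) j"
    if "P i" for i j
    using that unfolding P_def by (simp add: clin_onD[OF D(2) D(1)] wU)
  have YX: "opY U (opX U (w i)) j = t i * opY U (w i) j + opY U (w (Suc i)) j" for i j
    unfolding X by (subst clin_onD[OF D(3) D(1)]) (auto simp: wU)
  have ZX: "opZ U (opX U (w i)) j = t i * opZ U (w i) j + opZ U (w (Suc i)) j" for i j
    unfolding X by (subst clin_onD[OF D(4) D(1)]) (auto simp: wU)
  have R1: "opX U (opY U (w i)) j + opY U (opX U (w i)) j = opZ U (w i) j + \<mu> * w i j"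
    and R2: "opX U (opZ U (w i)) j + opZ U (opX U (w i)) j = opY U (w i) j + \<nu> * w i j" for i j
    using rel wU unfolding bi_rel_def by blast+
  have P0: "P 0" unfolding P_def using Y0 \<phi>0 by auto
  have P1: "P 1" unfolding P_def using Y1 by auto
  have step: "P (Suc (Suc i))" if Pi: "P i" and PS: "P (Suc i)" for i
  proof -
    \<comment> \<open>The sign becomes an indeterminate with e * e = 1, so that the concluding
      identity is a polynomial one for \<open>algebra\<close>.\<close>
    define e where "e = ((-1) ^ i :: complex)"
    have e2: "e * e = 1" by (simp add: e_def flip: power_mult_distrib)
    \<comment> \<open>Z is tridiagonal on the chain: the coefficients of w_(i+1) and w_(i-1) are
      sums of two consecutive diagonal entries of Y and of X, hence signs up to
      \<open>\<phi> i\<close>.\<close>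
    have Zw: "opZ U (w i) j = (- e) * w (Suc i) j + ((e * \<zeta> - 1/2) * w i j + e * \<phi> i * w (i - 1) j)" for j
    proof -
      define A where "A = opX U (w (i - 1)) j"
      have yS: "opY U (w (Suc i)) j = s (Suc i) * w (Suc i) j + \<phi> (Suc i) * w i j"
        and y: "opY U (w i) j = s i * w i j + \<phi> i * w (i - 1) j"
        using Pi PS unfolding P_def by auto
      have x: "opX U (w i) j = t i * w i j + w (Suc i) j" using X by simp
      have r: "opZ U (w i) j = s i * (t i * w i j + w (Suc i) j) + \<phi> i * A
          + (t i * (s i * w i j + \<phi> i * w (i - 1) j) + (s (Suc i) * w (Suc i) j + \<phi> (Suc i) * w i j))
          - \<mu> * w i j"
        using R1[of i j] unfolding XY[OF Pi] YX yS y x A_def by (metis add_diff_cancel)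
      have A: "\<phi> i * A = \<phi> i * t (i - 1) * w (i - 1) j + \<phi> i * w i j"
        unfolding \<phi>X[of i j, folded A_def] by (simp add: algebra_simps)
      have "opZ U (w i) j = (s i + s (Suc i)) * w (Suc i) j
          + (2 * t i * s i + \<phi> i + \<phi> (Suc i) - \<mu>) * w i j
          + \<phi> i * t (i - 1) * w (i - 1) j + t i * \<phi> i * w (i - 1) j"
        unfolding r A by (simp add: algebra_simps)
      then show ?thesis
        unfolding z ts \<phi>t e_def by (simp add: algebra_simps)
    qed
    have XZ: "opX U (opZ U (w i)) j = (- e) * opX U (w (Suc i)) j
        + ((e * \<zeta> - 1/2) * opX U (w i) j + e * \<phi> i * opX U (w (i - 1)) j)" for j
    proof -
      have 0: "(\<lambda>j. (e * \<zeta> - 1/2) * w i j + e * \<phi> i * w (i - 1) j) \<in> car U"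
        by (intro subspace_lin D wU)
      have "opZ U (w i) = (\<lambda>j. (- e) * w (Suc i) j + 1 * ((e * \<zeta> - 1/2) * w i j + e * \<phi> i * w (i - 1) j))"
        using Zw by auto
      then show ?thesis
        by (simp only: clin_onD[OF D(2) D(1) wU 0] clin_onD[OF D(2) D(1) wU wU]) simp
    qed
    have "opY U (w (Suc (Suc i))) j = s (Suc (Suc i)) * w (Suc (Suc i)) j + \<phi> (Suc (Suc i)) * w (Suc i) j" for j
    proof -
      define W3 W2 W1 W0 where "W3 = w (Suc (Suc i)) j" and "W2 = w (Suc i) j"
        and "W1 = w i j" and "W0 = w (i - 1) j"
      have x2: "opX U (w (Suc i)) j = t (Suc i) * W2 + W3" and x1: "opX U (w i) j = t i * W1 + W2"
        using X by (auto simp: W3_def W2_def W1_def)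
      have y2: "opY U (w (Suc i)) j = s (Suc i) * W2 + \<phi> (Suc i) * W1"
        and y1: "opY U (w i) j = s i * W1 + \<phi> i * W0"
        using Pi PS unfolding P_def by (auto simp: W2_def W1_def W0_def)
      have z1: "opZ U (w i) j = (- e) * W2 + ((e * \<zeta> - 1/2) * W1 + e * \<phi> i * W0)"
        using Zw by (simp add: W2_def W1_def W0_def)
      have f: "\<phi> i * opX U (w (i - 1)) j = \<phi> i * (e - t i) * W0 + \<phi> i * W1"
        unfolding \<phi>X e_def W0_def W1_def \<phi>t[symmetric] by (simp add: algebra_simps)
      have xz: "opX U (opZ U (w i)) j = (- e) * (t (Suc i) * W2 + W3)
        + ((e * \<zeta> - 1/2) * (t i * W1 + W2) + e * (\<phi> i * (e - t i) * W0 + \<phi> i * W1))"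
        using XZ[of j] x2 x1 f by (simp add: mult.assoc)
      have solve: "A + (B + Z) = D \<Longrightarrow> Z = D - A - B" for A B Z D :: complex
        by (auto simp: algebra_simps)
      have zz: "opZ U (w (Suc i)) j = s i * W1 + \<phi> i * W0 + \<nu> * W1
          - ((- e) * (t (Suc i) * W2 + W3)
        + ((e * \<zeta> - 1/2) * (t i * W1 + W2) + e * (\<phi> i * (e - t i) * W0 + \<phi> i * W1)))
          - t i * ((- e) * W2 + ((e * \<zeta> - 1/2) * W1 + e * \<phi> i * W0))"
        using solve[OF R2[of i j, unfolded ZX xz y1 z1, folded W1_def]] .
      have yy: "opY U (w (Suc (Suc i))) j = opZ U (w (Suc i)) j + \<mu> * W2
          - (s (Suc i) * (t (Suc i) * W2 + W3) + \<phi> (Suc i) * (t i * W1 + W2))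
          - t (Suc i) * (s (Suc i) * W2 + \<phi> (Suc i) * W1)"
        using solve[OF R1[of "Suc i" j, unfolded XY[OF PS, simplified] YX x1 x2 y2, folded W2_def]] .
      have t1: "t (Suc i) = - e - t i" and s1: "s (Suc i) = - e - s i"
        and s2: "s (Suc (Suc i)) = e - s (Suc i)"
        using t s by (auto simp: e_def)
      have f2: "\<phi> (Suc (Suc i)) = - e * \<zeta> - 1/2 + \<mu> - \<phi> (Suc i) - 2 * t (Suc i) * s (Suc i)"
        using z[of "Suc i"] by (simp add: e_def algebra_simps)
      have l1: "\<nu> = 2 * t i * (e * \<zeta> - 1/2) - e * (\<phi> (Suc i) - \<phi> i) - s i"
        using l[of i] by (simp add: e_def algebra_simps)
      show ?thesis
        unfolding yy zz f2 s2 l1 W3_def[symmetric] W2_def[symmetric] t1 s1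
        using e2 by algebra
    qed
    then show ?thesis unfolding P_def by auto
  qed
  have "P i \<and> P (Suc i)" for i
    by (induction i) (use P0 P1 step in auto)
  then show "opY U (w i) = (\<lambda>j. s i * w i j + \<phi> i * w (i - 1) j)" unfolding P_def by blast
qed

section \<open>Bidiagonal modules\<close>

lemma theta_Suc: "theta d a i + theta d a (Suc i) = - ((-1) ^ i)"
  unfolding theta_def by (simp add: field_simps)

lemma bimat_car [simp]: "car (bimat d a b \<phi> c) = {v. \<forall>i>d. v i = 0}"
  unfolding bimat_def Let_def by simp

lemma bimat_X: "opX (bimat d a b \<phi> c) v i
    = (if i \<le> d then theta d a i * v i + (if 1 \<le> i then v (i - 1) else 0) else 0)"
  unfolding bimat_def Let_def by simp

lemma bimat_Y: "opY (bimat d a b \<phi> c) v i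
    = (if i \<le> d then theta d b i * v i + (if i < d then \<phi> (Suc i) * v (Suc i) else 0) else 0)"
  unfolding bimat_def Let_def by (simp add: Suc_le_eq)

lemma bimat_Z: "opZ (bimat d a b \<phi> c) v i
    = opX (bimat d a b \<phi> c) (opY (bimat d a b \<phi> c) v) i
      + opY (bimat d a b \<phi> c) (opX (bimat d a b \<phi> c) v) i - c * v i"
  unfolding bimat_def Let_def vec_defs by simp

lemma bimat_subspace: "subspace_in (car (bimat d a b \<phi> c))"
  unfolding subspace_in_def vec_defs by auto

lemma bimat_bimodule: "bimodule (bimat d a b \<phi> c)"
  unfolding bimodule_def
proof (intro conjI ballI)
  let ?V = "bimat d a b \<phi> c"
  have X: "opX ?V (\<lambda>j. p * u j + q * v j) = (\<lambda>j. p * opX ?V u j + q * opX ?V v j)" for p q u v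
    by (auto simp: bimat_X algebra_simps)
  have Y: "opY ?V (\<lambda>j. p * u j + q * v j) = (\<lambda>j. p * opY ?V u j + q * opY ?V v j)" for p q u v
    by (auto simp: bimat_Y algebra_simps)
  have Z: "opZ ?V (\<lambda>j. p * u j + q * v j) = (\<lambda>j. p * opZ ?V u j + q * opZ ?V v j)" for p q u v
    by (auto simp: bimat_Z X Y algebra_simps)
  show "clin_on (car ?V) (opX ?V)" "clin_on (car ?V) (opY ?V)" "clin_on (car ?V) (opZ ?V)"
    by (auto intro!: clin_onI simp only: X Y Z)
  show "subspace_in (car ?V)" by (rule bimat_subspace)
qed (auto simp: bimat_X bimat_Y bimat_Z)

text \<open>An off-diagonal entry of {X,Y} is an entry of one matrix times the sum of two
  consecutive diagonal entries of the other, and that sum is a sign. In the last row the matrix Y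
  has no entry \<open>\<phi> (Suc d)\<close>, so the general formula for the diagonal holds there
  because this number is 0.\<close>

lemma bimat_Z_coord:
  assumes "bi_sys (theta d a) (theta d b) \<phi> \<kappa> \<nu> \<mu> \<zeta>" and "\<phi> (Suc d) = 0" and True: "i \<le> d"
  shows "opZ (bimat d a b \<phi> \<mu>) v i =
    ((-1) ^ i * \<zeta> - 1/2) * v i + (if 1 \<le> i then (-1) ^ i * v (i - 1) else 0)
       - (if i < d then (-1) ^ i * \<phi> (Suc i) * v (Suc i) else 0)"
proof -
  let ?t = "theta d a" and ?s = "theta d b"
  have z: "(-1) ^ i * \<zeta> - 1/2 = 2 * ?t i * ?s i + \<phi> i + \<phi> (Suc i) - \<mu>" and \<phi>0: "\<phi> 0 = 0"
    using assms(1) unfolding bi_sys_def by metis+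
  have tS: "?t (Suc i) = - ((-1) ^ i) - ?t i" using theta_Suc[of d a i] by (metis add_diff_cancel_left')
  show ?thesis
  proof (cases i)
    case 0
    have t1: "?t (Suc 0) = - 1 - ?t 0" using tS 0 by simp
    show ?thesis
      unfolding z using 0 \<phi>0 assms(2)
      by (cases "i = d") (auto simp: bimat_Z bimat_X bimat_Y t1 algebra_simps)
  next
    case (Suc k)
    have sS: "?s i = (-1) ^ i - ?s (i - 1)"
      using theta_Suc[of d b k] Suc by (simp add: algebra_simps)
    have iS: "\<not> i - 1 > d" "i - 1 < d" "Suc (i - 1) = i" "i - 1 \<le> d" "1 \<le> i" using True Suc by auto
    show ?thesis
    proof (cases "i < d")
      case False
      then have i: "i = d" using True by simp
      have \<phi>S: "\<phi> (Suc i) = 0" using assms(2) i by simp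
      show ?thesis
        unfolding z bimat_Z bimat_X bimat_Y \<phi>S
        apply (simp only: True False iS if_True if_False)
        unfolding sS by (simp add: algebra_simps)
    next
      case iltd: True
      then have "Suc i \<le> d" "1 \<le> Suc i" "Suc i - 1 = i" by auto
      then show ?thesis
        unfolding z bimat_Z bimat_X bimat_Y
        apply (simp only: True iltd iS if_True if_False)
        unfolding sS tS by (simp add: algebra_simps)
    qed
  qed
qed

text \<open>With Z tridiagonal, both remaining relations are compared entry by entry. The outermost
  entries cancel because the signs on the off-diagonals of Z alternate; the diagonal entries are the
  last two equations of \<open>bi_sys\<close>.\<close>

lemma bimat_rel:
  assumes sys: "bi_sys (theta d a) (theta d b) \<phi> \<kappa> \<nu> \<mu> \<zeta>" and \<phi>d: "\<phi> (Suc d) = 0"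
  shows "bi_rel (bimat d a b \<phi> \<mu>) \<kappa> \<nu> \<mu>"
  unfolding bi_rel_def
proof (intro ballI allI conjI)
  fix v j assume "v \<in> car (bimat d a b \<phi> \<mu>)"
  then have v0: "v i = 0" if "i > d" for i using that by simp
  let ?V = "bimat d a b \<phi> \<mu>" and ?t = "theta d a" and ?s = "theta d b"
  show "opX ?V (opY ?V v) j + opY ?V (opX ?V v) j = opZ ?V v j + \<mu> * v j"
    by (simp add: bimat_Z)
  note Z = bimat_Z_coord[OF sys \<phi>d]
  have \<phi>0: "\<phi> 0 = 0" using sys unfolding bi_sys_def by blast
  define e where "e = ((-1) ^ j :: complex)"
  have e2: "e * e = 1" by (simp add: e_def flip: power_mult_distrib)
  define z where "z = e * \<zeta> - 1/2"
  have l: "2 * ?t j * z - e * (\<phi> (Suc j) - \<phi> j) = ?s j + \<nu>"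
    and k: "2 * ?s j * z - e * (\<phi> (Suc j) - \<phi> j) = ?t j + \<kappa>"
    using sys unfolding bi_sys_def z_def e_def by blast+
  have tS: "?t (Suc j) = - e - ?t j" and sS: "?s (Suc j) = - e - ?s j"
    using theta_Suc[of d a j] theta_Suc[of d b j] unfolding e_def by (metis add_diff_cancel_left')+
  have tP: "?t (j - 1) = e - ?t j" and sP: "?s (j - 1) = e - ?s j"
    and eP: "(-1) ^ (j - 1) = - e" if "1 \<le> j"
    using theta_Suc[of d a "j - 1"] theta_Suc[of d b "j - 1"] that unfolding e_def
    by (cases j; auto simp: algebra_simps)+
  show "opX ?V (opZ ?V v) j + opZ ?V (opX ?V v) j = opY ?V v j + \<nu> * v j"
  proof (cases "j \<le> d")
    case True
    have XZ: "opX ?V (opZ ?V v) j = ?t j * opZ ?V v j + (if 1 \<le> j then opZ ?V v (j - 1) else 0)"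
      using True by (simp add: bimat_X)
    have ZX: "opZ ?V (opX ?V v) j = z * opX ?V v j + (if 1 \<le> j then e * opX ?V v (j - 1) else 0)
        - (if j < d then e * \<phi> (Suc j) * opX ?V v (Suc j) else 0)"
      using True by (simp add: Z z_def e_def)
    have Zj: "opZ ?V v j = z * v j + (if 1 \<le> j then e * v (j - 1) else 0)
        - (if j < d then e * \<phi> (Suc j) * v (Suc j) else 0)"
      using True by (simp add: Z z_def e_def)
    have Zp: "opZ ?V v (j - 1) = (- 1 - z) * v (j - 1) - (if 2 \<le> j then e * v (j - 2) else 0)
        + e * \<phi> j * v j" if "1 \<le> j"
      using True that eP by (auto simp: Z z_def numeral_2_eq_2 algebra_simps)
    have Xp: "opX ?V v (j - 1) = (e - ?t j) * v (j - 1) + (if 2 \<le> j then v (j - 2) else 0)" if "1 \<le> j"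
      using True that tP by (auto simp: bimat_X numeral_2_eq_2)
    have Xj: "opX ?V v j = ?t j * v j + (if 1 \<le> j then v (j - 1) else 0)"
      using True by (simp add: bimat_X)
    have XS: "opX ?V v (Suc j) = (- e - ?t j) * v (Suc j) + v j" if "j < d"
      using that by (simp add: bimat_X tS)
    have Yj: "opY ?V v j = ?s j * v j + (if j < d then \<phi> (Suc j) * v (Suc j) else 0)"
      using True by (simp add: bimat_Y)
    have l': "\<nu> = 2 * ?t j * z - e * (\<phi> (Suc j) - \<phi> j) - ?s j" using l by (simp add: algebra_simps)
    \<comment> \<open>P, Q, R, S hold everything that comes from coordinates below j. They enter
      through a single linear combination, evaluated in \<open>low\<close>, which also absorbs the
      boundary case j = 0.\<close>
    have *: "?t j * (z * v j + P - e * \<phi> (Suc j) * V) + Q + (z * (?t j * v j + R) + S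
         - e * \<phi> (Suc j) * ((- e - ?t j) * V + v j))
         = (?s j * v j + \<phi> (Suc j) * V) + \<nu> * v j"
      if "?t j * P + Q + z * R + S = e * \<phi> j * v j" for P Q R S V
      unfolding l' using that e2 by algebra
    have **: "?t j * (z * v j + P) + Q + (z * (?t j * v j + R) + S) = ?s j * v j + \<nu> * v j"
      if "?t j * P + Q + z * R + S = e * \<phi> j * v j" "\<phi> (Suc j) = 0" for P Q R S
      unfolding l' using that e2 by algebra
    define P Q R S where "P = (if 1 \<le> j then e * v (j - 1) else 0)"
      and "Q = (if 1 \<le> j then opZ ?V v (j - 1) else 0)"
      and "R = (if 1 \<le> j then v (j - 1) else 0)"
      and "S = (if 1 \<le> j then e * opX ?V v (j - 1) else 0)"
    have low: "?t j * P + Q + z * R + S = e * \<phi> j * v j"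
    proof (cases "1 \<le> j")
      case True
      define W where "W = (if 2 \<le> j then v (j - 2) else 0)"
      have "(if 2 \<le> j then e * v (j - 2) else 0) = e * W" by (simp add: W_def)
      show ?thesis
        unfolding P_def Q_def R_def S_def if_P[OF True] Zp[OF True] Xp[OF True] W_def[symmetric]
          \<open>(if 2 \<le> j then e * v (j - 2) else 0) = e * W\<close>
        using e2 by algebra
    next
      case False
      then have "j = 0" by simp
      then show ?thesis by (simp add: P_def Q_def R_def S_def \<phi>0)
    qed
    show ?thesis
    proof (cases "j < d")
      case True
      show ?thesis
        unfolding XZ ZX Zj Xj Yj P_def[symmetric] Q_def[symmetric] R_def[symmetric] S_def[symmetric]
        using *[OF low] True by (simp add: XS)
    next
      case False
      then have "j = d" using \<open>j \<le> d\<close> by simp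
      then show ?thesis
        unfolding XZ ZX Zj Xj Yj P_def[symmetric] Q_def[symmetric] R_def[symmetric] S_def[symmetric]
        using **[OF low] \<phi>d by simp
    qed
  qed (use v0 in \<open>simp add: bimat_X bimat_Y bimat_Z\<close>)
  show "opY ?V (opZ ?V v) j + opZ ?V (opY ?V v) j = opX ?V v j + \<kappa> * v j"
  proof (cases "j \<le> d")
    case True
    have YZ: "opY ?V (opZ ?V v) j = ?s j * opZ ?V v j + (if j < d then \<phi> (Suc j) * opZ ?V v (Suc j) else 0)"
      using True by (simp add: bimat_Y)
    have ZY: "opZ ?V (opY ?V v) j = z * opY ?V v j + (if 1 \<le> j then e * opY ?V v (j - 1) else 0)
        - (if j < d then e * \<phi> (Suc j) * opY ?V v (Suc j) else 0)"
      using True by (simp add: Z z_def e_def)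
    have Zj: "opZ ?V v j = z * v j + (if 1 \<le> j then e * v (j - 1) else 0)
        - (if j < d then e * \<phi> (Suc j) * v (Suc j) else 0)"
      using True by (simp add: Z z_def e_def)
    have ZS: "opZ ?V v (Suc j) = (- 1 - z) * v (Suc j) - e * v j
        + (if Suc j < d then e * \<phi> (Suc (Suc j)) * v (Suc (Suc j)) else 0)" if "j < d"
      using True that by (auto simp: Z z_def e_def algebra_simps)
    have Yp: "opY ?V v (j - 1) = (e - ?s j) * v (j - 1) + \<phi> j * v j" if "1 \<le> j"
      using True that sP by (auto simp: bimat_Y)
    have Xj: "opX ?V v j = ?t j * v j + (if 1 \<le> j then v (j - 1) else 0)"
      using True by (simp add: bimat_X)
    have YS: "opY ?V v (Suc j) = (- e - ?s j) * v (Suc j)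
        + (if Suc j < d then \<phi> (Suc (Suc j)) * v (Suc (Suc j)) else 0)" if "j < d"
      using that by (simp add: bimat_Y sS)
    have Yj: "opY ?V v j = ?s j * v j + (if j < d then \<phi> (Suc j) * v (Suc j) else 0)"
      using True by (simp add: bimat_Y)
    have k': "\<kappa> = 2 * ?s j * z - e * (\<phi> (Suc j) - \<phi> j) - ?t j" using k by (simp add: algebra_simps)
    define P R where "P = (if 1 \<le> j then v (j - 1) else 0)"
      and "R = (if 1 \<le> j then e * opY ?V v (j - 1) else 0)"
    have P': "(if 1 \<le> j then e * v (j - 1) else 0) = e * P" by (simp add: P_def)
    have R': "R = e * (e - ?s j) * P + e * \<phi> j * v j"
    proof (cases "1 \<le> j")
      case True
      then show ?thesis unfolding R_def P_def by (simp add: Yp[OF True, simplified] algebra_simps)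
    next
      case False
      then have "j = 0" by simp
      then show ?thesis by (simp add: R_def P_def \<phi>0)
    qed
    show ?thesis
    proof (cases "j < d")
      case True
      define W where "W = (if Suc j < d then \<phi> (Suc (Suc j)) * v (Suc (Suc j)) else 0)"
      have W': "(if Suc j < d then e * \<phi> (Suc (Suc j)) * v (Suc (Suc j)) else 0) = e * W"
        by (simp add: W_def)
      show ?thesis
        unfolding YZ ZY Zj Xj Yj ZS[OF True] YS[OF True] P' P_def[symmetric] R_def[symmetric]
          R' W' W_def[symmetric] k'
        apply (simp only: True if_True)
        using e2 by algebra
    next
      case False
      then have j: "j = d" using \<open>j \<le> d\<close> by simp
      have \<phi>S: "\<phi> (Suc j) = 0" using \<phi>d j by simp
      show ?thesis
        unfolding YZ ZY Zj Xj Yj P' P_def[symmetric] R_def[symmetric] R' k' \<phi>S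
        apply (simp only: False if_False)
        using e2 by algebra
    qed
  qed (use v0 in \<open>simp add: bimat_X bimat_Y bimat_Z\<close>)
qed

definition std :: "nat \<Rightarrow> nat \<Rightarrow> complex" where "std m = (\<lambda>i. if i = m then 1 else 0)"

lemma clin_on_sum:
  fixes d :: nat
  assumes "clin_on S f" "subspace_in S" "\<And>i. i \<le> d \<Longrightarrow> w i \<in> S"
  shows "(\<lambda>j. \<Sum>i\<le>d. c i * w i j) \<in> S"
    and "f (\<lambda>j. \<Sum>i\<le>d. c i * w i j) = (\<lambda>j. \<Sum>i\<le>d. c i * f (w i) j)"
proof -
  have "(\<lambda>j. \<Sum>i\<le>d. c i * w i j) \<in> S
      \<and> f (\<lambda>j. \<Sum>i\<le>d. c i * w i j) = (\<lambda>j. \<Sum>i\<le>d. c i * f (w i) j)"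
    using assms(3)
  proof (induction d)
    case 0
    then have w: "w 0 \<in> S" by simp
    then show ?case
      using subspace_lin[OF assms(2) w w, of "c 0" 0] clin_onD[OF assms(1,2) w w, of "c 0" 0] by simp
  next
    case (Suc d)
    let ?u = "\<lambda>j. \<Sum>i\<le>d. c i * w i j"
    have IH: "?u \<in> S" "f ?u = (\<lambda>j. \<Sum>i\<le>d. c i * f (w i) j)" and w: "w (Suc d) \<in> S"
      using Suc by auto
    then show ?case
      using subspace_lin[OF assms(2) IH(1) w, of 1 "c (Suc d)"]
        clin_onD[OF assms(1,2) IH(1) w, of 1 "c (Suc d)"] by simp
  qed
  then show "(\<lambda>j. \<Sum>i\<le>d. c i * w i j) \<in> S"
    "f (\<lambda>j. \<Sum>i\<le>d. c i * w i j) = (\<lambda>j. \<Sum>i\<le>d. c i * f (w i) j)" by auto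
qed

text \<open>The map sends the i-th standard vector to w_i, and \<open>w (Suc d) = vzero\<close>
  reflects that X multiplies the last standard vector by a scalar. No condition on Z is imposed on
  the w_i, because on both sides Z is {X,Y} minus the same scalar.\<close>

lemma bimat_homI:
  fixes w :: "nat \<Rightarrow> 'j \<Rightarrow> complex"
  assumes U: "bimodule U"
    and Z: "\<And>v j. v \<in> car U \<Longrightarrow> opX U (opY U v) j + opY U (opX U v) j = opZ U v j + \<mu> * v j"
    and wU: "\<And>i. i \<le> d \<Longrightarrow> w i \<in> car U" and wd: "w (Suc d) = vzero"
    and X: "\<And>i j. i \<le> d \<Longrightarrow> opX U (w i) j = theta d a i * w i j + w (Suc i) j"
    and Y: "\<And>i j. i \<le> d \<Longrightarrow> opY U (w i) j = theta d b i * w i j + (if i = 0 then 0 else \<phi> i * w (i - 1) j)"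
  shows "bi_hom (bimat d a b \<phi> \<mu>) U (\<lambda>v j. \<Sum>i\<le>d. v i * w i j)"
proof -
  let ?V = "bimat d a b \<phi> \<mu>" and ?f = "\<lambda>v j. \<Sum>i\<le>d. v i * w i j"
  note D = bimoduleD[OF U] and V = bimoduleD[OF bimat_bimodule[of d a b \<phi> \<mu>]]
  have fU: "?f v \<in> car U" for v using clin_on_sum(1)[OF D(2,1) wU] .
  have fX: "?f (opX ?V v) = opX U (?f v)" for v
  proof
    fix j
    have "(\<Sum>i\<le>d. v i * w (Suc i) j) = (\<Sum>i\<le>d. (if 1 \<le> i then v (i - 1) else 0) * w i j)"
    proof -
      have "(\<Sum>i\<le>d. v i * w (Suc i) j) = (\<Sum>i<d. v i * w (Suc i) j)"
        using wd unfolding lessThan_Suc_atMost[symmetric] sum.lessThan_Suc by (simp add: vzero_def)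
      also have "\<dots> = (\<Sum>i\<le>d. (if 1 \<le> i then v (i - 1) else 0) * w i j)"
        unfolding lessThan_Suc_atMost[symmetric] sum.lessThan_Suc_shift by simp
      finally show ?thesis .
    qed
    then have "(\<Sum>i\<le>d. v i * (theta d a i * w i j + w (Suc i) j))
        = (\<Sum>i\<le>d. opX ?V v i * w i j)"
      by (simp add: bimat_X algebra_simps sum.distrib)
    then show "?f (opX ?V v) j = opX U (?f v) j"
      using clin_on_sum(2)[OF D(2,1) wU, where d = d and c = v] X by simp
  qed
  have fY: "?f (opY ?V v) = opY U (?f v)" for v
  proof
    fix j
    have "(\<Sum>i\<le>d. v i * (if i = 0 then 0 else \<phi> i * w (i - 1) j))
        = (\<Sum>i\<le>d. (if i < d then \<phi> (Suc i) * v (Suc i) else 0) * w i j)"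
    proof -
      have "(\<Sum>i\<le>d. v i * (if i = 0 then 0 else \<phi> i * w (i - 1) j))
          = (\<Sum>i<d. v (Suc i) * (\<phi> (Suc i) * w i j))"
        unfolding lessThan_Suc_atMost[symmetric] sum.lessThan_Suc_shift by simp
      also have "\<dots> = (\<Sum>i\<le>d. (if i < d then \<phi> (Suc i) * v (Suc i) else 0) * w i j)"
        unfolding lessThan_Suc_atMost[symmetric] sum.lessThan_Suc by (simp add: mult_ac)
      finally show ?thesis .
    qed
    then have "(\<Sum>i\<le>d. v i * (theta d b i * w i j + (if i = 0 then 0 else \<phi> i * w (i - 1) j)))
        = (\<Sum>i\<le>d. opY ?V v i * w i j)"
      by (simp add: bimat_Y distrib_left distrib_right sum.distrib mult_ac)
    then show "?f (opY ?V v) j = opY U (?f v) j"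
      using clin_on_sum(2)[OF D(3,1) wU, where d = d and c = v] Y by simp
  qed
  have lin: "clin_on (car ?V) ?f"
    by (intro clin_onI) (simp add: algebra_simps sum.distrib sum_distrib_left)
  have fZ: "?f (opZ ?V v) = opZ U (?f v)" if "v \<in> car ?V" for v
  proof
    fix j
    have "opZ ?V v = (\<lambda>i. 1 * opX ?V (opY ?V v) i + 1 * (1 * opY ?V (opX ?V v) i + (- \<mu>) * v i))"
      by (auto simp: bimat_Z)
    then have "?f (opZ ?V v) j = ?f (opX ?V (opY ?V v)) j + ?f (opY ?V (opX ?V v)) j - \<mu> * ?f v j"
      by (simp add: algebra_simps sum.distrib sum_subtractf sum_distrib_left)
    moreover have "?f (opX ?V (opY ?V v)) j = opX U (opY U (?f v)) j"
      "?f (opY ?V (opX ?V v)) j = opY U (opX U (?f v)) j"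
      using fun_cong[OF fX[of "opY ?V v"], of j] fun_cong[OF fY[of "opX ?V v"], of j]
      by (simp_all only: fX[of v] fY[of v])
    ultimately have "?f (opZ ?V v) j
        = opX U (opY U (?f v)) j + opY U (opX U (?f v)) j - \<mu> * ?f v j" by simp
    also have "\<dots> = opZ U (?f v) j" unfolding Z[OF fU, of v j] by simp
    finally show "?f (opZ ?V v) j = opZ U (?f v) j" .
  qed
  show ?thesis
    unfolding bi_hom_def intertwines_def using lin fU fX fY fZ by blast
qed

lemma bi_homI_split_chain:
  assumes U: "bimodule U" and rel: "bi_rel U \<kappa>' \<nu> \<mu>"
    and sys: "bi_sys (theta d a) (theta d b) \<phi> \<kappa> \<nu> \<mu> \<zeta>"
    and w0: "w 0 \<in> car U"
    and wS: "\<And>i j. w (Suc i) j = opX U (w i) j - theta d a i * w i j"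
    and Y0: "\<And>j. opY U (w 0) j = theta d b 0 * w 0 j"
    and Y1: "\<And>j. opY U (w 1) j = theta d b 1 * w 1 j + \<phi> 1 * w 0 j"
    and wd: "w (Suc d) = vzero"
  shows "bi_hom (bimat d a b \<phi> \<mu>) U (\<lambda>v j. \<Sum>i\<le>d. v i * w i j)"
proof (rule bimat_homI[OF U])
  note c = split_chain[OF U rel sys w0 wS Y0 Y1]
  show "w i \<in> car U" for i by (rule c(1))
  have "\<phi> 0 = 0" using sys unfolding bi_sys_def by blast
  then show "opY U (w i) j = theta d b i * w i j + (if i = 0 then 0 else \<phi> i * w (i - 1) j)" for i j
    using c(2)[of i] by simp
  show "opX U (opY U v) j + opY U (opX U v) j = opZ U v j + \<mu> * v j" if "v \<in> car U" for v j
    using rel that unfolding bi_rel_def by blast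
qed (use wS wd in auto)

lemma triangular_bij:
  fixes w :: "nat \<Rightarrow> nat \<Rightarrow> complex"
  assumes up: "\<And>i j. i \<le> d \<Longrightarrow> i < j \<Longrightarrow> w i j = 0" and dg: "\<And>i. i \<le> d \<Longrightarrow> w i i \<noteq> 0"
  shows "bij_betw (\<lambda>v j. \<Sum>i\<le>d. v i * w i j) {v. \<forall>i>d. v i = 0} {v. \<forall>i>d. v i = 0}"
proof -
  let ?S = "{v :: nat \<Rightarrow> complex. \<forall>i>d. v i = 0}" and ?f = "\<lambda>v j. \<Sum>i\<le>d. v i * w i j"
  have inj: "v = v'" if "v \<in> ?S" "v' \<in> ?S" "?f v = ?f v'" for v v'
  proof (rule ccontr)
    assume "v \<noteq> v'"
    define I where "I = {i. v i \<noteq> v' i}"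
    have I: "I \<subseteq> {..d}" "I \<noteq> {}"
      using that(1,2) \<open>v \<noteq> v'\<close> unfolding I_def by (auto simp: not_le[symmetric])
    then have fin: "finite I" using finite_subset by blast
    define m where "m = Max I"
    have m: "m \<in> I" "m \<le> d" and mx: "\<And>i. i \<in> I \<Longrightarrow> i \<le> m" using Max_in[OF fin I(2)] I(1) fin unfolding m_def by auto
    have "?f v m - ?f v' m = (\<Sum>i\<le>d. (v i - v' i) * w i m)"
      by (simp add: left_diff_distrib sum_subtractf)
    also have "\<dots> = (\<Sum>i\<le>d. if i = m then (v m - v' m) * w m m else 0)"
    proof (intro sum.cong refl)
      fix i assume i: "i \<in> {..d}"
      show "(v i - v' i) * w i m = (if i = m then (v m - v' m) * w m m else 0)"
        using i up[of i m] mx[of i] by (cases i m rule: linorder_cases) (auto simp: I_def)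
    qed
    also have "\<dots> = (v m - v' m) * w m m" using m by simp
    finally show False using that(3) m dg[of m] by (auto simp: I_def dest: fun_cong[of _ _ m])
  qed
  \<comment> \<open>Induction on a bound m for the support of u: a multiple of w_m clears the
    highest coordinate without touching those above it.\<close>
  have surj: "\<exists>v\<in>?S. ?f v = u" if "\<forall>i\<ge>m. u i = 0" "m \<le> Suc d" for m and u :: "nat \<Rightarrow> complex"
    using that
  proof (induction m arbitrary: u)
    case 0
    then have "u = (\<lambda>_. 0)" by auto
    then show ?case by (intro bexI[of _ "\<lambda>_. 0"]) simp_all
  next
    case (Suc m)
    then have m: "m \<le> d" by simp
    define c where "c = u m / w m m"
    define u' where "u' = (\<lambda>j. u j - c * w m j)"
    have "u' i = 0" if "i \<ge> m" for i
    proof (cases "i = m")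
      case True
      then show ?thesis using dg[OF m] by (simp add: u'_def c_def)
    next
      case False
      then have "Suc m \<le> i" using that by simp
      then show ?thesis using Suc(2) up[OF m, of i] by (simp add: u'_def)
    qed
    then have "\<exists>v\<in>?S. ?f v = u'" by (intro Suc.IH) (use m in simp_all)
    then obtain v where v: "v \<in> ?S" "?f v = u'" by (rule bexE)
    let ?v = "\<lambda>i. v i + c * std m i"
    have st: "(\<Sum>i\<le>d. c * std m i * w i j) = c * w m j" for j
    proof -
      have "(\<Sum>i\<le>d. c * std m i * w i j) = (\<Sum>i\<le>d. if i = m then c * w m j else 0)"
        by (intro sum.cong) (auto simp: std_def)
      then show ?thesis using m by simp
    qed
    have "?f ?v = u"
    proof
      fix j
      have "?f ?v j = ?f v j + c * w m j"
        by (simp only: distrib_right sum.distrib st)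
      also have "?f v j = u' j" using fun_cong[OF v(2), of j] .
      finally show "?f ?v j = u j" by (simp add: u'_def)
    qed
    then show ?case
      by (rule bexI[of _ ?v]) (use v(1) m in \<open>simp add: std_def\<close>)
  qed
  have fS: "?f v \<in> ?S" for v using up by (auto intro!: sum.neutral)
  have "?f ` ?S = ?S"
  proof
    show "?S \<subseteq> ?f ` ?S"
    proof
      fix u :: "nat \<Rightarrow> complex" assume "u \<in> ?S"
      then have "\<forall>i\<ge>Suc d. u i = 0" by (simp add: Suc_le_eq)
      then show "u \<in> ?f ` ?S" using surj[of "Suc d" u] by blast
    qed
  qed (use fS in blast)
  moreover have "inj_on ?f ?S" using inj by (intro inj_onI) blast
  ultimately show ?thesis unfolding bij_betw_def by blast
qed

section \<open>Changes of the split basis\<close>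

definition phiE :: "nat \<Rightarrow> complex \<Rightarrow> complex \<Rightarrow> complex \<Rightarrow> nat \<Rightarrow> complex" where
  "phiE d a b c i = (if even i then of_nat i * (of_nat d - of_nat i + 1)
          else c ^ 2 - (2 * a + 2 * b - of_nat d + 2 * of_nat i - 1) ^ 2 / 4)"

definition phiO :: "nat \<Rightarrow> complex \<Rightarrow> complex \<Rightarrow> complex \<Rightarrow> nat \<Rightarrow> complex" where
  "phiO d a b c i = (if even i then of_nat i * (of_nat d + 1 - 2 * of_nat i - 2 * a - 2 * b - 2 * c) / 2
          else (of_nat i - of_nat d - 1) * (of_nat d + 1 - 2 * of_nat i - 2 * a - 2 * b + 2 * c) / 2)"

lemma Emod_bimat: "Emod d a b c = bimat d a b (phiE d a b c) (c ^ 2 - a ^ 2 - b ^ 2 + (of_nat d + 1) ^ 2 / 4)"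
  unfolding Emod_def phiE_def ..

lemma Omod_bimat: "Omod d a b c = bimat d a b (phiO d a b c) (2 * a * b - c * (of_nat d + 1))"
  unfolding Omod_def phiO_def ..

text \<open>The three scalars depend only on the squares of a, b, c, so sign changes of the
  parameters do not alter the central character.\<close>

lemma E_sys: "bi_sys (theta d a) (theta d b) (phiE d a b c)
    (a ^ 2 - b ^ 2 - c ^ 2 + (of_nat d + 1) ^ 2 / 4)
    (b ^ 2 - a ^ 2 - c ^ 2 + (of_nat d + 1) ^ 2 / 4)
    (c ^ 2 - a ^ 2 - b ^ 2 + (of_nat d + 1) ^ 2 / 4) (- (a + b))"
  unfolding bi_sys_def
proof (intro conjI allI)
  fix i
  show "2 * theta d a i * theta d b i + phiE d a b c i + phiE d a b c (Suc i)
      - (c ^ 2 - a ^ 2 - b ^ 2 + (of_nat d + 1) ^ 2 / 4) = (-1) ^ i * (- (a + b)) - 1/2"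
    by (cases "even i") (simp_all add: theta_def phiE_def field_simps power2_eq_square)
  show "2 * theta d a i * ((-1) ^ i * (- (a + b)) - 1/2) - (-1) ^ i * (phiE d a b c (Suc i) - phiE d a b c i)
      = theta d b i + (b ^ 2 - a ^ 2 - c ^ 2 + (of_nat d + 1) ^ 2 / 4)"
    by (cases "even i") (simp_all add: theta_def phiE_def field_simps power2_eq_square)
  show "2 * theta d b i * ((-1) ^ i * (- (a + b)) - 1/2) - (-1) ^ i * (phiE d a b c (Suc i) - phiE d a b c i)
      = theta d a i + (a ^ 2 - b ^ 2 - c ^ 2 + (of_nat d + 1) ^ 2 / 4)"
    by (cases "even i") (simp_all add: theta_def phiE_def field_simps power2_eq_square)
qed (auto simp: theta_Suc phiE_def)

text \<open>Permuting a, b, c permutes the three scalars in the same way. Negating a and c negates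
  the first and the third scalar and keeps the second.\<close>

lemma O_sys: "bi_sys (theta d a) (theta d b) (phiO d a b c)
    (2 * b * c - a * (of_nat d + 1)) (2 * a * c - b * (of_nat d + 1))
    (2 * a * b - c * (of_nat d + 1)) (c + (of_nat d + 1) / 2)"
  unfolding bi_sys_def
proof (intro conjI allI)
  fix i
  show "2 * theta d a i * theta d b i + phiO d a b c i + phiO d a b c (Suc i)
      - (2 * a * b - c * (of_nat d + 1)) = (-1) ^ i * (c + (of_nat d + 1) / 2) - 1/2"
    by (cases "even i") (simp_all add: theta_def phiO_def field_simps)
  show "2 * theta d a i * ((-1) ^ i * (c + (of_nat d + 1) / 2) - 1/2) - (-1) ^ i * (phiO d a b c (Suc i) - phiO d a b c i)
      = theta d b i + (2 * a * c - b * (of_nat d + 1))"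
    by (cases "even i") (simp_all add: theta_def phiO_def field_simps)
  show "2 * theta d b i * ((-1) ^ i * (c + (of_nat d + 1) / 2) - 1/2) - (-1) ^ i * (phiO d a b c (Suc i) - phiO d a b c i)
      = theta d a i + (2 * b * c - a * (of_nat d + 1))"
    by (cases "even i") (simp_all add: theta_def phiO_def field_simps)
qed (auto simp: theta_Suc phiO_def)

lemma phiE_top: "odd d \<Longrightarrow> phiE d a b c (Suc d) = 0"
  by (simp add: phiE_def)

lemma phiO_top: "even d \<Longrightarrow> phiO d a b c (Suc d) = 0"
  by (simp add: phiO_def)

text \<open>The twist of a module by X -> pX, Y -> qY, Z -> rZ, an automorphism of the algebra when
  p, q, r are signs with product 1. The two swaps below are further twists, since the relations are
  symmetric in the generators.\<close>

definition signs :: "complex \<Rightarrow> complex \<Rightarrow> complex \<Rightarrow> 'i bimod \<Rightarrow> 'i bimod" where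
  "signs p q r U = \<lparr> car = car U, opX = (\<lambda>u. smul p (opX U u)), opY = (\<lambda>u. smul q (opY U u)),
     opZ = (\<lambda>u. smul r (opZ U u)) \<rparr>"

definition swapXY :: "'i bimod \<Rightarrow> 'i bimod" where
  "swapXY U = \<lparr> car = car U, opX = opY U, opY = opX U, opZ = opZ U \<rparr>"

definition swapXZ :: "'i bimod \<Rightarrow> 'i bimod" where
  "swapXZ U = \<lparr> car = car U, opX = opZ U, opY = opY U, opZ = opX U \<rparr>"

lemma signs_simps [simp]:
  "car (signs p q r U) = car U" "opX (signs p q r U) u = smul p (opX U u)"
  "opY (signs p q r U) u = smul q (opY U u)" "opZ (signs p q r U) u = smul r (opZ U u)"
  unfolding signs_def by auto

lemma swapXY_simps [simp]:
  "car (swapXY U) = car U" "opX (swapXY U) = opY U" "opY (swapXY U) = opX U" "opZ (swapXY U) = opZ U"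
  unfolding swapXY_def by auto

lemma swapXZ_simps [simp]:
  "car (swapXZ U) = car U" "opX (swapXZ U) = opZ U" "opY (swapXZ U) = opY U" "opZ (swapXZ U) = opX U"
  unfolding swapXZ_def by auto

lemma subspace_smul: "subspace_in S \<Longrightarrow> u \<in> S \<Longrightarrow> smul c u \<in> S"
  unfolding subspace_in_def by blast

lemma clin_on_smul: "clin_on S f \<Longrightarrow> u \<in> S \<Longrightarrow> f (smul c u) = smul c (f u)"
  unfolding clin_on_def by blast

lemma bimodule_signs: "bimodule U \<Longrightarrow> bimodule (signs p q r U)"
  unfolding bimodule_def
  by (auto simp: subspace_smul clin_on_def) (auto simp: vec_defs algebra_simps)

lemma bimodule_swap: "bimodule U \<Longrightarrow> bimodule (swapXY U)" "bimodule U \<Longrightarrow> bimodule (swapXZ U)"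
  unfolding bimodule_def by (auto simp: swapXY_def swapXZ_def)

lemma bi_iso_signs:
  assumes "bimodule U" "bi_iso U V"
  shows "bi_iso (signs p q r U) (signs p q r V)"
proof -
  note D = bimoduleD[OF assms(1)]
  obtain f where f: "clin_on (car U) f" "bij_betw f (car U) (car V)" "intertwines U V f"
    using assms(2) unfolding bi_iso_def by blast
  show ?thesis
    unfolding bi_iso_def
    by (rule exI[of _ f]) (use f D in \<open>simp add: intertwines_def clin_on_smul\<close>)
qed

lemma bi_iso_swap:
  assumes "bi_iso U V"
  shows "bi_iso (swapXY U) (swapXY V)" "bi_iso (swapXZ U) (swapXZ V)"
  using assms unfolding bi_iso_def intertwines_def by auto

lemma irreducible_swap:
  "irreducible_mod U \<Longrightarrow> irreducible_mod (swapXY U)"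
  "irreducible_mod U \<Longrightarrow> irreducible_mod (swapXZ U)"
  unfolding irreducible_mod_def by auto

lemma bi_rel_signs:
  assumes "bi_rel U \<kappa> \<nu> \<mu>" "bimodule U" "p * q = r" "p * r = q" "q * r = p"
  shows "bi_rel (signs p q r U) (p * \<kappa>) (q * \<nu>) (r * \<mu>)"
  unfolding bi_rel_def
proof (intro ballI allI)
  fix v j assume "v \<in> car (signs p q r U)"
  then have v: "v \<in> car U" by simp
  note D = bimoduleD[OF assms(2)]
  have 1: "opX U (opY U v) j + opY U (opX U v) j = opZ U v j + \<mu> * v j"
     "opX U (opZ U v) j + opZ U (opX U v) j = opY U v j + \<nu> * v j"
     "opY U (opZ U v) j + opZ U (opY U v) j = opX U v j + \<kappa> * v j"
    using assms(1) v unfolding bi_rel_def by blast+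
  have "p * (q * A) + q * (p * B) = (p * q) * (A + B)" "p * (r * A) + r * (p * B) = (p * r) * (A + B)"
    "q * (r * A) + r * (q * B) = (q * r) * (A + B)" for A B
    by (simp_all add: algebra_simps)
  note 2 = this[unfolded assms(3-5)]
  show "opX (signs p q r U) (opY (signs p q r U) v) j + opY (signs p q r U) (opX (signs p q r U) v) j
        = opZ (signs p q r U) v j + r * \<mu> * v j
      \<and> opX (signs p q r U) (opZ (signs p q r U) v) j + opZ (signs p q r U) (opX (signs p q r U) v) j
        = opY (signs p q r U) v j + q * \<nu> * v j
      \<and> opY (signs p q r U) (opZ (signs p q r U) v) j + opZ (signs p q r U) (opY (signs p q r U) v) j
        = opX (signs p q r U) v j + p * \<kappa> * v j"
    using D v
    by (simp add: clin_on_smul[OF D(2)] clin_on_smul[OF D(3)] clin_on_smul[OF D(4)])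
      (simp add: smul_def 1 2 distrib_left mult.assoc)
qed

lemma bi_rel_swapXZ: "bi_rel U \<kappa> \<nu> \<mu> \<Longrightarrow> bi_rel (swapXZ U) \<mu> \<nu> \<kappa>"
  unfolding bi_rel_def by (simp add: add.commute)

text \<open>The vector (X - t_(i-1)) ... (X - t_0) v.\<close>

primrec chain :: "(('i \<Rightarrow> complex) \<Rightarrow> 'i \<Rightarrow> complex) \<Rightarrow> (nat \<Rightarrow> complex) \<Rightarrow> ('i \<Rightarrow> complex) \<Rightarrow> nat \<Rightarrow> 'i \<Rightarrow> complex" where
  "chain X t v 0 = v"
| "chain X t v (Suc i) = (\<lambda>j. X (chain X t v i) j - t i * chain X t v i j)"

lemma chain_closed:
  assumes "subspace_in S" "\<And>u. u \<in> S \<Longrightarrow> X u \<in> S" "v \<in> S"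
  shows "chain X t v i \<in> S"
proof (induction i)
  case (Suc i)
  then show ?case using subspace_lin[OF assms(1) assms(2)[OF Suc] Suc, of 1 "- t i"] by simp
qed (simp add: assms)

text \<open>The chain is a polynomial in X applied to v, so an additional factor X - c may be
  applied first or last.\<close>

lemma chain_comm:
  assumes "subspace_in S" "\<And>u. u \<in> S \<Longrightarrow> X u \<in> S" "clin_on S X" "v \<in> S"
  shows "chain X t (\<lambda>j. X v j - c * v j) i = (\<lambda>j. X (chain X t v i) j - c * chain X t v i j)"
proof (induction i)
  case (Suc i)
  have C: "chain X t v i \<in> S" by (rule chain_closed[OF assms(1,2,4)])
  have 1: "X (\<lambda>j. X (chain X t v i) j - c * chain X t v i j)
      = (\<lambda>j. X (X (chain X t v i)) j - c * X (chain X t v i) j)" for c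
    using clin_onD[OF assms(3,1) assms(2)[OF C] C, of 1 "- c"] by simp
  show ?case
    unfolding chain.simps Suc 1 by (auto simp: algebra_simps)
qed simp

lemma chain_smul:
  assumes "subspace_in S" "\<And>u. u \<in> S \<Longrightarrow> X u \<in> S" "clin_on S X" "v \<in> S"
  shows "chain X t (smul c v) i = smul c (chain X t v i)"
proof (induction i)
  case (Suc i)
  have C: "chain X t v i \<in> S" by (rule chain_closed[OF assms(1,2,4)])
  show ?case
    unfolding chain.simps Suc clin_on_smul[OF assms(3) C]
    by (auto simp: smul_def right_diff_distrib)
qed simp

text \<open>Running through the eigenvalues of X in reversed order yields another split basis
  which starts at the same eigenvector of Y.\<close>
lemma reverse_X:
  fixes \<epsilon> :: complex
  assumes sys: "bi_sys (theta d a) (theta d b) \<phi> \<kappa> \<nu> \<mu> \<zeta>" and \<phi>d: "\<phi> (Suc d) = 0"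
    and sys': "bi_sys (theta d a') (theta d b) \<phi>' (\<epsilon> * \<kappa>) \<nu> (\<epsilon> * \<mu>) \<zeta>'" and \<phi>d': "\<phi>' (Suc d) = 0"
    and \<epsilon>: "\<epsilon> * \<epsilon> = 1"
    and rev: "\<And>i. i \<le> d \<Longrightarrow> theta d a' i = \<epsilon> * theta d a (d - i)"
    and \<phi>1: "\<phi>' 1 = \<epsilon> * \<phi> 1 + (\<epsilon> * theta d a 0 - theta d a' 0) * (theta d b 0 - theta d b 1)"
  shows "bi_iso (bimat d a' b \<phi>' (\<epsilon> * \<mu>)) (signs \<epsilon> 1 \<epsilon> (bimat d a b \<phi> \<mu>))"
proof -
  let ?V = "bimat d a b \<phi> \<mu>"
  let ?U = "signs \<epsilon> 1 \<epsilon> ?V"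
  \<comment> \<open>Padding with zero beyond d makes X e_i = theta_i e_i + e_(i+1) valid for i = d
    as well.\<close>
  define e where "e i = (if i \<le> d then std i else vzero)" for i
  note V = bimoduleD[OF bimat_bimodule[of d a b \<phi> \<mu>]]
  have U: "bimodule ?U" by (intro bimodule_signs bimat_bimodule)
  note D = bimoduleD[OF U]
  have eV: "e i \<in> car ?V" for i by (auto simp: e_def std_def vzero_def)
  have Xe: "opX ?V (e i) j = theta d a i * e i j + e (Suc i) j" if "i \<le> d" for i j
    using that by (auto simp: bimat_X e_def std_def vzero_def)
  define w where "w = chain (opX ?U) (theta d a') (e 0)"
  have w0: "w 0 = e 0" by (simp add: w_def)
  have wS: "w (Suc i) j = opX ?U (w i) j - theta d a' i * w i j" for i j by (simp add: w_def)
  \<comment> \<open>Since theta'_m = eps theta_(d-m), the factor with index m maps e (d - m) to eps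
    e (d + 1 - m). Moving this factor to the front of the chain gives the induction step; m = d + 1
    is the claim for the start vector.\<close>
  have kill: "chain (opX ?U) (theta d a') (e (Suc d - m)) m = vzero" if "m \<le> Suc d" for m
    using that
  proof (induction m)
    case (Suc m)
    have 1: "(\<lambda>j. opX ?U (e (d - m)) j - theta d a' m * e (d - m) j) = smul \<epsilon> (e (Suc d - m))"
      using Suc(2) Xe[of "d - m"] rev[of m] by (auto simp: smul_def algebra_simps Suc_diff_le)
    have "chain (opX ?U) (theta d a') (e (Suc d - Suc m)) (Suc m)
        = chain (opX ?U) (theta d a') (smul \<epsilon> (e (Suc d - m))) m"
      using chain_comm[OF D(1) D(5) D(2), of "e (d - m)" "theta d a'" "theta d a' m" m] eV
      unfolding 1 by simp
    also have "\<dots> = smul \<epsilon> (chain (opX ?U) (theta d a') (e (Suc d - m)) m)"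
      using chain_smul[OF D(1) D(5) D(2)] eV by simp
    also have "\<dots> = smul \<epsilon> vzero" using Suc.IH[OF Suc_leD[OF Suc.prems]] by (rule arg_cong)
    also have "\<dots> = vzero" by (simp add: vec_defs)
    finally show ?case .
  qed (simp add: e_def)
  have wd: "w (Suc d) = vzero" using kill[of "Suc d"] by (simp add: w_def)
  have Y0: "opY ?U (w 0) j = theta d b 0 * w 0 j" for j
    by (auto simp: w0 bimat_Y e_def std_def smul_def)
  have Y1: "opY ?U (w 1) j = theta d b 1 * w 1 j + \<phi>' 1 * w 0 j" for j
  proof (cases "d = 0")
    case True
    then have "w 1 = vzero" using wd by simp
    then show ?thesis using True \<phi>d' by (simp add: bimat_Y vec_defs)
  next
    case False
    \<comment> \<open>Here w_1 = eps e_1 + g e_0. With s_i for \<open>theta d b i\<close>, Y w_1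
      equals s_1 w_1 plus eps phi_1 + g (s_0 - s_1) times e_0, which is the origin of the assumption
      on \<open>\<phi>' 1\<close>.\<close>
    define g where "g = \<epsilon> * theta d a 0 - theta d a' 0"
    have w1: "w 1 = (\<lambda>i. if i = 0 then g else if i = 1 then \<epsilon> else 0)"
    proof
      fix i
      have "w 1 i = \<epsilon> * e 1 i + g * e 0 i"
        using wS[of 0 i] Xe[of 0 i] by (simp add: w0 smul_def g_def algebra_simps)
      then show "w 1 i = (if i = 0 then g else if i = 1 then \<epsilon> else 0)"
        using False by (auto simp: e_def std_def)
    qed
    have w0': "w 0 = (\<lambda>i. if i = 0 then 1 else 0)" by (simp add: w0 e_def std_def)
    show ?thesis
      using False unfolding w1 w0' \<phi>1 g_def[symmetric]
      by (cases "j = 0"; cases "j = 1") (auto simp: bimat_Y smul_def algebra_simps)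
  qed
  have "bi_hom (bimat d a' b \<phi>' (\<epsilon> * \<mu>)) ?U (\<lambda>v j. \<Sum>i\<le>d. v i * w i j)"
  proof (rule bi_homI_split_chain[OF U _ sys' _ wS Y0 Y1 wd])
    have "bi_rel ?U (\<epsilon> * \<kappa>) (1 * \<nu>) (\<epsilon> * \<mu>)"
      by (intro bi_rel_signs bimat_rel[OF sys \<phi>d] bimat_bimodule) (use \<epsilon> in auto)
    then show "bi_rel ?U (\<epsilon> * \<kappa>) \<nu> (\<epsilon> * \<mu>)" by simp
    show "w 0 \<in> car ?U" using eV w0 by simp
  qed
  moreover have "bij_betw (\<lambda>v j. \<Sum>i\<le>d. v i * w i j) (car (bimat d a' b \<phi>' (\<epsilon> * \<mu>))) (car ?U)"
  proof -
    have up: "w i j = 0" if "i < j" for i j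
      using that
    proof (induction i arbitrary: j)
      case (Suc i)
      then show ?case by (auto simp: wS smul_def bimat_X)
    qed (auto simp: w0 e_def std_def)
    have dg: "w i i = \<epsilon> ^ i" if "i \<le> d" for i
      using that
    proof (induction i)
      case (Suc i)
      then show ?case using up[of i "Suc i"] by (auto simp: wS smul_def bimat_X)
    qed (auto simp: w0 e_def std_def)
    have "\<epsilon> \<noteq> 0" using \<epsilon> by auto
    then show ?thesis using triangular_bij[of d w] up dg by simp
  qed
  ultimately show ?thesis unfolding bi_iso_alt by blast
qed

lemma bi_sys_cong:
  assumes "bi_sys t s \<phi> \<kappa> \<nu> \<mu> \<zeta>" "\<kappa> = \<kappa>'" "\<nu> = \<nu>'" "\<mu> = \<mu>'"
  shows "bi_sys t s \<phi> \<kappa>' \<nu>' \<mu>' \<zeta>"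
  using assms by simp

lemma E_reverse:
  assumes "odd d"
  shows "bi_iso (Emod d (- a) b c) (Emod d a b c)"
proof -
  have "bi_iso (bimat d (- a) b (phiE d (- a) b c) (1 * (c ^ 2 - a ^ 2 - b ^ 2 + (of_nat d + 1) ^ 2 / 4)))
     (signs 1 1 1 (bimat d a b (phiE d a b c) (c ^ 2 - a ^ 2 - b ^ 2 + (of_nat d + 1) ^ 2 / 4)))"
  proof (rule reverse_X[OF E_sys phiE_top[OF assms] bi_sys_cong[OF E_sys] phiE_top[OF assms]])
    show "theta d (- a) i = 1 * theta d a (d - i)" if "i \<le> d" for i
      using that assms by (auto simp: theta_def of_nat_diff field_simps minus_one_power_iff)
    show "phiE d (- a) b c 1 = 1 * phiE d a b c 1
        + (1 * theta d a 0 - theta d (- a) 0) * (theta d b 0 - theta d b 1)"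
      by (simp add: theta_def phiE_def field_simps power2_eq_square)
  qed simp_all
  moreover have "signs 1 1 1 U = U" for U :: "nat bimod"
    by (cases U) (simp add: signs_def smul_def)
  ultimately show ?thesis unfolding Emod_bimat by simp
qed

text \<open>For even d the reversed eigenvalue sequence of X is minus the sequence with parameter
  -a, whereas for odd d it is that sequence itself. This costs the twist X -> -X, Z -> -Z, and c has
  to change sign to match the central scalars.\<close>

lemma O_reverse:
  assumes "even d"
  shows "bi_iso (Omod d (- a) b (- c)) (signs (- 1) 1 (- 1) (Omod d a b c))"
proof -
  have "bi_iso (bimat d (- a) b (phiO d (- a) b (- c)) (- 1 * (2 * a * b - c * (of_nat d + 1))))
     (signs (- 1) 1 (- 1) (bimat d a b (phiO d a b c) (2 * a * b - c * (of_nat d + 1))))"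
  proof (rule reverse_X[OF O_sys phiO_top[OF assms] bi_sys_cong[OF O_sys] phiO_top[OF assms]])
    show "theta d (- a) i = - 1 * theta d a (d - i)" if "i \<le> d" for i
      using that assms by (auto simp: theta_def of_nat_diff field_simps minus_one_power_iff)
    show "phiO d (- a) b (- c) 1 = - 1 * phiO d a b c 1
        + (- 1 * theta d a 0 - theta d (- a) 0) * (theta d b 0 - theta d b 1)"
      by (simp add: theta_def phiO_def field_simps)
  qed (simp_all add: algebra_simps)
  then show ?thesis unfolding Omod_bimat by (simp add: algebra_simps)
qed

text \<open>Reversing the split basis exchanges the roles of X and Y; the rescaling needs a
  nowhere vanishing split sequence.\<close>
lemma exchange_XY:
  fixes \<delta> :: complex
  assumes \<delta>: "\<delta> * \<delta> = 1" and \<phi>d: "\<phi> (Suc d) = 0"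
    and nz: "\<And>i. 1 \<le> i \<Longrightarrow> i \<le> d \<Longrightarrow> \<phi> i \<noteq> 0"
    and X: "\<And>i. i \<le> d \<Longrightarrow> theta d a i = \<delta> * theta d b' (d - i)"
    and Y: "\<And>i. i \<le> d \<Longrightarrow> theta d b i = \<delta> * theta d a' (d - i)"
    and \<phi>: "\<And>i. 1 \<le> i \<Longrightarrow> i \<le> d \<Longrightarrow> \<phi>' (Suc d - i) = \<phi> i"
  shows "bi_iso (bimat d a b \<phi> \<mu>) (signs \<delta> \<delta> 1 (swapXY (bimat d a' b' \<phi>' \<mu>)))"
proof -
  let ?V = "bimat d a' b' \<phi>' \<mu>"
  let ?U = "signs \<delta> \<delta> 1 (swapXY ?V)"
  note D = bimoduleD[OF bimat_bimodule[of d a' b' \<phi>' \<mu>]]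
  have U: "bimodule ?U" by (intro bimodule_signs bimodule_swap bimat_bimodule)
  \<comment> \<open>In the swapped module the first operator maps \<open>std (d - i)\<close> to a
    multiple of the preceding standard vector plus a diagonal term, with factor
    \<open>\<delta> * \<phi> (Suc i)\<close>. These scalars normalise that factor to 1. The one for
    i = d + 1 is 0, which ends the chain.\<close>
  define c where "c i = (\<Prod>l<i. \<delta> * \<phi> (Suc l))" for i
  have cS: "c (Suc i) = c i * (\<delta> * \<phi> (Suc i))" for i by (simp add: c_def)
  have \<delta>0: "\<delta> \<noteq> 0" using \<delta> by auto
  have c0: "c i \<noteq> 0" if "i \<le> d" for i
    using that nz \<delta>0 by (auto simp: c_def)
  define w where "w i = smul (c i) (std (d - i))" for i
  have "bi_hom (bimat d a b \<phi> \<mu>) ?U (\<lambda>v j. \<Sum>i\<le>d. v i * w i j)"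
  proof (rule bimat_homI[OF U])
    fix v j assume v: "v \<in> car ?U"
    have "opX ?U (opY ?U v) j = opY ?V (opX ?V v) j"
      using v D \<delta> by (simp add: clin_on_smul[OF D(3)]) (simp add: smul_def flip: mult.assoc)
    moreover have "opY ?U (opX ?U v) j = opX ?V (opY ?V v) j"
      using v D \<delta> by (simp add: clin_on_smul[OF D(2)]) (simp add: smul_def flip: mult.assoc)
    ultimately show "opX ?U (opY ?U v) j + opY ?U (opX ?U v) j = opZ ?U v j + \<mu> * v j"
      by (simp add: bimat_Z smul_def)
  next
    show "w i \<in> car ?U" for i by (auto simp: w_def std_def smul_def)
    show "w (Suc d) = vzero" by (simp add: w_def cS \<phi>d vec_defs)
  next
    fix i j assume i: "i \<le> d"
    show "opX ?U (w i) j = theta d a i * w i j + w (Suc i) j"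
    proof (cases "i = d")
      case True
      then show ?thesis using X[OF i]
        by (auto simp: w_def std_def smul_def bimat_Y cS \<phi>d)
    next
      case False
      then have s: "Suc (d - Suc i) = d - i" "Suc d - Suc i = d - i" using i by auto
      have "\<phi>' (d - i) = \<phi> (Suc i)" using \<phi>[of "Suc i"] i False s by simp
      then show ?thesis using X[OF i] False i s
        by (auto simp: w_def std_def smul_def bimat_Y cS)
    qed
    show "opY ?U (w i) j = theta d b i * w i j + (if i = 0 then 0 else \<phi> i * w (i - 1) j)"
    proof (cases i)
      case 0
      then show ?thesis using Y[OF i]
        by (auto simp: w_def std_def smul_def bimat_X)
    next
      case (Suc l)
      then have l: "l < d" "Suc (d - Suc l) = d - l" using i by auto
      have ci: "\<delta> * c i = \<phi> i * c l" using \<delta> by (simp add: Suc cS mult_ac flip: mult.assoc[of \<delta> \<delta>])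
      have "opY ?U (w i) j = \<delta> * theta d a' (d - i) * w i j + \<delta> * c i * std (d - l) j"
        using l Suc by (auto simp: w_def std_def smul_def bimat_X)
      then show ?thesis unfolding ci using Y[OF i] Suc by (simp add: w_def smul_def)
    qed
  qed
  moreover have "bij_betw (\<lambda>v j. \<Sum>i\<le>d. v i * w i j) (car (bimat d a b \<phi> \<mu>)) (car ?U)"
  proof -
    have f: "(\<Sum>i\<le>d. v i * w i j) = (if j \<le> d then c (d - j) * v (d - j) else 0)" for v j
    proof -
      have "(\<Sum>i\<le>d. v i * w i j) = (\<Sum>i\<le>d. if i = d - j then (if j \<le> d then c (d - j) * v (d - j) else 0) else 0)"
        by (intro sum.cong) (auto simp: w_def std_def smul_def)
      then show ?thesis by simp
    qed
    show ?thesis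
      unfolding f
      by (rule bij_betw_byWitness[where f' = "\<lambda>u i. if i \<le> d then u (d - i) / c i else 0"])
        (auto simp: c0 fun_eq_iff)
  qed
  ultimately show ?thesis unfolding bi_iso_alt by blast
qed

section \<open>Comparison of the modules E and O for changed parameters\<close>

lemma E_exchange:
  assumes "odd d" and "\<And>i. 1 \<le> i \<Longrightarrow> i \<le> d \<Longrightarrow> phiE d a b c i \<noteq> 0"
  shows "bi_iso (Emod d a b c) (swapXY (Emod d (- b) (- a) c))"
proof -
  have "bi_iso (Emod d a b c) (signs 1 1 1 (swapXY (Emod d (- b) (- a) c)))"
  proof -
    have "bi_iso (bimat d a b (phiE d a b c) \<mu>) (signs 1 1 1 (swapXY (bimat d (- b) (- a) (phiE d (- b) (- a) c) \<mu>)))" for \<mu>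
    proof (rule exchange_XY)
      show "theta d a i = 1 * theta d (- a) (d - i)" "theta d b i = 1 * theta d (- b) (d - i)"
        if "i \<le> d" for i
        using that assms(1) by (auto simp: theta_def of_nat_diff field_simps minus_one_power_iff)
      show "phiE d (- b) (- a) c (Suc d - i) = phiE d a b c i" if "1 \<le> i" "i \<le> d" for i
        using that assms(1) by (auto simp: phiE_def of_nat_diff field_simps power2_eq_square)
    qed (use assms phiE_top in auto)
    then show ?thesis unfolding Emod_bimat by (simp add: algebra_simps)
  qed
  moreover have "signs 1 1 1 U = U" for U :: "nat bimod"
    by (cases U) (simp add: signs_def smul_def)
  ultimately show ?thesis by simp
qed

lemma O_exchange:
  assumes "even d" and "\<And>i. 1 \<le> i \<Longrightarrow> i \<le> d \<Longrightarrow> phiO d a b c i \<noteq> 0"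
  shows "bi_iso (Omod d a b c) (signs (- 1) (- 1) 1 (swapXY (Omod d (- b) (- a) c)))"
proof -
  have "bi_iso (bimat d a b (phiO d a b c) \<mu>)
      (signs (- 1) (- 1) 1 (swapXY (bimat d (- b) (- a) (phiO d (- b) (- a) c) \<mu>)))" for \<mu>
  proof (rule exchange_XY)
    show "theta d a i = - 1 * theta d (- a) (d - i)" "theta d b i = - 1 * theta d (- b) (d - i)"
      if "i \<le> d" for i
      using that assms(1) by (auto simp: theta_def of_nat_diff field_simps minus_one_power_iff)
    show "phiO d (- b) (- a) c (Suc d - i) = phiO d a b c i" if "1 \<le> i" "i \<le> d" for i
      using that assms(1) by (auto simp: phiO_def of_nat_diff field_simps)
  qed (use assms phiO_top in auto)
  then show ?thesis unfolding Omod_bimat by (simp add: algebra_simps)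
qed

text \<open>Reversal of X conjugated by the exchange: the parameters run from (a,b) through (-b,-a)
  and (b,-a) to (a,-b). Each of the two exchanges brings its own condition that a split sequence has
  no zero.\<close>

lemma E_reverse_Y:
  assumes "odd d" and "\<And>i. 1 \<le> i \<Longrightarrow> i \<le> d \<Longrightarrow> phiE d a b c i \<noteq> 0"
    and "\<And>i. 1 \<le> i \<Longrightarrow> i \<le> d \<Longrightarrow> phiE d b (- a) c i \<noteq> 0"
  shows "bi_iso (Emod d a b c) (Emod d a (- b) c)"
proof -
  have "bi_iso (Emod d a b c) (swapXY (Emod d (- b) (- a) c))"
    using E_exchange assms(1,2) by blast
  also have "bi_iso \<dots> (swapXY (Emod d b (- a) c))"
    by (intro bi_iso_swap E_reverse assms(1))
  also have "bi_iso \<dots> (swapXY (swapXY (Emod d a (- b) c)))"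
    using bi_iso_swap(1)[OF E_exchange[OF assms(1,3)]] by simp
  also have "swapXY (swapXY (Emod d a (- b) c)) = Emod d a (- b) c"
    by (cases "Emod d a (- b) c") (simp add: swapXY_def)
  finally show ?thesis .
qed

text \<open>Reversing, exchanging and reversing again leads from (a,b,c) through (-a,b,-c) and
  (-b,a,-c) to (b,a,c), and the three sign twists cancel. The exchange takes place at (-a,b,-c),
  hence the form of the nonvanishing condition.\<close>

lemma O_swap_XY:
  assumes "even d" and nz: "\<And>i. 1 \<le> i \<Longrightarrow> i \<le> d \<Longrightarrow> phiO d (- a) b (- c) i \<noteq> 0"
  shows "bi_iso (Omod d a b c) (swapXY (Omod d b a c))"
proof -
  let ?s = "signs (- 1) 1 (- 1) :: nat bimod \<Rightarrow> _" and ?t = "signs (- 1) (- 1) 1 :: nat bimod \<Rightarrow> _"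
  have m: "bimodule (Omod d a b c)" for a b c unfolding Omod_bimat by (rule bimat_bimodule)
  have "bi_iso (Omod d a b c) (?s (Omod d (- a) b (- c)))"
    using O_reverse[OF assms(1), of "- a" b "- c"] by simp
  also have "bi_iso \<dots> (?s (?t (swapXY (Omod d (- b) a (- c)))))"
    using bi_iso_signs[OF m O_exchange[OF assms(1) nz]] by simp
  also have "bi_iso \<dots> (?s (?t (swapXY (?s (Omod d b a c)))))"
    using O_reverse[OF assms(1), of b a c]
    by (intro bi_iso_signs bi_iso_swap bimodule_signs bimodule_swap m)
  also have "?s (?t (swapXY (?s (Omod d b a c)))) = swapXY (Omod d b a c)"
    by (simp add: signs_def swapXY_def smul_def)
  finally show ?thesis .
qed

text \<open>Allows an identity between continuous functions of a parameter to be checked for generic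
  values only.\<close>

lemma isCont_eq_zero:
  fixes F :: "complex \<Rightarrow> complex"
  assumes "isCont F b" "finite B" "\<And>x. x \<notin> B \<Longrightarrow> F x = 0"
  shows "F b = 0"
proof -
  have "open (- (B - {b}))" using assms(2) by (intro open_Compl finite_imp_closed) auto
  then have "eventually (\<lambda>x. x \<notin> B) (at b)"
    unfolding eventually_at_topological by (intro exI[of _ "- (B - {b})"]) auto
  then have "eventually (\<lambda>x. F x = 0) (at b)" by eventually_elim (rule assms(3))
  then have "(F \<longlongrightarrow> 0) (at b)" by (rule tendsto_eventually)
  moreover have "(F \<longlongrightarrow> F b) (at b)" using assms(1) by (simp add: isCont_def)
  ultimately show ?thesis using tendsto_unique[OF at_neq_bot] by blast
qed

lemma O_swap_XZ:
  assumes "even d"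
  shows "bi_iso (Omod d a b c) (swapXZ (Omod d c b a))"
proof -
  define w where "w b = chain (opZ (Omod d c b a)) (theta d a) (std 0)" for b
  have w0: "w b 0 = std 0" and wS: "w b (Suc i) j = opZ (Omod d c b a) (w b i) j - theta d a i * w b i j" for b i j
    by (simp_all add: w_def)
  have Z: "opZ (Omod d c b a) v i =
    ((-1) ^ i * (a + (of_nat d + 1) / 2) - 1/2) * v i + (if 1 \<le> i then (-1) ^ i * v (i - 1) else 0)
       - (if i < d then (-1) ^ i * phiO d c b a (Suc i) * v (Suc i) else 0)" if "i \<le> d" for b v i
    unfolding Omod_bimat using bimat_Z_coord[OF O_sys phiO_top[OF assms] that] .
  have Z0: "opZ (Omod d c b a) v i = 0" if "i > d" "v i = 0" for b v i
    unfolding Omod_bimat using that by (simp add: bimat_Z bimat_X bimat_Y)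
  have mV: "bimodule (Omod d c b a)" for b unfolding Omod_bimat by (rule bimat_bimodule)
  have U: "bimodule (swapXZ (Omod d c b a))" for b using mV by (rule bimodule_swap)
  have rel: "bi_rel (swapXZ (Omod d c b a)) (2 * c * b - a * (of_nat d + 1))
      (2 * c * a - b * (of_nat d + 1)) (2 * b * a - c * (of_nat d + 1))" for b
    unfolding Omod_bimat using bi_rel_swapXZ[OF bimat_rel[OF O_sys phiO_top[OF assms]]] .
  have Yd: "opY (Omod d c b a) v i
      = (if i \<le> d then theta d b i * v i + (if i < d then phiO d c b a (Suc i) * v (Suc i) else 0) else 0)" for b v i
    unfolding Omod_bimat by (rule bimat_Y)
  have Y0: "opY (swapXZ (Omod d c b a)) (w b 0) j = theta d b 0 * w b 0 j" for b j
    by (auto simp: w0 Yd std_def)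
  have Y1: "opY (swapXZ (Omod d c b a)) (w b 1) j = theta d b 1 * w b 1 j + phiO d a b c 1 * w b 0 j" for b j
  proof -
    \<comment> \<open>The diagonal entry of Z at 0 is a + d/2 and exceeds \<open>theta d a 0\<close>
      by d; the subdiagonal entry in row 1 is -1.\<close>
    have w1: "w b 1 i = (if i = 0 then of_nat d else if i = 1 \<and> d \<noteq> 0 then -1 else 0)" for i
    proof (cases "i \<le> d")
      case True
      then show ?thesis
        unfolding One_nat_def wS w0 Z[OF True]
        by (cases "i < d"; cases "i = 0"; cases "i = 1"; simp add: std_def theta_def field_simps; auto)
    next
      case False
      then show ?thesis using wS[of b 0 i] by (auto simp: w0 Z0 std_def)
    qed
    have w1': "w b 1 = (\<lambda>i. if i = 0 then of_nat d else if i = 1 \<and> d \<noteq> 0 then -1 else 0)"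
      using w1 by (rule ext)
    have p: "theta d b 0 * of_nat d - phiO d c b a 1 = theta d b 1 * of_nat d + phiO d a b c 1"
      by (simp add: theta_def phiO_def field_simps)
    show ?thesis
    proof (cases "d = 0")
      case True
      then show ?thesis unfolding w1' w0 swapXZ_simps Yd by (simp add: phiO_def)
    next
      case False
      then show ?thesis
        unfolding w1' w0 swapXZ_simps Yd std_def
        by (cases "j = 0"; cases "j = 1") (use p in auto)
    qed
  qed
  have w0U: "w b 0 \<in> car (swapXZ (Omod d c b a))" for b by (simp add: w0 Omod_bimat std_def)
  have wU: "w b i \<in> car (Omod d c b a)" and Yw: "opY (Omod d c b a) (w b i)
      = (\<lambda>j. theta d b i * w b i j + phiO d a b c i * w b (i - 1) j)" for b i
  proof -
    have sys: "bi_sys (theta d a) (theta d b) (phiO d a b c) (2 * b * c - a * (of_nat d + 1))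
       (2 * c * a - b * (of_nat d + 1)) (2 * b * a - c * (of_nat d + 1)) (c + (of_nat d + 1) / 2)"
      by (rule bi_sys_cong[OF O_sys]) simp_all
    note s = split_chain[where w = "w b" and t = "theta d a", OF U rel sys w0U _ Y0 Y1, of i]
    show "w b i \<in> car (Omod d c b a)" using s(1) by (simp add: wS)
    show "opY (Omod d c b a) (w b i) = (\<lambda>j. theta d b i * w b i j + phiO d a b c i * w b (i - 1) j)"
      using s(2) by (simp add: wS)
  qed
  have car: "car (Omod d c b a) = {v. \<forall>i>d. v i = 0}" for b by (simp add: Omod_bimat)
  \<comment> \<open>For generic b the vector vanishes, being an eigenvector of Y for a value outside
    the spectrum; its coordinates are polynomials in b.\<close>
  have wd: "w b (Suc d) = vzero" for b
  proof -
    \<comment> \<open>B contains every b for which \<open>theta d b (Suc d)\<close> equals some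
      \<open>theta d b m\<close> with m <= d. For even m this equation reads 2b + m + 1 = 0; for odd
      m it would force m = d + 1.\<close>
    define B where "B = (\<lambda>m :: nat. - (of_nat m + 1) / 2 :: complex) ` {..d}"
    have gen: "w x (Suc d) j = 0" if x: "x \<notin> B" for x j
    proof (rule ccontr)
      assume nz: "w x (Suc d) j \<noteq> 0"
      define I where "I = {i. w x (Suc d) i \<noteq> 0}"
      have I: "I \<subseteq> {..d}" "j \<in> I" using wU[of x "Suc d"] nz unfolding I_def car by (auto simp: not_le[symmetric])
      then have fin: "finite I" using finite_subset by blast
      \<comment> \<open>Y is upper bidiagonal, so at the highest nonzero coordinate of a vector it
        acts by its diagonal entry.\<close>
      define m where "m = Max I"
      have m: "m \<in> I" "m \<le> d" and mx: "\<And>i. i \<in> I \<Longrightarrow> i \<le> m"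
        using Max_in[OF fin] Max_ge[OF fin] I unfolding m_def by blast+
      have z: "w x (Suc d) (Suc m) = 0" using mx[of "Suc m"] by (auto simp: I_def)
      have "opY (Omod d c x a) (w x (Suc d)) m = theta d x (Suc d) * w x (Suc d) m"
        using fun_cong[OF Yw[of x "Suc d"], of m] phiO_top[OF assms] by simp
      then have "theta d x m * w x (Suc d) m = theta d x (Suc d) * w x (Suc d) m"
        using m z by (simp add: Yd split: if_splits)
      then have "theta d x m = theta d x (Suc d)" using m(1) by (simp add: I_def)
      then have "x = - (of_nat m + 1) / 2"
      proof (cases "even m")
        case True
        have "4 * (2 * x + of_nat m + 1) = 0"
          using True \<open>theta d x m = theta d x (Suc d)\<close> assms by (simp add: theta_def field_simps)
        then have "2 * x + of_nat m + 1 = 0" by (metis mult_eq_0_iff zero_neq_numeral)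
        then have "2 * x = - (of_nat m + 1)" by (metis add.assoc eq_neg_iff_add_eq_0)
        then show ?thesis by (simp add: field_simps)
      next
        case False
        then have "4 * (of_nat m :: complex) = 4 * of_nat (Suc d)"
          using \<open>theta d x m = theta d x (Suc d)\<close> assms by (simp add: theta_def field_simps)
        then have "(of_nat m :: complex) = of_nat (Suc d)"
          by (metis mult_left_cancel zero_neq_numeral)
        then show ?thesis using m(2) unfolding of_nat_eq_iff by simp
      qed
      then show False using x m(2) unfolding B_def by blast
    qed
    have cont: "isCont (\<lambda>b. w b i j) x" for i j x
    proof (induction i arbitrary: j)
      case (Suc i)
      show ?case
      proof (cases "j \<le> d")
        case True
        have f: "isCont (\<lambda>b. phiO d c b a (Suc j)) x" unfolding phiO_def
          by (cases "even (Suc j)") (simp_all only: if_True if_False, (intro continuous_intros; simp)+)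
        show ?thesis unfolding wS Z[OF True] using Suc f
          by (cases "j < d"; cases "1 \<le> j"; simp only: if_True if_False)
            (intro continuous_intros; simp)+
      next
        case False
        then have "w b i j = 0" "w b (Suc i) j = 0" for b using wU unfolding car by auto
        then show ?thesis by simp
      qed
    qed (simp add: w0)
    show ?thesis
      unfolding vzero_def
      using isCont_eq_zero[OF cont, of B] gen by (auto simp: B_def)
  qed
  have "bi_hom (bimat d a b (phiO d a b c) (2 * b * a - c * (of_nat d + 1))) (swapXZ (Omod d c b a)) (\<lambda>v j. \<Sum>i\<le>d. v i * w b i j)"
  proof (rule bi_homI_split_chain[where w = "w b", OF U rel bi_sys_cong[OF O_sys] w0U _ Y0 Y1 wd])
    show "w b (Suc i) j = opX (swapXZ (Omod d c b a)) (w b i) j - theta d a i * w b i j" for i j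
      by (simp add: wS)
  qed simp_all
  moreover have "bij_betw (\<lambda>v j. \<Sum>i\<le>d. v i * w b i j) {v. \<forall>i>d. v i = 0} {v. \<forall>i>d. v i = 0}"
  proof (rule triangular_bij)
    show up: "w b i j = 0" if "i \<le> d" "i < j" for i j
      using that
    proof (induction i arbitrary: j)
      case (Suc i)
      then show ?case using Z0[of j "w b i"] by (cases "j \<le> d") (auto simp: wS Z)
    qed (auto simp: w0 std_def)
    \<comment> \<open>The subdiagonal entries of Z are signs, so each step of the chain reaches one
      new coordinate with a nonzero value.\<close>
    show "w b i i \<noteq> 0" if "i \<le> d" for i
      using that
    proof (induction i)
      case (Suc i)
      then show ?case using up[of i "Suc i"] up[of i "Suc (Suc i)"] by (auto simp: wS Z)
    qed (auto simp: w0 std_def)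
  qed
  ultimately show ?thesis unfolding bi_iso_alt Omod_bimat by (auto simp: mult_ac)
qed

section \<open>Irreducibility\<close>

text \<open>A submodule contains an eigenvector u of X for the first eigenvalue, because Y lowers
  the support down to the first coordinate.  In the reversed split basis u is the last basis
  vector, from which Y reaches all the others.\<close>
lemma irreducible_of_reverse:
  fixes \<epsilon> :: complex
  assumes iso: "bi_iso (bimat d a' b \<phi>' \<mu>') (signs \<epsilon> 1 \<epsilon> (bimat d a b \<phi> \<mu>))"
    and \<epsilon>: "\<epsilon> * \<epsilon> = 1"
    and rev: "\<And>i. i \<le> d \<Longrightarrow> theta d a' i = \<epsilon> * theta d a (d - i)"
    and nz: "\<And>i. 1 \<le> i \<Longrightarrow> i \<le> d \<Longrightarrow> \<phi> i \<noteq> 0"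
    and nz': "\<And>i. 1 \<le> i \<Longrightarrow> i \<le> d \<Longrightarrow> \<phi>' i \<noteq> 0"
    and simple: "\<And>i. 1 \<le> i \<Longrightarrow> i \<le> d \<Longrightarrow> theta d a i \<noteq> theta d a 0"
  shows "irreducible_mod (bimat d a b \<phi> \<mu>)"
proof -
  let ?V = "bimat d a b \<phi> \<mu>" and ?V' = "bimat d a' b \<phi>' \<mu>'"
  have \<epsilon>0: "\<epsilon> \<noteq> 0" using \<epsilon> by auto
  note D = bimoduleD[OF bimat_bimodule[of d a b \<phi> \<mu>]]
    and D' = bimoduleD[OF bimat_bimodule[of d a' b \<phi>' \<mu>']]
  obtain h where h: "bi_hom ?V' (signs \<epsilon> 1 \<epsilon> ?V) h" "bij_betw h (car ?V') (car ?V)"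
    using iso unfolding bi_iso_alt by auto
  note H = bi_homD[OF h(1)]
  have full: "S = car ?V"
    if S: "S \<subseteq> car ?V" "subspace_in S" "\<forall>u\<in>S. opX ?V u \<in> S \<and> opY ?V u \<in> S \<and> opZ ?V u \<in> S"
      and nt: "S \<noteq> {vzero}" for S
  proof -
    have v0S: "vzero \<in> S" using S(2) unfolding subspace_in_def by blast
    define P where "P m \<longleftrightarrow> (\<exists>v\<in>S. v m \<noteq> 0)" for m
    have "\<exists>m. P m" using nt v0S unfolding P_def vzero_def by fastforce
    \<comment> \<open>The least coordinate that does not vanish identically on S. If it were
      positive, Y would produce a vector of S with a nonzero coordinate just below it.\<close>
    define m where "m = (LEAST m. P m)"
    have Pm: "P m" unfolding m_def using \<open>\<exists>m. P m\<close> by (rule LeastI_ex)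
    then obtain v where v: "v \<in> S" "v m \<noteq> 0" unfolding P_def by blast
    have low: "u i = 0" if "u \<in> S" "i < m" for u i
      using not_less_Least[of i P] that unfolding m_def P_def by blast
    have md: "m \<le> d" using v S(1) by (auto simp: not_le[symmetric])
    have "m = 0"
    proof (rule ccontr)
      assume "m \<noteq> 0"
      then obtain l where l: "m = Suc l" by (cases m) auto
      have "opY ?V v l = \<phi> m * v m"
        using low[OF v(1), of l] l md by (simp add: bimat_Y)
      moreover have "opY ?V v l = 0" using low[of "opY ?V v" l] S(3) v(1) l by simp
      ultimately show False using nz[of m] v(2) md l by simp
    qed
    then have v0: "v 0 \<noteq> 0" using v by simp
    \<comment> \<open>The vector (X - theta_d) ... (X - theta_1) v. One more factor X - theta_0
      kills it, because each factor of the lower triangular X clears one more coordinate (fact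
      \<open>van\<close>). Its coordinate 0 is v_0 times the product of all theta_0 - theta_i with i
      >= 1, nonzero by \<open>simple\<close>.\<close>
    define u where "u = chain (opX ?V) (\<lambda>i. theta d a (Suc i)) v d"
    have SX: "opX ?V x \<in> S" and SY: "opY ?V x \<in> S" if "x \<in> S" for x using S(3) that by blast+
    have uS: "u \<in> S" unfolding u_def by (rule chain_closed[OF S(2) SX v(1)])
    have "chain (opX ?V) (\<lambda>i. theta d a (Suc i)) v i 0 \<noteq> 0" if "i \<le> d" for i
      using that
    proof (induction i)
      case (Suc i)
      then show ?case using simple[of "Suc i"]
        by (simp add: bimat_X)
    qed (simp add: v0)
    from this[OF order_refl] have u0: "u 0 \<noteq> 0" unfolding u_def .
    have van: "chain (opX ?V) (\<lambda>i. theta d a (Suc i)) (\<lambda>j. opX ?V v j - theta d a 0 * v j) i j = 0"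
      if "j \<le> i" "i \<le> d" for i j
      using that
    proof (induction i arbitrary: j)
      case (Suc i)
      let ?c = "chain (opX ?V) (\<lambda>i. theta d a (Suc i)) (\<lambda>j. opX ?V v j - theta d a 0 * v j) i"
      have z: "?c l = 0" if "l \<le> i" for l using Suc.IH[OF that] Suc.prems(2) by simp
      have "opX ?V ?c j = theta d a j * ?c j"
        using z[of "j - 1"] Suc.prems by (simp add: bimat_X del: chain.simps)
      moreover have "?c j = 0 \<or> j = Suc i" using z[of j] Suc.prems(1) by (auto simp del: chain.simps)
      ultimately show ?case unfolding chain.simps(2) by (elim disjE) simp_all
    qed (simp add: bimat_X)
    have lin: "clin_on S (opX ?V)" using D(2) S(1) unfolding clin_on_def by blast
    have Xu: "opX ?V u j = theta d a 0 * u j" for j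
    proof (cases "j \<le> d")
      case True
      have "chain (opX ?V) (\<lambda>i. theta d a (Suc i)) (\<lambda>j. opX ?V v j - theta d a 0 * v j) d j
          = opX ?V u j - theta d a 0 * u j"
        unfolding u_def using chain_comm[OF S(2) SX lin v(1)] by simp
      then show ?thesis using van[OF True] by simp
    next
      case False
      then show ?thesis using uS S(1) by (auto simp: bimat_X)
    qed
    define S' where "S' = {x \<in> car ?V'. h x \<in> S}"
    have S'sub: "subspace_in S'"
    proof (rule subspace_inI)
      have "vzero \<in> S'"
        using v0S D'(1) unfolding S'_def subspace_in_def by (simp only: mem_Collect_eq clin_on_zero[OF H(1) D'(1)])
      then show "S' \<noteq> {}" by blast
      fix p q x y assume xy: "x \<in> S'" "y \<in> S'"
      then have 1: "x \<in> car ?V'" "y \<in> car ?V'" "h x \<in> S" "h y \<in> S" unfolding S'_def by blast+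
      show "(\<lambda>j. p * x j + q * y j) \<in> S'"
        unfolding S'_def mem_Collect_eq clin_onD[OF H(1) D'(1) 1(1,2)]
        using subspace_lin[OF D'(1) 1(1,2)] subspace_lin[OF S(2) 1(3,4)] by (rule conjI)
    qed
    have S'Y: "opY ?V' x \<in> S'" if "x \<in> S'" for x
      using that D'(6) H(4) SY unfolding S'_def by (auto simp: smul_def)
    have "u \<in> h ` car ?V'" using subsetD[OF S(1) uS] h(2) by (simp only: bij_betw_def)
    then obtain x where x: "x \<in> car ?V'" "h x = u" by (elim imageE) (rule that, simp_all only:)
    have xS: "x \<in> S'" using x uS unfolding S'_def by simp
    have ux: "h (opX ?V' x) = h (smul (\<epsilon> * theta d a 0) x)"
    proof -
      have "h (opX ?V' x) = smul \<epsilon> (opX ?V u)" using H(3)[OF x(1)] x(2) by simp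
      also have "\<dots> = smul (\<epsilon> * theta d a 0) u" by (auto simp: smul_def Xu)
      finally show ?thesis using clin_on_smul[OF H(1) x(1)] x(2) by simp
    qed
    have inj: "inj_on h (car ?V')" using h(2) unfolding bij_betw_def by blast
    have Xx: "opX ?V' x = smul (\<epsilon> * theta d a 0) x"
      using inj_onD[OF inj ux D'(5)[OF x(1)] subspace_smul[OF D'(1) x(1)]] .
    \<comment> \<open>The eigenvalue eps theta_0 is the last diagonal entry of X in the reversed
      basis and differs from all earlier ones. Since X is lower bidiagonal there, x has only its
      last coordinate.\<close>
    have xlow: "x i = 0" if "i < d" for i
      using that
    proof (induction i rule: less_induct)
      case (less i)
      have "theta d a' i * x i = \<epsilon> * theta d a 0 * x i"
        using fun_cong[OF Xx, of i] less by (auto simp: bimat_X smul_def split: if_splits)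
      then show ?case using rev[of i] simple[of "d - i"] less.prems \<epsilon>0 by auto
    qed
    have xd: "x d \<noteq> 0"
    proof
      assume "x d = 0"
      then have "x i = 0" for i using xlow[of i] x(1) by (cases i d rule: linorder_cases) auto
      then have "x = vzero" unfolding vzero_def by auto
      then have "u = vzero" using x(2) clin_on_zero[OF H(1) D'(1)] by simp
      then show False using u0 by (simp add: vzero_def)
    qed
    have stdS: "std (d - i) \<in> S'" if "i \<le> d" for i
      using that
    proof (induction i)
      case 0
      have "std d = smul (1 / x d) x"
      proof
        fix j show "std d j = smul (1 / x d) x j"
          using xlow[of j] x(1) xd by (cases j d rule: linorder_cases) (auto simp: std_def smul_def)
      qed
      then show ?case using subspace_smul[OF S'sub xS] by simp
    next
      case (Suc i)
      define l where "l = d - Suc i"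
      have l: "d - i = Suc l" "l < d" using Suc(2) by (auto simp: l_def)
      then have m: "std (Suc l) \<in> S'" using Suc by simp
      have "std l = (\<lambda>j. (1 / \<phi>' (Suc l)) * opY ?V' (std (Suc l)) j
          + (- theta d b (Suc l) / \<phi>' (Suc l)) * std (Suc l) j)"
        using l nz'[of "Suc l"] by (auto simp: fun_eq_iff bimat_Y std_def)
      then have "std l \<in> S'" using subspace_lin[OF S'sub S'Y[OF m] m] by metis
      then show ?case by (simp add: l_def)
    qed
    have "y \<in> S'" if y: "y \<in> car ?V'" for y
    proof -
      have "(\<lambda>j. \<Sum>i\<le>d. y i * std i j) \<in> S'"
      proof (rule clin_on_sum(1)[OF _ S'sub])
        show "clin_on S' (\<lambda>x. x)" by (simp add: clin_on_def)
        show "std i \<in> S'" if "i \<le> d" for i using stdS[of "d - i"] that by simp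
      qed
      moreover have "(\<Sum>i\<le>d. y i * std i j) = y j" for j
      proof -
        have "(\<Sum>i\<le>d. y i * std i j) = (\<Sum>i\<le>d. if i = j then y j else 0)"
          by (intro sum.cong) (auto simp: std_def)
        then show ?thesis using y by auto
      qed
      ultimately show ?thesis by simp
    qed
    then have "h ` car ?V' \<subseteq> S" unfolding S'_def by blast
    then show ?thesis using S(1) h(2) unfolding bij_betw_def by blast
  qed
  have "std 0 \<in> car ?V" "std 0 \<noteq> vzero" by (auto simp: std_def vzero_def fun_eq_iff)
  then have "car ?V \<noteq> {vzero}" by blast
  then show ?thesis unfolding irreducible_mod_def using full by blast
qed

text \<open>The absolute value of \<open>theta d a i\<close> is (h + 2i)/2, which for positive h
  grows with i.\<close>

lemma theta_simple:
  fixes h :: real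
  assumes "2 * a - of_nat d = complex_of_real h" "h > 0" "1 \<le> i"
  shows "theta d a i \<noteq> theta d a 0"
proof
  assume "theta d a i = theta d a 0"
  then have "(-1) ^ i * complex_of_real (h + 2 * real i) = complex_of_real h"
    unfolding theta_def using assms(1) by simp
  then have "complex_of_real ((-1) ^ i * (h + 2 * real i)) = complex_of_real h" by simp
  then have "(-1) ^ i * (h + 2 * real i) = h" unfolding of_real_eq_iff .
  then show False using assms(2,3) by (cases "even i") auto
qed

lemma E_irreducible:
  fixes h :: real
  assumes "odd d" "2 * a - of_nat d = complex_of_real h" "h > 0"
    and "\<And>i. 1 \<le> i \<Longrightarrow> i \<le> d \<Longrightarrow> phiE d a b c i \<noteq> 0"
    and "\<And>i. 1 \<le> i \<Longrightarrow> i \<le> d \<Longrightarrow> phiE d (- a) b c i \<noteq> 0"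
  shows "irreducible_mod (Emod d a b c)"
  unfolding Emod_bimat
proof (rule irreducible_of_reverse[where \<epsilon> = 1 and a' = "- a"])
  have "signs 1 1 1 U = U" for U :: "nat bimod" by (cases U) (simp add: signs_def smul_def)
  then show "bi_iso (bimat d (- a) b (phiE d (- a) b c) (c\<^sup>2 - (- a)\<^sup>2 - b\<^sup>2 + (of_nat d + 1)\<^sup>2 / 4))
     (signs 1 1 1 (bimat d a b (phiE d a b c) (c\<^sup>2 - a\<^sup>2 - b\<^sup>2 + (of_nat d + 1)\<^sup>2 / 4)))"
    using E_reverse[OF assms(1), of a b c] unfolding Emod_bimat by simp
  show "theta d (- a) i = 1 * theta d a (d - i)" if "i \<le> d" for i
    using that assms(1) by (auto simp: theta_def of_nat_diff field_simps minus_one_power_iff)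
  show "theta d a i \<noteq> theta d a 0" if "1 \<le> i" for i
    using theta_simple[OF assms(2,3) that] .
qed (fact assms | simp)+

lemma O_irreducible:
  fixes h :: real
  assumes "even d" "2 * a - of_nat d = complex_of_real h" "h > 0"
    and "\<And>i. 1 \<le> i \<Longrightarrow> i \<le> d \<Longrightarrow> phiO d a b c i \<noteq> 0"
    and "\<And>i. 1 \<le> i \<Longrightarrow> i \<le> d \<Longrightarrow> phiO d (- a) b (- c) i \<noteq> 0"
  shows "irreducible_mod (Omod d a b c)"
  unfolding Omod_bimat
proof (rule irreducible_of_reverse[where \<epsilon> = "- 1" and a' = "- a"])
  show "bi_iso (bimat d (- a) b (phiO d (- a) b (- c)) (2 * (- a) * b - (- c) * (of_nat d + 1)))
     (signs (- 1) 1 (- 1) (bimat d a b (phiO d a b c) (2 * a * b - c * (of_nat d + 1))))"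
    using O_reverse[OF assms(1), of a b c] unfolding Omod_bimat by simp
  show "theta d (- a) i = - 1 * theta d a (d - i)" if "i \<le> d" for i
    using that assms(1) by (auto simp: theta_def of_nat_diff field_simps minus_one_power_iff)
  show "theta d a i \<noteq> theta d a 0" if "1 \<le> i" for i
    using theta_simple[OF assms(2,3) that] .
qed (fact assms | simp)+

lemma irreducible_iso:
  assumes "bi_iso U V" "bimodule U" "irreducible_mod V"
  shows "irreducible_mod U"
proof -
  obtain f where f: "bi_hom U V f" "bij_betw f (car U) (car V)"
    using assms(1) unfolding bi_iso_alt by blast
  note F = bi_homD[OF f(1)] and D = bimoduleD[OF assms(2)]
  have inj: "inj_on f (car U)" and img: "f ` car U = car V" using f(2) unfolding bij_betw_def by auto
  have f0: "f vzero = vzero" by (rule clin_on_zero[OF F(1) D(1)])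
  have z: "vzero \<in> car U" using D(1) unfolding subspace_in_def by blast
  show ?thesis
    unfolding irreducible_mod_def
  proof (intro conjI allI impI)
    show "car U \<noteq> {vzero}"
    proof
      assume "car U = {vzero}"
      then have "car V = {vzero}" using img f0 by (metis image_empty image_insert)
      then show False using assms(3) unfolding irreducible_mod_def by blast
    qed
    fix S assume S: "S \<subseteq> car U \<and> subspace_in S \<and> (\<forall>u\<in>S. opX U u \<in> S \<and> opY U u \<in> S \<and> opZ U u \<in> S)"
    have "subspace_in (f ` S)"
    proof (rule subspace_inI)
      show "f ` S \<noteq> {}" using S unfolding subspace_in_def by blast
      fix p q x y assume "x \<in> f ` S" "y \<in> f ` S"
      then obtain u v where uv: "u \<in> S" "v \<in> S" "x = f u" "y = f v" by blast
      then have "f (\<lambda>j. p * u j + q * v j) = (\<lambda>j. p * x j + q * y j)"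
        using clin_onD[OF F(1) D(1), of u v p q] subsetD[OF conjunct1[OF S]] by simp
      moreover have "(\<lambda>j. p * u j + q * v j) \<in> S" using subspace_lin[of S u v p q] S uv by simp
      ultimately show "(\<lambda>j. p * x j + q * y j) \<in> f ` S" by (rule image_eqI[OF sym])
    qed
    moreover have "f ` S \<subseteq> car V" using S img by blast
    moreover have "\<forall>x\<in>f ` S. opX V x \<in> f ` S \<and> opY V x \<in> f ` S \<and> opZ V x \<in> f ` S"
    proof
      fix x assume "x \<in> f ` S"
      then obtain u where u: "u \<in> S" "x = f u" by blast
      then have "u \<in> car U" using S by blast
      then show "opX V x \<in> f ` S \<and> opY V x \<in> f ` S \<and> opZ V x \<in> f ` S"
        using F(3)[of u, symmetric] F(4)[of u, symmetric] F(5)[of u, symmetric] S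
        unfolding u(2) using u(1) by (metis imageI)
    qed
    ultimately have "f ` S = {vzero} \<or> f ` S = car V"
      using assms(3) unfolding irreducible_mod_def by blast
    then show "S = {vzero} \<or> S = car U"
    proof
      assume "f ` S = {vzero}"
      then have "f ` S = f ` {vzero}" using f0 by simp
      then show ?thesis using inj_on_image_eq_iff[OF inj, of S "{vzero}"] S z by blast
    next
      assume "f ` S = car V"
      then have "f ` S = f ` car U" using img by simp
      then show ?thesis using inj_on_image_eq_iff[OF inj, of S "car U"] S by blast
    qed
  qed
qed

section \<open>Quotients as direct sums\<close>

definition dsum_map :: "(('i \<Rightarrow> complex) \<Rightarrow> 'j \<Rightarrow> complex) list \<Rightarrow> ('i \<Rightarrow> complex) \<Rightarrow> nat \<times> 'j \<Rightarrow> complex" where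
  "dsum_map fs u = (\<lambda>(j, i). if j < length fs then (fs ! j) u i else 0)"

lemma dsum_map_hom:
  assumes "length Vs = length fs" "\<And>j. j < length fs \<Longrightarrow> bi_hom U (Vs ! j) (fs ! j)"
  shows "bi_hom U (dsum Vs) (dsum_map fs)"
  unfolding bi_hom_def
proof (intro conjI)
  have lin: "clin_on (car U) (fs ! j)" and im: "u \<in> car U \<Longrightarrow> (fs ! j) u \<in> car (Vs ! j)"
    and ops: "u \<in> car U \<Longrightarrow> (fs ! j) (opX U u) = opX (Vs ! j) ((fs ! j) u)
      \<and> (fs ! j) (opY U u) = opY (Vs ! j) ((fs ! j) u) \<and> (fs ! j) (opZ U u) = opZ (Vs ! j) ((fs ! j) u)"
    if "j < length fs" for j u
    using bi_homD[OF assms(2)[OF that]] by blast+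
  show "clin_on (car U) (dsum_map fs)"
    using lin unfolding clin_on_def dsum_map_def vec_defs by (auto simp: fun_eq_iff)
  show "dsum_map fs ` car U \<subseteq> car (dsum Vs)"
    using im assms(1) by (auto simp: dsum_def dsum_map_def)
  show "intertwines U (dsum Vs) (dsum_map fs)"
    unfolding intertwines_def
    using ops assms(1) by (auto simp: dsum_def dsum_map_def fun_eq_iff)
qed

lemma dsum_map_zero: "dsum_map fs u = vzero \<longleftrightarrow> (\<forall>j<length fs. (fs ! j) u = vzero)"
  unfolding dsum_map_def vzero_def by (auto simp: fun_eq_iff)

lemma dsum_map_onto:
  assumes "length Vs = length fs" "\<And>j. j < length fs \<Longrightarrow> bi_hom U (Vs ! j) (fs ! j)"
    and "\<And>v. (\<And>j. j < length fs \<Longrightarrow> v j \<in> car (Vs ! j)) \<Longrightarrow> \<exists>u\<in>car U. \<forall>j<length fs. (fs ! j) u = v j"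
  shows "dsum_map fs ` car U = car (dsum Vs)"
proof
  show "dsum_map fs ` car U \<subseteq> car (dsum Vs)"
    using dsum_map_hom[OF assms(1,2)] unfolding bi_hom_def by blast
  show "car (dsum Vs) \<subseteq> dsum_map fs ` car U"
  proof
    fix v assume "v \<in> car (dsum Vs)"
    then have v: "\<And>j. j < length fs \<Longrightarrow> (\<lambda>i. v (j, i)) \<in> car (Vs ! j)"
      "\<And>j i. j \<ge> length fs \<Longrightarrow> v (j, i) = 0"
      unfolding dsum_def by (auto simp: assms(1))
    obtain u where u: "u \<in> car U" "\<forall>j<length fs. (fs ! j) u = (\<lambda>i. v (j, i))"
      using assms(3)[OF v(1)] by blast
    then have "v = dsum_map fs u"
      using v(2) by (auto simp: dsum_map_def fun_eq_iff)
    then show "v \<in> dsum_map fs ` car U" using u(1) by blast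
  qed
qed

lemma quot_isoI:
  assumes "length Vs = length fs" "\<And>j. j < length fs \<Longrightarrow> bi_hom U (Vs ! j) (fs ! j)"
    and "\<And>v. (\<And>j. j < length fs \<Longrightarrow> v j \<in> car (Vs ! j)) \<Longrightarrow> \<exists>u\<in>car U. \<forall>j<length fs. (fs ! j) u = v j"
    and "S = {u \<in> car U. \<forall>j<length fs. (fs ! j) u = vzero}"
  shows "quot_iso U S (dsum Vs)"
  unfolding quot_iso_def
  using dsum_map_hom[OF assms(1,2)] dsum_map_onto[OF assms(1-3)] assms(4)
  by (intro exI[of _ "dsum_map fs"]) (simp add: dsum_map_zero bi_hom_def)

text \<open>Surjectivity already on T is what makes the pairs of maps belonging to different
  exponents jointly surjective, since T lies in the kernel of the other pairs.\<close>
definition quot_pair :: "'i bimod \<Rightarrow> ('i \<Rightarrow> complex) set \<Rightarrow> ('i \<Rightarrow> complex) set \<Rightarrow> 'j bimod \<Rightarrow> bool" where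
  "quot_pair U S T V \<longleftrightarrow> (\<exists>f g. bi_hom U V f \<and> bi_hom U V g
     \<and> S = {u \<in> car U. f u = vzero \<and> g u = vzero}
     \<and> (\<forall>x\<in>car V. \<forall>y\<in>car V. \<exists>u\<in>T. u \<in> car U \<and> f u = x \<and> g u = y))"

lemma all_less_2: "(\<forall>j<Suc (Suc 0). P j) \<longleftrightarrow> P 0 \<and> P (Suc 0)"
  by (auto simp: less_Suc_eq)

lemma all_less_4: "(\<forall>j<Suc (Suc (Suc (Suc 0))). P j) \<longleftrightarrow> P 0 \<and> P (Suc 0) \<and> P (Suc (Suc 0)) \<and> P (Suc (Suc (Suc 0)))"
  by (auto simp: less_Suc_eq)

lemma quot_pair_quot_iso:
  assumes "quot_pair U S T V"
  shows "quot_iso U S (dsum [V, V])"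
proof -
  obtain f g where fg: "bi_hom U V f" "bi_hom U V g"
    "S = {u \<in> car U. f u = vzero \<and> g u = vzero}"
    "\<And>x y. x \<in> car V \<Longrightarrow> y \<in> car V \<Longrightarrow> \<exists>u\<in>T. u \<in> car U \<and> f u = x \<and> g u = y"
    using assms unfolding quot_pair_def by blast
  show ?thesis
  proof (rule quot_isoI[where fs = "[f, g]"])
    show "bi_hom U ([V, V] ! j) ([f, g] ! j)" if "j < length [f, g]" for j
      using that fg(1,2) by (auto simp: less_Suc_eq)
    show "S = {u \<in> car U. \<forall>j<length [f, g]. ([f, g] ! j) u = vzero}"
      using fg(3) by (simp add: all_less_2)
    fix v :: "nat \<Rightarrow> 'b \<Rightarrow> complex"
    assume "\<And>j. j < length [f, g] \<Longrightarrow> v j \<in> car ([V, V] ! j)"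
    from this[of 0] this[of 1] have "v 0 \<in> car V" "v 1 \<in> car V" by auto
    then show "\<exists>u\<in>car U. \<forall>j<length [f, g]. ([f, g] ! j) u = v j"
      using fg(4)[of "v 0" "v 1"] by (auto simp: all_less_2)
  qed simp
qed

lemma bi_hom_restrict:
  assumes "bi_hom U V f" "R \<subseteq> car U"
  shows "bi_hom (restrict_mod U R) V f"
  using assms(1) subsetD[OF assms(2)] image_mono[OF assms(2), of f]
  unfolding bi_hom_def restrict_mod_def clin_on_def intertwines_def
  by (simp add: subset_trans)

text \<open>A remainder argument: preimages under the first pair are taken in T, where the second
  pair vanishes, and the other way round, so that they can simply be added. R is meant to be one of
  the three submodules, with S and S' the other two, whence the kernel is the triple
  intersection.\<close>

lemma quot_pair_quot_iso_restrict:
  assumes V: "quot_pair U S T V" and W: "quot_pair U S' T' W"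
    and R: "subspace_in R" "R \<subseteq> car U" "T \<subseteq> R" "T' \<subseteq> R" "T \<subseteq> S'" "T' \<subseteq> S"
  shows "quot_iso (restrict_mod U R) (R \<inter> S \<inter> S') (dsum [V, V, W, W])"
proof -
  obtain f g where fg: "bi_hom U V f" "bi_hom U V g"
    "S = {u \<in> car U. f u = vzero \<and> g u = vzero}"
    "\<And>x y. x \<in> car V \<Longrightarrow> y \<in> car V \<Longrightarrow> \<exists>u\<in>T. u \<in> car U \<and> f u = x \<and> g u = y"
    using V unfolding quot_pair_def by blast
  obtain f' g' where fg': "bi_hom U W f'" "bi_hom U W g'"
    "S' = {u \<in> car U. f' u = vzero \<and> g' u = vzero}"
    "\<And>x y. x \<in> car W \<Longrightarrow> y \<in> car W \<Longrightarrow> \<exists>u\<in>T'. u \<in> car U \<and> f' u = x \<and> g' u = y"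
    using W unfolding quot_pair_def by blast
  let ?fs = "[f, g, f', g']"
  note rs = bi_hom_restrict[OF _ R(2)]
  show ?thesis
  proof (rule quot_isoI[where fs = ?fs])
    show "bi_hom (restrict_mod U R) ([V, V, W, W] ! j) (?fs ! j)" if "j < length ?fs" for j
      using that rs fg(1,2) fg'(1,2) by (auto simp: less_Suc_eq)
    show "R \<inter> S \<inter> S' = {u \<in> car (restrict_mod U R). \<forall>j<length ?fs. (?fs ! j) u = vzero}"
      using fg(3) fg'(3) R(2) by (auto simp: all_less_4 restrict_mod_def)
    fix v :: "nat \<Rightarrow> 'b \<Rightarrow> complex"
    assume "\<And>j. j < length ?fs \<Longrightarrow> v j \<in> car ([V, V, W, W] ! j)"
    from this[of 0] this[of 1] this[of 2] this[of 3]
    have v: "v 0 \<in> car V" "v 1 \<in> car V" "v 2 \<in> car W" "v 3 \<in> car W" by (auto simp: numeral_eq_Suc)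
    obtain x where x: "x \<in> T" "x \<in> car U" "f x = v 0" "g x = v 1" using fg(4)[OF v(1,2)] by blast
    obtain y where y: "y \<in> T'" "y \<in> car U" "f' y = v 2" "g' y = v 3" using fg'(4)[OF v(3,4)] by blast
    have xR: "x \<in> R" "y \<in> R" using x y R by blast+
    have k: "f' x = vzero" "g' x = vzero" "f y = vzero" "g y = vzero"
      using x(1) y(1) R(5,6) fg(3) fg'(3) by blast+
    have add: "h (vadd x y) = vadd (h x) (h y)" if "clin_on (car U) h" for h :: "('a \<Rightarrow> complex) \<Rightarrow> 'b \<Rightarrow> complex"
      using that x(2) y(2) unfolding clin_on_def by blast
    have "vadd x y \<in> R" using R(1) xR unfolding subspace_in_def by blast
    moreover have "\<forall>j<length ?fs. (?fs ! j) (vadd x y) = v j"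
      using add[OF bi_homD(1)[OF fg(1)]] add[OF bi_homD(1)[OF fg(2)]]
        add[OF bi_homD(1)[OF fg'(1)]] add[OF bi_homD(1)[OF fg'(2)]] k x y
      by (simp add: all_less_4) (simp add: vec_defs numeral_eq_Suc)
    ultimately show "\<exists>u\<in>car (restrict_mod U R). \<forall>j<length ?fs. (?fs ! j) u = v j"
      unfolding restrict_mod_def by auto
  qed simp
qed

lemma quot_pair_iso:
  assumes "quot_pair U S T V" "bi_iso V W" "bimodule V"
  shows "quot_pair U S T W"
proof -
  obtain h where h: "bi_hom V W h" "bij_betw h (car V) (car W)"
    using assms(2) unfolding bi_iso_alt by blast
  have inj: "inj_on h (car V)" and img: "h ` car V = car W" using h(2) unfolding bij_betw_def by auto
  note H = bi_homD[OF h(1)] and D = bimoduleD[OF assms(3)]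
  have z: "vzero \<in> car V" using D(1) unfolding subspace_in_def by blast
  have h0: "h v = vzero \<longleftrightarrow> v = vzero" if "v \<in> car V" for v
    using inj_onD[OF inj _ that z] clin_on_zero[OF H(1) D(1)] by auto
  obtain f g where fg: "bi_hom U V f" "bi_hom U V g"
    "S = {u \<in> car U. f u = vzero \<and> g u = vzero}"
    "\<And>x y. x \<in> car V \<Longrightarrow> y \<in> car V \<Longrightarrow> \<exists>u\<in>T. u \<in> car U \<and> f u = x \<and> g u = y"
    using assms(1) unfolding quot_pair_def by blast
  show ?thesis
    unfolding quot_pair_def
  proof (intro exI conjI)
    show "bi_hom U W (\<lambda>u. h (f u))" "bi_hom U W (\<lambda>u. h (g u))"
      using bi_hom_comp[OF fg(1) h(1)] bi_hom_comp[OF fg(2) h(1)] .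
    show "S = {u \<in> car U. h (f u) = vzero \<and> h (g u) = vzero}"
      using h0 bi_homD(2)[OF fg(1)] bi_homD(2)[OF fg(2)] unfolding fg(3) by auto
    show "\<forall>x\<in>car W. \<forall>y\<in>car W. \<exists>u\<in>T. u \<in> car U \<and> h (f u) = x \<and> h (g u) = y"
      unfolding img[symmetric] using fg(4) by fast
  qed
qed

lemma bi_hom_swap:
  "bi_hom (swapXY U) (swapXY V) f \<longleftrightarrow> bi_hom U V f" "bi_hom (swapXZ U) (swapXZ V) f \<longleftrightarrow> bi_hom U V f"
  unfolding bi_hom_def intertwines_def swapXY_simps swapXZ_simps by (simp_all only: conj_ac)

lemma quot_pair_swap:
  assumes "quot_pair U S T V"
  shows "quot_pair (swapXY U) S T (swapXY V)" "quot_pair (swapXZ U) S T (swapXZ V)"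
  using assms unfolding quot_pair_def bi_hom_swap swapXY_simps swapXZ_simps by assumption+

lemma quot_pair_pullback:
  assumes "quot_pair U' S' T' V" and r: "bi_hom U U' r" "bij_betw r (car U) (car U')"
    and S: "S = {u \<in> car U. r u \<in> S'}" and T: "\<And>u. u \<in> car U \<Longrightarrow> r u \<in> T' \<Longrightarrow> u \<in> T"
  shows "quot_pair U S T V"
proof -
  obtain f g where fg: "bi_hom U' V f" "bi_hom U' V g"
    "S' = {u \<in> car U'. f u = vzero \<and> g u = vzero}"
    "\<And>x y. x \<in> car V \<Longrightarrow> y \<in> car V \<Longrightarrow> \<exists>u\<in>T'. u \<in> car U' \<and> f u = x \<and> g u = y"
    using assms(1) unfolding quot_pair_def by blast
  show ?thesis
    unfolding quot_pair_def
  proof (intro exI conjI)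
    show "bi_hom U V (\<lambda>u. f (r u))" "bi_hom U V (\<lambda>u. g (r u))"
      using bi_hom_comp[OF r(1) fg(1)] bi_hom_comp[OF r(1) fg(2)] .
    show "S = {u \<in> car U. f (r u) = vzero \<and> g (r u) = vzero}"
      using bi_homD(2)[OF r(1)] unfolding S fg(3) by auto
    show "\<forall>x\<in>car V. \<forall>y\<in>car V. \<exists>u\<in>T. u \<in> car U \<and> f (r u) = x \<and> g (r u) = y"
    proof (intro ballI)
      fix x y assume "x \<in> car V" "y \<in> car V"
      then obtain w where w: "w \<in> T'" "w \<in> car U'" "f w = x" "g w = y" using fg(4) by blast
      then obtain u where "u \<in> car U" "r u = w" using r(2) unfolding bij_betw_def by (metis imageE)
      then show "\<exists>u\<in>T. u \<in> car U \<and> f (r u) = x \<and> g (r u) = y" using w T by blast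
    qed
  qed
qed

text \<open>Lets the intersection of the three submodules be treated like the quotients, namely as
  its own quotient by zero.\<close>

lemma quot_iso_bi_iso:
  assumes "quot_iso U {vzero} V" "subspace_in (car U)"
  shows "bi_iso U V"
proof -
  obtain f where f: "clin_on (car U) f" "f ` car U = car V" "{u \<in> car U. f u = vzero} = {vzero}"
    "intertwines U V f"
    using assms(1) unfolding quot_iso_def by blast
  have "inj_on f (car U)"
  proof (rule inj_onI)
    fix x y assume xy: "x \<in> car U" "y \<in> car U" "f x = f y"
    let ?d = "\<lambda>j. 1 * x j + (- 1) * y j"
    have "?d \<in> car U" using subspace_lin[OF assms(2) xy(1,2)] .
    moreover have "f ?d = vzero" using clin_onD[OF f(1) assms(2) xy(1,2), of 1 "- 1"] xy(3)
      by (simp add: vzero_def)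
    ultimately have "?d = vzero" using f(3) by blast
    then show "x = y" by (auto simp: vzero_def fun_eq_iff)
  qed
  then show ?thesis unfolding bi_iso_def bij_betw_def using f by blast
qed

section \<open>Action on coefficients\<close>

text \<open>The Dunkl factor: T_i maps x_i^m to \<open>nu (k i) m\<close> times x_i^(m-1).\<close>

definition nu :: "real \<Rightarrow> nat \<Rightarrow> complex" where
  "nu r m = of_nat m + (if odd m then 2 * complex_of_real r else 0)"

lemma Mn_iff:
  "f \<in> Mn k n \<longleftrightarrow> (\<forall>s a b c. f (s, a, b, c) \<noteq> 0 \<longrightarrow> s < 2 \<and> a + b + c = n)
     \<and> (\<forall>a b c.
       nu (k 1) (Suc a) * f (1, Suc a, b, c) - \<i> * nu (k 2) (Suc b) * f (1, a, Suc b, c)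
         + nu (k 3) (Suc c) * f (0, a, b, Suc c) = 0
     \<and> nu (k 1) (Suc a) * f (0, Suc a, b, c) + \<i> * nu (k 2) (Suc b) * f (0, a, Suc b, c)
         - nu (k 3) (Suc c) * f (1, a, b, Suc c) = 0)"
proof -
  have D: "Dirac k f (s, a, b, c) = (if s = 0 then
       nu (k 1) (Suc a) * f (1, Suc a, b, c) - \<i> * nu (k 2) (Suc b) * f (1, a, Suc b, c)
         + nu (k 3) (Suc c) * f (0, a, b, Suc c)
     else if s = 1 then nu (k 1) (Suc a) * f (0, Suc a, b, c) + \<i> * nu (k 2) (Suc b) * f (0, a, Suc b, c)
         - nu (k 3) (Suc c) * f (1, a, b, Suc c) else 0)" for s a b c
    by (simp add: Dirac_def vadd_def sig_def Tdk_def ex_def incr_def nu_def algebra_simps)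
  have "Dirac k f = vzero \<longleftrightarrow> (\<forall>s a b c. Dirac k f (s, a, b, c) = 0)"
    by (auto simp: fun_eq_iff vzero_def)
  also have "\<dots> \<longleftrightarrow> (\<forall>a b c. Dirac k f (0, a, b, c) = 0 \<and> Dirac k f (1, a, b, c) = 0)"
    by (auto simp: D)
  finally show ?thesis
    unfolding Mn_def homog_def by (simp add: D ex_def)
qed

lemma Mn_subspace: "subspace_in (Mn k n)"
proof (rule subspace_inI)
  show "Mn k n \<noteq> {}"
  proof -
    have "(\<lambda>_. 0) \<in> Mn k n" unfolding Mn_iff by simp
    then show ?thesis by blast
  qed
  fix p q u v assume u: "u \<in> Mn k n" and v: "v \<in> Mn k n"
  show "(\<lambda>j. p * u j + q * v j) \<in> Mn k n"
    unfolding Mn_iff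
  proof (intro conjI allI impI)
    fix s a b c assume "p * u (s, a, b, c) + q * v (s, a, b, c) \<noteq> 0"
    then have "u (s, a, b, c) \<noteq> 0 \<or> v (s, a, b, c) \<noteq> 0" by auto
    then show "s < 2" "a + b + c = n" using u v unfolding Mn_iff by blast+
  next
    fix a b c
    have lin1: "A * (p * x + q * x') - B * (p * y + q * y') + C * (p * z + q * z')
        = p * (A * x - B * y + C * z) + q * (A * x' - B * y' + C * z')"
      and lin2: "A * (p * x + q * x') + B * (p * y + q * y') - C * (p * z + q * z')
        = p * (A * x + B * y - C * z) + q * (A * x' + B * y' - C * z')" for A B C x y z x' y' z' :: complex
      by (simp_all add: algebra_simps)
    show "nu (k 1) (Suc a) * (p * u (1, Suc a, b, c) + q * v (1, Suc a, b, c))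
        - \<i> * nu (k 2) (Suc b) * (p * u (1, a, Suc b, c) + q * v (1, a, Suc b, c))
        + nu (k 3) (Suc c) * (p * u (0, a, b, Suc c) + q * v (0, a, b, Suc c)) = 0"
      using u v unfolding lin1 Mn_iff by simp
    show "nu (k 1) (Suc a) * (p * u (0, Suc a, b, c) + q * v (0, Suc a, b, c))
        + \<i> * nu (k 2) (Suc b) * (p * u (0, a, Suc b, c) + q * v (0, a, Suc b, c))
        - nu (k 3) (Suc c) * (p * u (1, a, b, Suc c) + q * v (1, a, b, Suc c)) = 0"
      using u v unfolding lin2 Mn_iff by simp
  qed
qed

lemma Mx_subspace: "subspace_in (Mx k n i)"
proof (rule subspace_inI)
  show "Mx k n i \<noteq> {}"
  proof -
    have "(\<lambda>_. 0) \<in> Mx k n i" unfolding Mx_def Mn_iff by simp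
    then show ?thesis by blast
  qed
  fix p q u v assume uv: "u \<in> Mx k n i" "v \<in> Mx k n i"
  have "tt (k i) \<le> enat (ex i \<alpha>)" if "p * u (s, \<alpha>) + q * v (s, \<alpha>) \<noteq> 0" for s \<alpha>
  proof -
    have "u (s, \<alpha>) \<noteq> 0 \<or> v (s, \<alpha>) \<noteq> 0" using that by auto
    then show ?thesis using uv unfolding Mx_def by blast
  qed
  then show "(\<lambda>j. p * u j + q * v j) \<in> Mx k n i"
    using subspace_lin[OF Mn_subspace, of u k n v p q] uv unfolding Mx_def by simp
qed

lemma coord_ops:
  "Tdk k 1 f (s, a, b, c) = nu (k 1) (Suc a) * f (s, Suc a, b, c)"
  "Tdk k 2 f (s, a, b, c) = nu (k 2) (Suc b) * f (s, a, Suc b, c)"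
  "Tdk k 3 f (s, a, b, c) = nu (k 3) (Suc c) * f (s, a, b, Suc c)"
  "mulx 1 f (s, a, b, c) = (if 1 \<le> a then f (s, a - 1, b, c) else 0)"
  "mulx 2 f (s, a, b, c) = (if 1 \<le> b then f (s, a, b - 1, c) else 0)"
  "mulx 3 f (s, a, b, c) = (if 1 \<le> c then f (s, a, b, c - 1) else 0)"
  "Rf 1 f (s, a, b, c) = (-1) ^ a * f (s, a, b, c)"
  "Rf 2 f (s, a, b, c) = (-1) ^ b * f (s, a, b, c)"
  "Rf 3 f (s, a, b, c) = (-1) ^ c * f (s, a, b, c)"
  "sig 1 f (s, a, b, c) = (if s < 2 then f (1 - s, a, b, c) else 0)"
  "sig 2 f (s, a, b, c) = (if s < 2 then - \<i> * (-1) ^ s * f (1 - s, a, b, c) else 0)"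
  "sig 3 f (s, a, b, c) = (if s < 2 then (-1) ^ s * f (s, a, b, c) else 0)"
  by (auto simp: sig_def mulx_def Tdk_def Rf_def ex_def incr_def decr_def nu_def numeral_2_eq_2 less_Suc_eq)

lemma opX_Mmod:
  "opX (Mmod k n) f (s, a, b, c) =
     (if s < 2 then \<i> * ((if 1 \<le> c then nu (k 2) (Suc b) * ((-1) ^ Suc b * ((-1) ^ (c - 1) * f (1 - s, a, Suc b, c - 1))) else 0)
          - (if 1 \<le> b then nu (k 3) (Suc c) * ((-1) ^ (b - 1) * ((-1) ^ Suc c * f (1 - s, a, b - 1, Suc c))) else 0)) else 0)
      + (1 / 2 * ((-1) ^ b * ((-1) ^ c * f (s, a, b, c)))
      + (complex_of_real (k 2) * ((-1) ^ c * f (s, a, b, c))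
      + complex_of_real (k 3) * ((-1) ^ b * f (s, a, b, c))))"
  by (simp only: Mmod_def bimod.simps opG_def Let_def vec_defs coord_ops) (simp only: if_distrib[of "\<lambda>x. _ * x"] mult_zero_right)

lemma opY_Mmod:
  "opY (Mmod k n) f (s, a, b, c) =
     (if s < 2 then (-1) ^ s * ((if 1 \<le> a then nu (k 3) (Suc c) * ((-1) ^ Suc c * ((-1) ^ (a - 1) * f (1 - s, a - 1, b, Suc c))) else 0)
          - (if 1 \<le> c then nu (k 1) (Suc a) * ((-1) ^ (c - 1) * ((-1) ^ Suc a * f (1 - s, Suc a, b, c - 1))) else 0)) else 0)
      + (1 / 2 * ((-1) ^ c * ((-1) ^ a * f (s, a, b, c)))
      + (complex_of_real (k 3) * ((-1) ^ a * f (s, a, b, c))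
      + complex_of_real (k 1) * ((-1) ^ c * f (s, a, b, c))))"
proof -
  have i: "\<i> * (if s < 2 then - \<i> * (-1) ^ s * D else 0) = (if s < 2 then (-1) ^ s * D else 0)" for D
    by (simp flip: mult.assoc)
  show ?thesis
    by (simp only: Mmod_def bimod.simps opG_def Let_def vec_defs coord_ops i)
qed

lemma opZ_Mmod:
  "opZ (Mmod k n) f (s, a, b, c) =
     (if s < 2 then \<i> * ((-1) ^ s * ((if 1 \<le> b then nu (k 1) (Suc a) * ((-1) ^ Suc a * ((-1) ^ (b - 1) * f (s, Suc a, b - 1, c))) else 0)
          - (if 1 \<le> a then nu (k 2) (Suc b) * ((-1) ^ (a - 1) * ((-1) ^ Suc b * f (s, a - 1, Suc b, c))) else 0))) else 0)
      + (1 / 2 * ((-1) ^ a * ((-1) ^ b * f (s, a, b, c)))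
      + (complex_of_real (k 1) * ((-1) ^ b * f (s, a, b, c))
      + complex_of_real (k 2) * ((-1) ^ a * f (s, a, b, c))))"
  by (simp only: Mmod_def bimod.simps opG_def Let_def vec_defs coord_ops) (simp only: if_distrib[of "\<lambda>x. _ * x"] mult_zero_right)

lemma MnD:
  assumes "f \<in> Mn k n"
  shows "f (s, a, b, c) \<noteq> 0 \<Longrightarrow> s < 2" "f (s, a, b, c) \<noteq> 0 \<Longrightarrow> a + b + c = n"
    "nu (k 1) (Suc a) * f (1, Suc a, b, c) - \<i> * nu (k 2) (Suc b) * f (1, a, Suc b, c)
         + nu (k 3) (Suc c) * f (0, a, b, Suc c) = 0"
    "nu (k 1) (Suc a) * f (0, Suc a, b, c) + \<i> * nu (k 2) (Suc b) * f (0, a, Suc b, c)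
         - nu (k 3) (Suc c) * f (1, a, b, Suc c) = 0"
  using assms unfolding Mn_iff by blast+

text \<open>This is -i times the eigenvalue of sigma_3 on the component s. It collects the factors
  in which the row formulas for the two spinor components differ, and its square is -1.\<close>

definition spin :: "nat \<Rightarrow> complex" where "spin s = (if s = 0 then - \<i> else \<i>)"

lemma less_2_cases: "(s :: nat) < 2 \<Longrightarrow> (s = 0 \<Longrightarrow> P) \<Longrightarrow> (s = 1 \<Longrightarrow> P) \<Longrightarrow> P"
  by linarith

text \<open>On a row of constant odd x3-exponent the Dirac equation eliminates the neighbouring
  rows from the action of X and Y.\<close>
lemma opX_row:
  assumes f: "f \<in> Mn k n" and s: "s < 2" and b: "1 \<le> b" and c: "odd c"
    and z: "nu (k 2) (Suc b) * f (1 - s, a, Suc b, c - 1) = 0"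
  shows "opX (Mmod k n) f (s, a, b, c) = (-1) ^ Suc b *
     ((of_nat b + complex_of_real (k 2) - complex_of_real (k 3) + 1 / 2) * f (s, a, b, c)
        + spin s * nu (k 1) (Suc a) * f (s, Suc a, b - 1, c))"
proof -
  define e where "e = (-1 :: complex) ^ b"
  have e2: "e * e = 1" by (simp add: e_def flip: power_mult_distrib)
  have Sb: "Suc (b - 1) = b" using b by simp
  have eb: "(-1 :: complex) ^ (b - 1) = - e" using b by (cases b) (simp_all add: e_def)
  have c1: "1 \<le> c" using c by (cases c) auto
  have ec: "(-1 :: complex) ^ c = - 1" "(-1 :: complex) ^ Suc c = 1" using c by simp_all
  have z': "nu (k 2) (Suc b) * (A * (B * f (1 - s, a, Suc b, c - 1))) = 0" for A B
    using z by auto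
  have nb: "nu (k 2) b = of_nat b + complex_of_real (k 2) * (1 - e)"
    by (simp add: nu_def e_def)
  define G where "G = f (1 - s, a, b - 1, Suc c)"
  define F where "F = f (s, a, b, c)"
  define H where "H = f (s, Suc a, b - 1, c)"
  have op: "opX (Mmod k n) f (s, a, b, c) = \<i> * (- (nu (k 3) (Suc c) * (- e * G)))
     + (- (1 / 2 * e * F) + (- (complex_of_real (k 2) * F) + complex_of_real (k 3) * e * F))"
    unfolding opX_Mmod z' eb ec G_def F_def using s b c1 by (simp add: e_def)
  \<comment> \<open>The Dirac equation at the exponents (a, b - 1, c) expresses the neighbour in row
    c + 1 through row c. The neighbour in row c - 1 has already dropped out by the assumption
    z.\<close>
  have D: "\<i> * (nu (k 3) (Suc c) * G) = spin s * nu (k 1) (Suc a) * H * (- 1) - nu (k 2) b * F"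
    using s
  proof (rule less_2_cases)
    assume s0: "s = 0"
    have "nu (k 3) (Suc c) * G = nu (k 1) (Suc a) * H + \<i> * nu (k 2) b * F"
      using MnD(4)[OF f, of a "b - 1" c] unfolding G_def H_def F_def s0 Sb by simp
    then show ?thesis by (simp add: spin_def s0 algebra_simps)
  next
    assume s1: "s = 1"
    have e: "nu (k 3) (Suc c) * G = \<i> * nu (k 2) b * F - nu (k 1) (Suc a) * H"
      using MnD(3)[OF f, of a "b - 1" c] unfolding G_def H_def F_def s1 Sb
      by (simp add: algebra_simps add_eq_0_iff)
    show ?thesis unfolding e by (simp add: spin_def s1 algebra_simps)
  qed
  have "opX (Mmod k n) f (s, a, b, c) = e * (\<i> * (nu (k 3) (Suc c) * G))
     + (- (1 / 2 * e * F) + (- (complex_of_real (k 2) * F) + complex_of_real (k 3) * e * F))"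
    unfolding op by simp
  also have "\<dots> = - e * ((of_nat b + complex_of_real (k 2) - complex_of_real (k 3) + 1 / 2) * F
        + spin s * nu (k 1) (Suc a) * H)"
    unfolding D nb using e2 by algebra
  finally show ?thesis unfolding e_def F_def H_def by simp
qed

lemma opY_row:
  assumes f: "f \<in> Mn k n" and s: "s < 2" and c: "odd c"
    and z: "nu (k 1) (Suc a) * f (1 - s, Suc a, b, c - 1) = 0"
  shows "opY (Mmod k n) f (s, a, b, c) = (-1) ^ Suc a *
     ((of_nat a + complex_of_real (k 1) - complex_of_real (k 3) + 1 / 2) * f (s, a, b, c)
        - spin s * nu (k 2) (Suc b) * (if 1 \<le> a then f (s, a - 1, Suc b, c) else 0))"
proof -
  define e where "e = (-1 :: complex) ^ a"
  have e2: "e * e = 1" by (simp add: e_def flip: power_mult_distrib)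
  have c1: "1 \<le> c" using c by (cases c) auto
  have ec: "(-1 :: complex) ^ c = - 1" "(-1 :: complex) ^ Suc c = 1" using c by simp_all
  have z': "nu (k 1) (Suc a) * (A * (B * f (1 - s, Suc a, b, c - 1))) = 0" for A B
    using z by auto
  have na: "nu (k 1) a = of_nat a + complex_of_real (k 1) * (1 - e)"
    by (simp add: nu_def e_def)
  define G where "G = (if 1 \<le> a then f (1 - s, a - 1, b, Suc c) else 0)"
  define F where "F = f (s, a, b, c)"
  define H where "H = (if 1 \<le> a then f (s, a - 1, Suc b, c) else 0)"
  have op: "opY (Mmod k n) f (s, a, b, c) = (-1) ^ s * (nu (k 3) (Suc c) * (- e * G))
     + (- (1 / 2 * e * F) + (complex_of_real (k 3) * e * F - complex_of_real (k 1) * F))"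
  proof (cases a)
    case 0
    then show ?thesis unfolding opY_Mmod z' ec G_def F_def using s c1 by (simp add: e_def)
  next
    case (Suc a')
    then show ?thesis unfolding opY_Mmod z' ec G_def F_def using s c1 by (simp add: e_def)
  qed
  have D: "(-1) ^ s * (nu (k 3) (Suc c) * G) = nu (k 1) a * F - spin s * nu (k 2) (Suc b) * H"
  proof (cases a)
    case 0
    then show ?thesis by (simp add: G_def H_def nu_def)
  next
    case (Suc a')
    show ?thesis
      using s
    proof (rule less_2_cases)
      assume s0: "s = 0"
      show ?thesis using MnD(4)[OF f, of a' b c] unfolding G_def H_def F_def s0 Suc
        by (simp add: spin_def algebra_simps)
    next
      assume s1: "s = 1"
      show ?thesis using MnD(3)[OF f, of a' b c] unfolding G_def H_def F_def s1 Suc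
        by (simp add: spin_def algebra_simps add_eq_0_iff)
    qed
  qed
  have "opY (Mmod k n) f (s, a, b, c) = - e * ((-1) ^ s * (nu (k 3) (Suc c) * G))
     + (- (1 / 2 * e * F) + (complex_of_real (k 3) * e * F - complex_of_real (k 1) * F))"
    unfolding op by simp
  also have "\<dots> = - e * ((of_nat a + complex_of_real (k 1) - complex_of_real (k 3) + 1 / 2) * F
        - spin s * nu (k 2) (Suc b) * H)"
    unfolding D na using e2 by algebra
  finally show ?thesis unfolding e_def F_def H_def by simp
qed

text \<open>Z keeps the x_3-exponent, so it acts within the row. Odd a + b makes R_1 R_2 act as -1,
  which gives the summand -1/2.\<close>

lemma opZ_row:
  assumes s: "s < 2" and b: "1 \<le> b" and ab: "odd (a + b)"
  shows "opZ (Mmod k n) f (s, a, b, c) =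
     ((-1) ^ a * (complex_of_real (k 2) - complex_of_real (k 1)) - 1 / 2) * f (s, a, b, c)
     + spin s * (nu (k 1) (Suc a) * f (s, Suc a, b - 1, c)
       - nu (k 2) (Suc b) * (if 1 \<le> a then f (s, a - 1, Suc b, c) else 0))"
proof -
  define e where "e = (-1 :: complex) ^ a"
  have eb: "(-1 :: complex) ^ b = - e" using ab by (cases "even a") (simp_all add: e_def)
  have e2: "e * e = 1" by (simp add: e_def flip: power_mult_distrib)
  have e2': "e * (e * x) = x" for x using e2 by (metis mult.assoc mult.left_neutral)
  have sp: "spin s = - \<i> * (-1) ^ s" using s by (rule less_2_cases) (simp_all add: spin_def)
  obtain b' where b': "b = Suc b'" using b by (cases b) auto
  have eb': "(-1 :: complex) ^ b' = e" using eb b' by simp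
  show ?thesis
  proof (cases a)
    case 0
    then have e: "e = 1" by (simp add: e_def)
    show ?thesis
      unfolding opZ_Mmod sp eb' eb using s 0 e by (simp add: b' eb' algebra_simps)
  next
    case (Suc a')
    have ea': "(-1 :: complex) ^ a' = - e" using Suc by (simp add: e_def)
    have ea: "(-1 :: complex) ^ a = e" by (simp add: e_def)
    have "1 \<le> a" "a - 1 = a'" using Suc by auto
    then show ?thesis
      unfolding opZ_Mmod sp eb ea power_Suc using s b b' eb' ea'
      by (simp add: e2 e2' algebra_simps)
  qed
qed

text \<open>The coordinates run along the row x_3^t through the monomials x_1^(a0-i) x_2^(b0+i). The
  denominators turn the off-diagonal coefficient of \<open>opX_row\<close> into the subdiagonal
  1.\<close>

definition row_map :: "(nat \<Rightarrow> real) \<Rightarrow> nat \<Rightarrow> nat \<Rightarrow> nat \<Rightarrow> nat \<Rightarrow> nat \<Rightarrow> pv \<Rightarrow> nat \<Rightarrow> complex" where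
  "row_map k t a0 b0 d s f = (\<lambda>i. if i \<le> d
     then f (s, a0 - i, b0 + i, t) / (\<Prod>l<i. (-1) ^ Suc l * spin s * nu (k 1) (a0 - l)) else 0)"

text \<open>z1 and z2 remove row t - 1 from the action of X and Y; z3 and z4 cut the segment off at
  its two ends. What is left is bidiagonal and is identified by its diagonals (th, ths) and by the
  products of opposite off-diagonal entries of X and Y, which no rescaling changes and which equal a
  product of two Dunkl factors.\<close>

lemma row_map_hom:
  assumes U: "U \<subseteq> Mn k n" and s: "s < 2" and t: "odd t"
    and a0: "even a0" "d \<le> a0" and b0: "odd b0"
    and z1: "\<And>f i. f \<in> U \<Longrightarrow> i \<le> d \<Longrightarrow> f (1 - s, a0 - i, Suc (b0 + i), t - 1) = 0"
    and z2: "\<And>f i. f \<in> U \<Longrightarrow> i \<le> d \<Longrightarrow> nu (k 1) (Suc (a0 - i)) * f (1 - s, Suc (a0 - i), b0 + i, t - 1) = 0"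
    and z3: "\<And>f. f \<in> U \<Longrightarrow> nu (k 1) (Suc a0) * f (s, Suc a0, b0 - 1, t) = 0"
    and z4: "\<And>f. f \<in> U \<Longrightarrow> d < a0 \<Longrightarrow> f (s, a0 - d - 1, Suc (b0 + d), t) = 0"
    and th: "\<And>i. i \<le> d \<Longrightarrow> theta d \<alpha> i
        = (-1) ^ i * (of_nat (b0 + i) + complex_of_real (k 2) - complex_of_real (k 3) + 1 / 2)"
    and ths: "\<And>i. i \<le> d \<Longrightarrow> theta d \<beta> i
        = - ((-1) ^ i * (of_nat (a0 - i) + complex_of_real (k 1) - complex_of_real (k 3) + 1 / 2))"
    and sys: "bi_sys (theta d \<alpha>) (theta d \<beta>) \<phi> \<kappa> \<nu> \<mu> (complex_of_real (k 2) - complex_of_real (k 1))"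
    and \<phi>d: "\<phi> (Suc d) = 0"
    and nz: "\<And>i. i < d \<Longrightarrow> nu (k 1) (a0 - i) \<noteq> 0"
    and \<phi>: "\<And>i. i < d \<Longrightarrow> \<phi> (Suc i) = nu (k 1) (a0 - i) * nu (k 2) (Suc (b0 + i))"
  shows "bi_hom (restrict_mod (Mmod k n) U) (bimat d \<alpha> \<beta> \<phi> \<mu>) (row_map k t a0 b0 d s)"
proof -
  let ?V = "bimat d \<alpha> \<beta> \<phi> \<mu>" and ?h = "row_map k t a0 b0 d s"
  define x where "x l = (-1) ^ Suc l * spin s * nu (k 1) (a0 - l)" for l
  define g where "g i = (\<Prod>l<i. x l)" for i
  have h: "?h f i = (if i \<le> d then f (s, a0 - i, b0 + i, t) / g i else 0)" for f i
    by (simp add: row_map_def g_def x_def)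
  have sp2: "spin s * spin s = - 1" by (simp add: spin_def)
  have sp0: "spin s \<noteq> 0" by (simp add: spin_def)
  have x0: "x l \<noteq> 0" if "l < d" for l using nz[OF that] sp0 by (simp add: x_def)
  have gS: "g (Suc i) = g i * x i" for i by (simp add: g_def)
  have g0: "g i \<noteq> 0" if "i \<le> d" for i using x0 that by (simp add: g_def)
  have lin: "clin_on U ?h"
    by (intro clin_onI) (auto simp: h add_divide_distrib)
  have pm: "(-1 :: complex) ^ i * (-1) ^ i = 1" for i by (simp flip: power_mult_distrib)
  have term1: "spin s * nu (k 1) (Suc (a0 - i)) * f (s, Suc (a0 - i), b0 + i - 1, t) / g i
      = (-1) ^ i * (if 1 \<le> i then ?h f (i - 1) else 0)" if f: "f \<in> U" and i: "i \<le> d" for f i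
  proof (cases i)
    case 0
    then show ?thesis using z3[OF f] by simp
  next
    case (Suc l)
    then have l: "l < d" "a0 - l = Suc (a0 - i)" "b0 + i - 1 = b0 + l" using i a0 by auto
    have "spin s * nu (k 1) (Suc (a0 - i)) = (-1) ^ i * x l"
      using l pm[of l] by (simp add: x_def Suc flip: mult.assoc)
    moreover have "g i = g l * x l" using Suc gS by simp
    ultimately show ?thesis
      using l x0[OF l(1)] g0[of l] by (simp add: Suc h)
  qed
  have term2: "spin s * nu (k 2) (Suc (b0 + i)) * (if 1 \<le> a0 - i then f (s, a0 - i - 1, Suc (b0 + i), t) else 0) / g i
      = (-1) ^ i * (if i < d then \<phi> (Suc i) * ?h f (Suc i) else 0)" if f: "f \<in> U" and i: "i \<le> d" for f i
  proof (cases "i < d")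
    case True
    then have i': "1 \<le> a0 - i" "a0 - i - 1 = a0 - Suc i" "Suc i \<le> d" using a0 by auto
    have "(-1) ^ i * \<phi> (Suc i) = spin s * nu (k 2) (Suc (b0 + i)) * x i"
    proof -
      have "spin s * nu (k 2) (Suc (b0 + i)) * x i
          = - (spin s * spin s) * (-1) ^ i * (nu (k 1) (a0 - i) * nu (k 2) (Suc (b0 + i)))"
        by (simp add: x_def)
      then show ?thesis unfolding sp2 \<phi>[OF True] by auto
    qed
    then have "(-1) ^ i * (\<phi> (Suc i) * ?h f (Suc i)) = spin s * nu (k 2) (Suc (b0 + i)) * x i * ?h f (Suc i)"
      by (simp flip: mult.assoc)
    then show ?thesis using True i' x0[OF True] g0[of i] by (simp add: h gS)
  next
    case False
    then have "i = d" using i by simp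
    then show ?thesis using z4[OF f] by (cases "d < a0") auto
  qed
  have sg: "(-1 :: complex) ^ Suc (b0 + i) = (-1) ^ i" for i using b0 by (simp add: power_add)
  have sa: "(-1 :: complex) ^ Suc (a0 - i) = - ((-1) ^ i)" "(-1 :: complex) ^ (a0 - i) = (-1) ^ i" if "i \<le> d" for i
    using a0 that by (auto simp: minus_one_power_iff)
  have b1: "1 \<le> b0 + i" for i using b0 by (cases b0) auto
  have dist1: "e * (T * F + R) / G = e * T * (F / G) + e * (R / G)"
    and dist2: "- e * (T * F - R) / G = - (e * T) * (F / G) + e * (R / G)" for e T F R G :: complex
    by (simp_all add: algebra_simps add_divide_distrib diff_divide_distrib)
  have X: "?h (opX (Mmod k n) f) = opX ?V (?h f)" if f: "f \<in> U" for f
  proof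
    fix i
    show "?h (opX (Mmod k n) f) i = opX ?V (?h f) i"
    proof (cases "i \<le> d")
      case True
      have "opX (Mmod k n) f (s, a0 - i, b0 + i, t) = (-1) ^ i *
          ((of_nat (b0 + i) + complex_of_real (k 2) - complex_of_real (k 3) + 1 / 2) * f (s, a0 - i, b0 + i, t)
            + spin s * nu (k 1) (Suc (a0 - i)) * f (s, Suc (a0 - i), b0 + i - 1, t))"
        using opX_row[OF subsetD[OF U f] s b1[of i] t, where a = "a0 - i"] z1[OF f True]
        unfolding sg by simp
      then have "?h (opX (Mmod k n) f) i = theta d \<alpha> i * ?h f i
          + (-1) ^ i * (spin s * nu (k 1) (Suc (a0 - i)) * f (s, Suc (a0 - i), b0 + i - 1, t) / g i)"
        using True unfolding h th[OF True] by (simp only: if_True dist1)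
      then show ?thesis unfolding term1[OF f True] using True pm[of i]
        by (simp add: bimat_X flip: mult.assoc)
    qed (simp add: h bimat_X)
  qed
  have Y: "?h (opY (Mmod k n) f) = opY ?V (?h f)" if f: "f \<in> U" for f
  proof
    fix i
    show "?h (opY (Mmod k n) f) i = opY ?V (?h f) i"
    proof (cases "i \<le> d")
      case True
      have "opY (Mmod k n) f (s, a0 - i, b0 + i, t) = - ((-1) ^ i) *
          ((of_nat (a0 - i) + complex_of_real (k 1) - complex_of_real (k 3) + 1 / 2) * f (s, a0 - i, b0 + i, t)
            - spin s * nu (k 2) (Suc (b0 + i)) * (if 1 \<le> a0 - i then f (s, a0 - i - 1, Suc (b0 + i), t) else 0))"
        using opY_row[OF subsetD[OF U f] s t z2[OF f True]] unfolding sa[OF True] .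
      then have "?h (opY (Mmod k n) f) i = theta d \<beta> i * ?h f i
          + (-1) ^ i * (spin s * nu (k 2) (Suc (b0 + i)) * (if 1 \<le> a0 - i then f (s, a0 - i - 1, Suc (b0 + i), t) else 0) / g i)"
        using True unfolding h ths[OF True] by (simp only: if_True dist2)
      then show ?thesis unfolding term2[OF f True] using True pm[of i]
        by (simp add: bimat_Y flip: mult.assoc)
    qed (simp add: h bimat_Y)
  qed
  have Z: "?h (opZ (Mmod k n) f) = opZ ?V (?h f)" if f: "f \<in> U" for f
  proof
    fix i
    show "?h (opZ (Mmod k n) f) i = opZ ?V (?h f) i"
    proof (cases "i \<le> d")
      case True
      have ab: "odd (a0 - i + (b0 + i))" using a0 b0 True by auto
      have "?h (opZ (Mmod k n) f) i
        = ((-1) ^ i * (complex_of_real (k 2) - complex_of_real (k 1)) - 1 / 2) * ?h f i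
          + spin s * nu (k 1) (Suc (a0 - i)) * f (s, Suc (a0 - i), b0 + i - 1, t) / g i
          - spin s * nu (k 2) (Suc (b0 + i)) * (if 1 \<le> a0 - i then f (s, a0 - i - 1, Suc (b0 + i), t) else 0) / g i"
        using True unfolding h opZ_row[OF s b1 ab] sa[OF True]
        by (simp add: add_divide_distrib diff_divide_distrib right_diff_distrib mult.assoc)
      then show ?thesis
        unfolding term1[OF f True] term2[OF f True] bimat_Z_coord[OF sys \<phi>d True]
        by (simp add: mult.assoc)
    next
      case False
      then show ?thesis by (simp add: h bimat_Z bimat_X bimat_Y)
    qed
  qed
  show ?thesis
    unfolding bi_hom_def intertwines_def restrict_mod_def using lin X Y Z
    by (auto simp: h)
qed

section \<open>Rows of Dunkl monogenic polynomials\<close>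

declare One_nat_def [simp del]

text \<open>The bound of the theorem on the sum of the t_i forces all three to be finite, hence odd
  positive integers equal to -2 k_i.\<close>

locale dunkl =
  fixes k :: "nat \<Rightarrow> real" and n t1 t2 t3 :: nat
  assumes t_odd: "odd t1" "odd t2" "odd t3"
    and k: "2 * k 1 = - real t1" "2 * k 2 = - real t2" "2 * k 3 = - real t3"
    and n_even: "even n" and n_ge: "t1 + t2 + t3 \<le> n"
begin

lemma k_complex:
  "complex_of_real (k 1) = - of_nat t1 / 2" "complex_of_real (k 2) = - of_nat t2 / 2"
  "complex_of_real (k 3) = - of_nat t3 / 2"
proof -
  have "k 1 = - real t1 / 2" "k 2 = - real t2 / 2" "k 3 = - real t3 / 2" using k by auto
  then show "complex_of_real (k 1) = - of_nat t1 / 2" "complex_of_real (k 2) = - of_nat t2 / 2"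
    "complex_of_real (k 3) = - of_nat t3 / 2" by simp_all
qed

lemma nu_eq:
  "nu (k 1) m = (if odd m then of_nat m - of_nat t1 else of_nat m)"
  "nu (k 2) m = (if odd m then of_nat m - of_nat t2 else of_nat m)"
  "nu (k 3) m = (if odd m then of_nat m - of_nat t3 else of_nat m)"
  unfolding nu_def k_complex by simp_all

text \<open>The factor of x_i^t_i is t_i + 2 k_i, because t_i is odd. By the next lemma it is the
  only zero among the positive exponents, so this one degeneracy of T_i is the source of all
  submodules.\<close>

lemma nu_zero: "nu (k 1) t1 = 0" "nu (k 2) t2 = 0" "nu (k 3) t3 = 0"
  by (simp_all add: nu_eq t_odd)

lemma nu_nonzero:
  "0 < m \<Longrightarrow> m \<noteq> t1 \<Longrightarrow> nu (k 1) m \<noteq> 0" "0 < m \<Longrightarrow> m \<noteq> t2 \<Longrightarrow> nu (k 2) m \<noteq> 0"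
  "0 < m \<Longrightarrow> m \<noteq> t3 \<Longrightarrow> nu (k 3) m \<noteq> 0"
  by (auto simp: nu_eq)

lemma tt_eq: "tt (k 1) = enat t1" "tt (k 2) = enat t2" "tt (k 3) = enat t3"
proof -
  have "tt r = enat t" if "odd t" "2 * r = - real t" for r t
  proof -
    have "\<exists>m::nat. odd m \<and> 2 * r = - real m" using that by blast
    moreover have "- 2 * r = real t" using that(2) by linarith
    ultimately show ?thesis by (simp add: tt_def)
  qed
  then show "tt (k 1) = enat t1" "tt (k 2) = enat t2" "tt (k 3) = enat t3" using t_odd k by blast+
qed

lemma Mx_iff:
  "f \<in> Mx k n 1 \<longleftrightarrow> f \<in> Mn k n \<and> (\<forall>s a b c. a < t1 \<longrightarrow> f (s, a, b, c) = 0)"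
  "f \<in> Mx k n 2 \<longleftrightarrow> f \<in> Mn k n \<and> (\<forall>s a b c. b < t2 \<longrightarrow> f (s, a, b, c) = 0)"
  "f \<in> Mx k n 3 \<longleftrightarrow> f \<in> Mn k n \<and> (\<forall>s a b c. c < t3 \<longrightarrow> f (s, a, b, c) = 0)"
  unfolding Mx_def ex_def tt_eq by (auto simp: not_le[symmetric])

text \<open>If two exponents are small, the third one exceeds its exceptional value, so the
  Dirac equation expresses the coefficient by vanishing ones.\<close>

lemma vanish_12:
  assumes f: "f \<in> Mn k n" and "a < t1" "b < t2"
  shows "f (s, a, b, c) = 0"
  using assms(2,3)
proof (induction c arbitrary: s a b)
  case 0
  have "a + b + 0 \<noteq> n" using 0 n_ge by linarith
  then show ?case using MnD(2)[OF f] by blast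
next
  case (Suc c)
  show ?case
  proof (cases "s < 2 \<and> a + b + Suc c = n")
    case False
    then show ?thesis using MnD(1,2)[OF f] by blast
  next
    case True
    then have "nu (k 3) (Suc c) \<noteq> 0" using Suc.prems n_ge by (intro nu_nonzero) auto
    \<comment> \<open>If raising a reaches t1, the induction hypothesis no longer applies, but then
      the Dunkl factor is zero.\<close>
    moreover have 1: "nu (k 1) (Suc a) * f (s', Suc a, b, c) = 0" for s'
      using Suc nu_zero(1) by (cases "Suc a = t1") auto
    moreover have 2: "nu (k 2) (Suc b) * f (s', a, Suc b, c) = 0" for s'
      using Suc nu_zero(2) by (cases "Suc b = t2") auto
    moreover have "s = 0 \<or> s = 1" using True by auto
    ultimately show ?thesis
      using MnD(3,4)[OF f, of a b c, unfolded mult.assoc 1 2] by auto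
  qed
qed

lemma vanish_13:
  assumes f: "f \<in> Mn k n" and "a < t1" "c < t3"
  shows "f (s, a, b, c) = 0"
  using assms(2,3)
proof (induction b arbitrary: s a c)
  case 0
  have "a + 0 + c \<noteq> n" using 0 n_ge by linarith
  then show ?case using MnD(2)[OF f] by blast
next
  case (Suc b)
  show ?case
  proof (cases "s < 2 \<and> a + Suc b + c = n")
    case False
    then show ?thesis using MnD(1,2)[OF f] by blast
  next
    case True
    then have "nu (k 2) (Suc b) \<noteq> 0" using Suc.prems n_ge by (intro nu_nonzero) auto
    moreover have 1: "nu (k 1) (Suc a) * f (s', Suc a, b, c) = 0" for s'
      using Suc nu_zero(1) by (cases "Suc a = t1") auto
    moreover have 2: "nu (k 3) (Suc c) * f (s', a, b, Suc c) = 0" for s'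
      using Suc nu_zero(3) by (cases "Suc c = t3") auto
    moreover have "s = 0 \<or> s = 1" using True by auto
    ultimately show ?thesis
      using MnD(3,4)[OF f, of a b c, unfolded mult.assoc 1 2] by auto
  qed
qed

text \<open>Solving the Dirac equation for row c + 1 involves row c with a or b raised by one. So a
  region P may be treated by itself if it is closed under raising, except across t1 and t2, where
  the Dunkl factor vanishes.\<close>

lemma determined_by_row:
  assumes f: "f \<in> Mn k n"
    and P: "\<And>a b. P a b \<Longrightarrow> Suc a \<noteq> t1 \<Longrightarrow> P (Suc a) b" "\<And>a b. P a b \<Longrightarrow> Suc b \<noteq> t2 \<Longrightarrow> P a (Suc b)"
    and row: "\<And>s a b. P a b \<Longrightarrow> f (s, a, b, t3) = 0"
    and "P a b" "t3 \<le> c"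
  shows "f (s, a, b, c) = 0"
  using assms(6,5)
proof (induction c arbitrary: s a b rule: dec_induct)
  case base
  then show ?case by (rule row)
next
  case (step c)
  have "nu (k 3) (Suc c) \<noteq> 0" using step.hyps by (intro nu_nonzero) auto
  moreover have 1: "nu (k 1) (Suc a) * f (s', Suc a, b, c) = 0" for s'
    using step.IH[OF P(1)[OF step.prems]] nu_zero(1) by (cases "Suc a = t1") auto
  moreover have 2: "nu (k 2) (Suc b) * f (s', a, Suc b, c) = 0" for s'
    using step.IH[OF P(2)[OF step.prems]] nu_zero(2) by (cases "Suc b = t2") auto
  moreover have "s = 0 \<or> s = 1 \<or> \<not> s < 2" by auto
  ultimately show ?case
    using MnD(3,4)[OF f, of a b c, unfolded mult.assoc 1 2] MnD(1)[OF f, of s a b "Suc c"]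
    by auto
qed

text \<open>The Dirac equation solved for the row x_3^(t3+j+1). The denominators are nonzero because
  the exponent exceeds t3.\<close>

primrec ck_row :: "(nat \<Rightarrow> nat \<Rightarrow> nat \<Rightarrow> complex) \<Rightarrow> nat \<Rightarrow> nat \<Rightarrow> nat \<Rightarrow> nat \<Rightarrow> complex" where
  "ck_row r 0 = r"
| "ck_row r (Suc j) = (\<lambda>s a b.
     if s = 0 then (\<i> * nu (k 2) (Suc b) * ck_row r j 1 a (Suc b) - nu (k 1) (Suc a) * ck_row r j 1 (Suc a) b)
         / nu (k 3) (Suc (t3 + j))
     else if s = 1 then (nu (k 1) (Suc a) * ck_row r j 0 (Suc a) b + \<i> * nu (k 2) (Suc b) * ck_row r j 0 a (Suc b))
         / nu (k 3) (Suc (t3 + j))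
     else 0)"

text \<open>The rows below t3 may be filled with zeros: the equation that links row t3 - 1 to row t3
  carries the factor \<open>nu (k 3) t3\<close>, which is 0.\<close>

definition ck :: "(nat \<Rightarrow> nat \<Rightarrow> nat \<Rightarrow> complex) \<Rightarrow> pv" where
  "ck r = (\<lambda>(s, a, b, c). if c < t3 then 0 else ck_row r (c - t3) s a b)"

text \<open>Each step spreads the support by lowering a or b, but not across t1 or t2. The condition
  on Q is dual to the one on P in \<open>determined_by_row\<close>.\<close>

lemma ck_row_support:
  assumes "\<And>s a b. r s a b \<noteq> 0 \<Longrightarrow> s < 2 \<and> a + b + t3 = n \<and> Q a b"
    and Q: "\<And>a b. Q (Suc a) b \<Longrightarrow> Suc a \<noteq> t1 \<Longrightarrow> Q a b" "\<And>a b. Q a (Suc b) \<Longrightarrow> Suc b \<noteq> t2 \<Longrightarrow> Q a b"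
  shows "ck_row r j s a b \<noteq> 0 \<Longrightarrow> s < 2 \<and> a + b + t3 + j = n \<and> Q a b"
proof (induction j arbitrary: s a b)
  case 0
  then show ?case using assms(1) by simp
next
  case (Suc j)
  have "s < 2" using Suc.prems by (auto split: if_splits)
  have "\<exists>s'. nu (k 1) (Suc a) * ck_row r j s' (Suc a) b \<noteq> 0 \<or> nu (k 2) (Suc b) * ck_row r j s' a (Suc b) \<noteq> 0"
  proof (rule ccontr)
    assume "\<not> ?thesis"
    then have 0: "nu (k 1) (Suc a) * ck_row r j s' (Suc a) b = 0" "nu (k 2) (Suc b) * ck_row r j s' a (Suc b) = 0" for s'
      by blast+
    show False using Suc.prems unfolding ck_row.simps mult.assoc 0 by (simp split: if_splits)
  qed
  then obtain s' where "nu (k 1) (Suc a) * ck_row r j s' (Suc a) b \<noteq> 0 \<or> nu (k 2) (Suc b) * ck_row r j s' a (Suc b) \<noteq> 0"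
    by blast
  then show ?case
  proof
    assume "nu (k 1) (Suc a) * ck_row r j s' (Suc a) b \<noteq> 0"
    then have "ck_row r j s' (Suc a) b \<noteq> 0" "Suc a \<noteq> t1" using nu_zero(1) by auto
    then show ?thesis using Suc.IH[of s' "Suc a" b] Q(1) \<open>s < 2\<close> by auto
  next
    assume "nu (k 2) (Suc b) * ck_row r j s' a (Suc b) \<noteq> 0"
    then have "ck_row r j s' a (Suc b) \<noteq> 0" "Suc b \<noteq> t2" using nu_zero(2) by auto
    then show ?thesis using Suc.IH[of s' a "Suc b"] Q(2) \<open>s < 2\<close> by auto
  qed
qed

text \<open>Cauchy-Kovalevskaya extension in the variable x3, starting from the row x3^t3.\<close>
lemma ck_extension:
  assumes "\<And>s a b. r s a b \<noteq> 0 \<Longrightarrow> s < 2 \<and> a + b + t3 = n \<and> Q a b"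
    and Q: "\<And>a b. Q (Suc a) b \<Longrightarrow> Suc a \<noteq> t1 \<Longrightarrow> Q a b" "\<And>a b. Q a (Suc b) \<Longrightarrow> Suc b \<noteq> t2 \<Longrightarrow> Q a b"
  shows "ck r \<in> Mx k n 3" "ck r (s, a, b, t3) = r s a b" "ck r (s, a, b, c) \<noteq> 0 \<Longrightarrow> Q a b"
proof -
  note sup = ck_row_support[where r = r and Q = Q, OF assms]
  have M: "ck r \<in> Mn k n"
    unfolding Mn_iff
  proof (intro conjI allI impI)
    fix s a b c assume nz: "ck r (s, a, b, c) \<noteq> 0"
    then have "\<not> c < t3" "ck_row r (c - t3) s a b \<noteq> 0" by (auto simp: ck_def split: if_splits)
    then show "s < 2" "a + b + c = n" using sup[of "c - t3" s a b] by auto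
  next
    fix a b c
    consider "Suc c < t3" | "Suc c = t3" | "t3 \<le> c" by linarith
    then have "nu (k 1) (Suc a) * ck r (1, Suc a, b, c) - \<i> * nu (k 2) (Suc b) * ck r (1, a, Suc b, c)
         + nu (k 3) (Suc c) * ck r (0, a, b, Suc c) = 0
       \<and> nu (k 1) (Suc a) * ck r (0, Suc a, b, c) + \<i> * nu (k 2) (Suc b) * ck r (0, a, Suc b, c)
         - nu (k 3) (Suc c) * ck r (1, a, b, Suc c) = 0"
    proof cases
      case 2
      then show ?thesis using nu_zero(3) by (auto simp: ck_def)
    next
      case 3
      then have nz: "nu (k 3) (Suc c) \<noteq> 0" by (intro nu_nonzero) auto
      have e: "Suc c - t3 = Suc (c - t3)" "t3 + (c - t3) = c" using 3 by auto
      show ?thesis using 3 nz by (simp add: ck_def e)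
    qed (simp add: ck_def)
    then show "nu (k 1) (Suc a) * ck r (1, Suc a, b, c) - \<i> * nu (k 2) (Suc b) * ck r (1, a, Suc b, c)
         + nu (k 3) (Suc c) * ck r (0, a, b, Suc c) = 0"
      "nu (k 1) (Suc a) * ck r (0, Suc a, b, c) + \<i> * nu (k 2) (Suc b) * ck r (0, a, Suc b, c)
         - nu (k 3) (Suc c) * ck r (1, a, b, Suc c) = 0" by blast+
  qed
  then show "ck r \<in> Mx k n 3" unfolding Mx_iff by (simp add: ck_def)
  show "ck r (s, a, b, t3) = r s a b" by (simp add: ck_def)
  show "ck r (s, a, b, c) \<noteq> 0 \<Longrightarrow> Q a b"
    using sup[of "c - t3" s a b] by (auto simp: ck_def split: if_splits)
qed

end

section \<open>The quotient by M_n(x_1) and the intersection of the three submodules\<close>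

context dunkl
begin

abbreviation kap :: complex where "kap \<equiv> complex_of_real (k 1 + k 2 + k 3)"

lemma kap: "kap = - (of_nat t1 + of_nat t2 + of_nat t3) / 2"
  by (simp add: k_complex field_simps)

definition modA :: "nat bimod" where
  "modA = Omod (t1 - 1) (kap + of_nat n + 1) (complex_of_real (k 3)) (complex_of_real (k 2))"

lemma t_pos: "1 \<le> t1" "1 \<le> t2" "1 \<le> t3"
  using t_odd[THEN odd_pos] by simp_all

lemma restrict_mod_self: "restrict_mod (Mmod k n) (Mn k n) = Mmod k n"
  by (simp add: restrict_mod_def Mmod_def)

lemma row_map_at:
  "i \<le> d \<Longrightarrow> row_map k t a0 b0 d s f i
     = f (s, a0 - i, b0 + i, t) / (\<Prod>l<i. (-1) ^ Suc l * spin s * nu (k 1) (a0 - l))"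
  "i > d \<Longrightarrow> row_map k t a0 b0 d s f i = 0"
  by (simp_all add: row_map_def)

lemma row_map_den:
  assumes "\<And>l. l < d \<Longrightarrow> nu (k 1) (a0 - l) \<noteq> 0" "i \<le> d"
  shows "(\<Prod>l<i. (-1) ^ Suc l * spin s * nu (k 1) (a0 - l)) \<noteq> 0"
  using assms by (simp add: spin_def)

lemma row_map_zero_iff:
  assumes "\<And>l. l < d \<Longrightarrow> nu (k 1) (a0 - l) \<noteq> 0"
  shows "row_map k t a0 b0 d s f = vzero \<longleftrightarrow> (\<forall>i\<le>d. f (s, a0 - i, b0 + i, t) = 0)"
proof -
  have "row_map k t a0 b0 d s f = vzero \<longleftrightarrow> (\<forall>i\<le>d. row_map k t a0 b0 d s f i = 0)"
    unfolding vzero_def fun_eq_iff using row_map_at(2) not_le by metis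
  also have "\<dots> \<longleftrightarrow> (\<forall>i\<le>d. f (s, a0 - i, b0 + i, t) = 0)"
    using row_map_den[OF assms] by (simp add: row_map_at)
  finally show ?thesis .
qed

text \<open>The wanted coordinates, rescaled by g, are written on the segment of row t3 and
  extended. Both spinor components can be prescribed independently, which accounts for the two
  copies of each module.\<close>

lemma row_map_onto:
  fixes x y :: "nat \<Rightarrow> complex"
  assumes nz: "\<And>l. l < d \<Longrightarrow> nu (k 1) (a0 - l) \<noteq> 0" and ab: "d \<le> a0" "a0 + b0 + t3 = n"
    and xy: "\<forall>i>d. x i = 0" "\<forall>i>d. y i = 0"
    and Q0: "\<And>i. i \<le> d \<Longrightarrow> Q (a0 - i) (b0 + i)"
    and Q: "\<And>a b. Q (Suc a) b \<Longrightarrow> Suc a \<noteq> t1 \<Longrightarrow> Q a b" "\<And>a b. Q a (Suc b) \<Longrightarrow> Suc b \<noteq> t2 \<Longrightarrow> Q a b"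
  shows "\<exists>f\<in>Mx k n 3. (\<forall>s a b c. f (s, a, b, c) \<noteq> 0 \<longrightarrow> Q a b)
    \<and> row_map k t3 a0 b0 d 0 f = x \<and> row_map k t3 a0 b0 d 1 f = y"
proof -
  define g where "g s i = (\<Prod>l<i. (-1) ^ Suc l * spin s * nu (k 1) (a0 - l))" for s i
  define r where "r s a b = (if s < 2 \<and> a + b + t3 = n \<and> b0 \<le> b \<and> b \<le> b0 + d
      then (if s = 0 then x else y) (b - b0) * g s (b - b0) else 0)" for s a b
  have r: "s < 2 \<and> a + b + t3 = n \<and> Q a b" if "r s a b \<noteq> 0" for s a b
  proof -
    have 1: "s < 2" "a + b + t3 = n" "b0 \<le> b" "b \<le> b0 + d" using that by (auto simp: r_def split: if_splits)
    then have "a = a0 - (b - b0)" "b = b0 + (b - b0)" "b - b0 \<le> d" using ab by auto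
    then show ?thesis using Q0[of "b - b0"] 1 by simp
  qed
  note c = ck_extension[where r = r and Q = Q, OF r Q]
  have row: "row_map k t3 a0 b0 d s (ck r) = (if s = 0 then x else y)" if "s < 2" for s
  proof
    fix i
    show "row_map k t3 a0 b0 d s (ck r) i = (if s = 0 then x else y) i"
    proof (cases "i \<le> d")
      case True
      have "a0 - i + (b0 + i) + t3 = n" using True ab by simp
      then have "r s (a0 - i) (b0 + i) = (if s = 0 then x else y) i * g s i"
        using True that by (simp add: r_def)
      moreover have "g s i \<noteq> 0" unfolding g_def by (rule row_map_den[OF nz True])
      moreover have "ck r (s, a0 - i, b0 + i, t3) = r s (a0 - i) (b0 + i)" by (simp add: ck_def)
      ultimately show ?thesis unfolding row_map_at(1)[OF True] g_def[symmetric] by simp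
    qed (use xy row_map_at(2) in auto)
  qed
  show ?thesis
    by (rule bexI[of _ "ck r"]) (use c row[of 0] row[of 1] in auto)
qed

text \<open>By homogeneity the segment from x_1-exponent t1 - 1 down to 0 contains all coefficients
  of the row x_3^t3 with x_1-exponent below t1. It is cut off at one end by
  \<open>nu (k 1) t1\<close> being 0 and at the other by the exponent 0; row t3 - 1 is removed by
  \<open>vanish_13\<close>.\<close>

lemma quot_pair_A: "quot_pair (Mmod k n) (Mx k n 1) (Mx k n 2 \<inter> Mx k n 3) modA"
proof -
  define d where "d = t1 - 1"
  define b0 where "b0 = n - t3 - t1 + 1"
  have ev: "even d" "odd b0" and sum: "d + b0 + t3 = n" and St: "Suc d = t1"
    using t_odd n_even n_ge t_pos by (auto simp: d_def b0_def)
  have dC: "(of_nat d :: complex) = of_nat t1 - 1"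
    unfolding St[symmetric] by simp
  have bC: "(of_nat b0 :: complex) = of_nat n - of_nat t3 - of_nat t1 + 1"
    unfolding sum[symmetric] by (simp add: dC)
  define \<alpha> \<beta> \<gamma> where "\<alpha> = kap + of_nat n + 1" and "\<beta> = complex_of_real (k 3)" and "\<gamma> = complex_of_real (k 2)"
  have mA: "modA = bimat d \<alpha> \<beta> (phiO d \<alpha> \<beta> \<gamma>) (2 * \<alpha> * \<beta> - \<gamma> * (of_nat d + 1))"
    unfolding modA_def Omod_bimat d_def \<alpha>_def \<beta>_def \<gamma>_def ..
  have nz: "nu (k 1) (d - l) \<noteq> 0" if "l < d" for l
    using that St by (intro nu_nonzero) auto
  have hom: "bi_hom (Mmod k n) modA (row_map k t3 d b0 d s)" if s: "s < 2" for s
  proof -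
    have "\<gamma> + (of_nat d + 1) / 2 = complex_of_real (k 2) - complex_of_real (k 1)"
      by (simp add: \<gamma>_def dC k_complex field_simps)
    then have sys: "bi_sys (theta d \<alpha>) (theta d \<beta>) (phiO d \<alpha> \<beta> \<gamma>) (2 * \<beta> * \<gamma> - \<alpha> * (of_nat d + 1))
      (2 * \<alpha> * \<gamma> - \<beta> * (of_nat d + 1)) (2 * \<alpha> * \<beta> - \<gamma> * (of_nat d + 1))
      (complex_of_real (k 2) - complex_of_real (k 1))" using O_sys[of d \<alpha> \<beta> \<gamma>] by simp
    have "bi_hom (restrict_mod (Mmod k n) (Mn k n))
      (bimat d \<alpha> \<beta> (phiO d \<alpha> \<beta> \<gamma>) (2 * \<alpha> * \<beta> - \<gamma> * (of_nat d + 1))) (row_map k t3 d b0 d s)"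
    proof (rule row_map_hom[OF subset_refl s t_odd(3) ev(1) order_refl ev(2) _ _ _ _ _ _ sys phiO_top[OF ev(1)] nz])
      fix f i assume f: "f \<in> Mn k n" and i: "i \<le> d"
      show "f (1 - s, d - i, Suc (b0 + i), t3 - 1) = 0"
        using St t_pos by (intro vanish_13[OF f]) auto
      show "nu (k 1) (Suc (d - i)) * f (1 - s, Suc (d - i), b0 + i, t3 - 1) = 0"
      \<comment> \<open>For i = 0 the neighbour has x_1-exponent t1, which \<open>vanish_13\<close>
        does not cover, but its Dunkl factor is zero.\<close>
      proof (cases "i = 0")
        case True
        then show ?thesis using St nu_zero(1) by simp
      next
        case False
        then have "f (1 - s, Suc (d - i), b0 + i, t3 - 1) = 0"
          using St t_pos i by (intro vanish_13[OF f]) auto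
        then show ?thesis by simp
      qed
    next
      fix f show "nu (k 1) (Suc d) * f (s, Suc d, b0 - 1, t3) = 0" using St nu_zero(1) by simp
    next
      fix i assume i: "i \<le> d"
      then have iC: "(of_nat (d - i) :: complex) = of_nat t1 - 1 - of_nat i" by (simp add: of_nat_diff dC)
      show "theta d \<alpha> i = (-1) ^ i * (of_nat (b0 + i) + complex_of_real (k 2) - complex_of_real (k 3) + 1 / 2)"
        unfolding theta_def \<alpha>_def kap of_nat_add bC dC k_complex by (simp add: field_simps)
      show "theta d \<beta> i = - ((-1) ^ i * (of_nat (d - i) + complex_of_real (k 1) - complex_of_real (k 3) + 1 / 2))"
        unfolding theta_def \<beta>_def iC dC k_complex by (simp add: field_simps)
    next
      fix i assume i: "i < d"
      then have iC: "(of_nat (d - i) :: complex) = of_nat t1 - 1 - of_nat i" by (simp add: of_nat_diff dC)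
      show "phiO d \<alpha> \<beta> \<gamma> (Suc i) = nu (k 1) (d - i) * nu (k 2) (Suc (b0 + i))"
      proof (cases "even i")
        case True
        then have "even (d - i)" "even (Suc (b0 + i))" using ev i by auto
        then show ?thesis using True
          unfolding phiO_def nu_eq \<alpha>_def \<beta>_def \<gamma>_def kap of_nat_Suc of_nat_add bC dC iC k_complex
          by (simp add: field_simps)
      next
        case False
        then have "odd (d - i)" "odd (Suc (b0 + i))" using ev i by auto
        then show ?thesis using False
          unfolding phiO_def nu_eq \<alpha>_def \<beta>_def \<gamma>_def kap of_nat_Suc of_nat_add bC dC iC k_complex
          by (simp add: field_simps)
      qed
    qed simp
    then show ?thesis unfolding restrict_mod_self mA .
  qed
  have zero_iff: "row_map k t3 d b0 d s f = vzero \<longleftrightarrow> (\<forall>i\<le>d. f (s, d - i, b0 + i, t3) = 0)" for s f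
    by (rule row_map_zero_iff) (rule nz)
  have ker: "Mx k n 1 = {f \<in> Mn k n. row_map k t3 d b0 d 0 f = vzero \<and> row_map k t3 d b0 d 1 f = vzero}"
  proof (intro set_eqI iffI)
    fix f assume "f \<in> Mx k n 1"
    then have f: "f \<in> Mn k n" "\<And>s a b c. a < t1 \<Longrightarrow> f (s, a, b, c) = 0" unfolding Mx_iff by blast+
    have "row_map k t3 d b0 d s f = vzero" for s
      unfolding zero_iff using f(2) St by auto
    then show "f \<in> {f \<in> Mn k n. row_map k t3 d b0 d 0 f = vzero \<and> row_map k t3 d b0 d 1 f = vzero}"
      using f(1) by blast
  next
    fix f assume "f \<in> {f \<in> Mn k n. row_map k t3 d b0 d 0 f = vzero \<and> row_map k t3 d b0 d 1 f = vzero}"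
    then have f: "f \<in> Mn k n" and z: "\<And>i. i \<le> d \<Longrightarrow> f (0, d - i, b0 + i, t3) = 0"
      "\<And>i. i \<le> d \<Longrightarrow> f (1, d - i, b0 + i, t3) = 0"
      unfolding mem_Collect_eq zero_iff by auto
    have row: "f (s, a, b, t3) = 0" if "a < t1" for s a b
    proof (cases "s < 2 \<and> a + b + t3 = n")
      case True
      then have "d - (d - a) = a" "b0 + (d - a) = b" using that St sum by auto
      moreover have "s = 0 \<or> s = 1" using True by auto
      ultimately show ?thesis using z[of "d - a"] by auto
    next
      case False
      then show ?thesis using MnD(1,2)[OF f] by blast
    qed
    have "f (s, a, b, c) = 0" if "a < t1" for s a b c
    proof (cases "c < t3")
      case True
      then show ?thesis using vanish_13[OF f that] by blast
    next
      case False
      show ?thesis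
        by (rule determined_by_row[where P = "\<lambda>a b. a < t1", OF f]) (use that False row in auto)
    qed
    then show "f \<in> Mx k n 1" unfolding Mx_iff using f by blast
  qed
  have onto: "\<exists>f\<in>Mx k n 2 \<inter> Mx k n 3. f \<in> Mn k n \<and> row_map k t3 d b0 d 0 f = x \<and> row_map k t3 d b0 d 1 f = y"
    if xy: "x \<in> car modA" "y \<in> car modA" for x y
  proof -
    have "\<exists>f\<in>Mx k n 3. (\<forall>s a b c. f (s, a, b, c) \<noteq> 0 \<longrightarrow> a < t1)
      \<and> row_map k t3 d b0 d 0 f = x \<and> row_map k t3 d b0 d 1 f = y"
      by (rule row_map_onto[OF nz order_refl sum]) (use xy St in \<open>auto simp: mA\<close>)
    then obtain f where f: "f \<in> Mx k n 3" "\<And>s a b c. f (s, a, b, c) \<noteq> 0 \<Longrightarrow> a < t1"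
      "row_map k t3 d b0 d 0 f = x" "row_map k t3 d b0 d 1 f = y" by blast
    have M: "f \<in> Mn k n" using f(1) unfolding Mx_iff by blast
    \<comment> \<open>The support lies in a < t1, where coefficients with b < t2 vanish by
      \<open>vanish_12\<close>.\<close>
    have "f \<in> Mx k n 2" unfolding Mx_iff using M vanish_12[OF M] f(2) by blast
    then show ?thesis using f M by blast
  qed
  have car: "car (Mmod k n) = Mn k n" by (simp add: Mmod_def)
  show ?thesis
    unfolding quot_pair_def car
    by (rule exI[of _ "row_map k t3 d b0 d 0"], rule exI[of _ "row_map k t3 d b0 d 1"])
      (use hom ker onto in simp)
qed

text \<open>The second parameter carries a minus sign because the diagonal of Y along the segment is
  minus an alternating sequence of x_1-exponents up to a shift. \<open>modW_props\<close> removes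
  the sign.\<close>

definition modM :: "nat bimod" where
  "modM = Emod (n - t1 - t2 - t3) (complex_of_real (k 1) + (of_nat n + 1) / 2)
     (- (complex_of_real (k 2) + (of_nat n + 1) / 2)) (complex_of_real (k 3) + (of_nat n + 1) / 2)"

text \<open>On M every exponent is at least its t_i, so the row x_3^t3 lives on the segment from
  x_2-exponent t2 to x_1-exponent t1, and the neighbours outside it vanish by membership in M. This
  row determines the polynomial, so the kernel is zero.\<close>

lemma quot_pair_M:
  defines "M \<equiv> Mx k n 1 \<inter> Mx k n 2 \<inter> Mx k n 3"
  shows "quot_pair (restrict_mod (Mmod k n) M) {vzero} M modM"
proof -
  define d where "d = n - t1 - t2 - t3"
  define a0 where "a0 = n - t3 - t2"
  have ev: "odd d" "even a0" and sum: "a0 + t2 + t3 = n" and da: "d + t1 = a0"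
    using t_odd n_even n_ge by (auto simp: d_def a0_def)
  then have da': "d \<le> a0" by simp
  have aC: "(of_nat a0 :: complex) = of_nat n - of_nat t3 - of_nat t2"
    unfolding sum[symmetric] by simp
  have dC: "(of_nat d :: complex) = of_nat n - of_nat t3 - of_nat t2 - of_nat t1"
    unfolding aC[symmetric] da[symmetric] by simp
  define N :: complex where "N = (of_nat n + 1) / 2"
  define \<alpha> \<beta> \<gamma> where "\<alpha> = complex_of_real (k 1) + N" and "\<beta> = - (complex_of_real (k 2) + N)"
    and "\<gamma> = complex_of_real (k 3) + N"
  have mM: "modM = bimat d \<alpha> \<beta> (phiE d \<alpha> \<beta> \<gamma>) (\<gamma> ^ 2 - \<alpha> ^ 2 - \<beta> ^ 2 + (of_nat d + 1) ^ 2 / 4)"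
    unfolding modM_def Emod_bimat d_def \<alpha>_def \<beta>_def \<gamma>_def N_def ..
  have nz: "nu (k 1) (a0 - l) \<noteq> 0" if "l < d" for l
    using that da t_pos by (intro nu_nonzero) auto
  have M: "M \<subseteq> Mn k n" unfolding M_def Mx_iff(1) by (auto simp: Mx_def)
  have van: "f (s, a, b, c) = 0" if "f \<in> M" "a < t1 \<or> b < t2 \<or> c < t3" for f s a b c
    using that unfolding M_def Int_iff Mx_iff by blast
  have hom: "bi_hom (restrict_mod (Mmod k n) M) modM (row_map k t3 a0 t2 d s)" if s: "s < 2" for s
  proof -
    have "- (\<alpha> + \<beta>) = complex_of_real (k 2) - complex_of_real (k 1)"
      by (simp add: \<alpha>_def \<beta>_def)
    then have sys: "bi_sys (theta d \<alpha>) (theta d \<beta>) (phiE d \<alpha> \<beta> \<gamma>)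
       (\<alpha> ^ 2 - \<beta> ^ 2 - \<gamma> ^ 2 + (of_nat d + 1) ^ 2 / 4) (\<beta> ^ 2 - \<alpha> ^ 2 - \<gamma> ^ 2 + (of_nat d + 1) ^ 2 / 4)
       (\<gamma> ^ 2 - \<alpha> ^ 2 - \<beta> ^ 2 + (of_nat d + 1) ^ 2 / 4) (complex_of_real (k 2) - complex_of_real (k 1))"
      using E_sys[of d \<alpha> \<beta> \<gamma>] by simp
    show ?thesis
      unfolding mM
    proof (rule row_map_hom[OF M s t_odd(3) ev(2) da' t_odd(2) _ _ _ _ _ _ sys phiE_top[OF ev(1)] nz])
      fix f assume f: "f \<in> M"
      show "f (1 - s, a0 - i, Suc (t2 + i), t3 - 1) = 0" for i
        using t_pos by (intro van[OF f]) auto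
      show "nu (k 1) (Suc (a0 - i)) * f (1 - s, Suc (a0 - i), t2 + i, t3 - 1) = 0" for i
        using t_pos van[OF f, of _ _ "t3 - 1"] by simp
      show "nu (k 1) (Suc a0) * f (s, Suc a0, t2 - 1, t3) = 0"
        using t_pos van[OF f, of _ "t2 - 1"] by simp
      show "f (s, a0 - d - 1, Suc (t2 + d), t3) = 0"
        using t_pos da by (intro van[OF f]) auto
    next
      fix i assume i: "i \<le> d"
      then have iC: "(of_nat (a0 - i) :: complex) = of_nat n - of_nat t3 - of_nat t2 - of_nat i"
        using da' by (simp add: of_nat_diff aC)
      show "theta d \<alpha> i = (-1) ^ i * (of_nat (t2 + i) + complex_of_real (k 2) - complex_of_real (k 3) + 1 / 2)"
        unfolding theta_def \<alpha>_def N_def of_nat_add dC k_complex by (simp add: field_simps)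
      show "theta d \<beta> i = - ((-1) ^ i * (of_nat (a0 - i) + complex_of_real (k 1) - complex_of_real (k 3) + 1 / 2))"
        unfolding theta_def \<beta>_def N_def iC dC k_complex by (simp add: field_simps)
    next
      fix i assume i: "i < d"
      then have iC: "(of_nat (a0 - i) :: complex) = of_nat n - of_nat t3 - of_nat t2 - of_nat i"
        using da' by (simp add: of_nat_diff aC)
      show "phiE d \<alpha> \<beta> \<gamma> (Suc i) = nu (k 1) (a0 - i) * nu (k 2) (Suc (t2 + i))"
      proof (cases "even i")
        case True
        then have "even (a0 - i)" "even (Suc (t2 + i))" using ev t_odd i da' by auto
        then show ?thesis using True
          unfolding phiE_def nu_eq \<alpha>_def \<beta>_def \<gamma>_def N_def of_nat_Suc of_nat_add dC iC k_complex
          by (simp add: field_simps power2_eq_square)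
      next
        case False
        then have "odd (a0 - i)" "odd (Suc (t2 + i))" using ev t_odd i da' by auto
        then show ?thesis using False
          unfolding phiE_def nu_eq \<alpha>_def \<beta>_def \<gamma>_def N_def of_nat_Suc of_nat_add dC iC k_complex
          by (simp add: field_simps)
      qed
    qed simp
  qed
  have zero_iff: "row_map k t3 a0 t2 d s f = vzero \<longleftrightarrow> (\<forall>i\<le>d. f (s, a0 - i, t2 + i, t3) = 0)" for s f
    by (rule row_map_zero_iff) (rule nz)
  have z0: "vzero \<in> M"
    unfolding M_def using Mx_subspace unfolding subspace_in_def by blast
  have ker: "{vzero} = {f \<in> M. row_map k t3 a0 t2 d 0 f = vzero \<and> row_map k t3 a0 t2 d 1 f = vzero}"
  proof (intro set_eqI iffI)
    fix f :: pv assume "f \<in> {vzero}"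
    then show "f \<in> {f \<in> M. row_map k t3 a0 t2 d 0 f = vzero \<and> row_map k t3 a0 t2 d 1 f = vzero}"
      using z0 unfolding mem_Collect_eq zero_iff by (simp add: vzero_def)
  next
    fix f assume "f \<in> {f \<in> M. row_map k t3 a0 t2 d 0 f = vzero \<and> row_map k t3 a0 t2 d 1 f = vzero}"
    then have fM: "f \<in> M" and z: "\<And>i. i \<le> d \<Longrightarrow> f (0, a0 - i, t2 + i, t3) = 0"
      "\<And>i. i \<le> d \<Longrightarrow> f (1, a0 - i, t2 + i, t3) = 0"
      unfolding mem_Collect_eq zero_iff by auto
    have f: "f \<in> Mn k n" using fM M by blast
    have row: "f (s, a, b, t3) = 0" for s a b
    proof (cases "s < 2 \<and> a + b + t3 = n \<and> t1 \<le> a \<and> t2 \<le> b")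
      case True
      then have "a0 - (b - t2) = a" "t2 + (b - t2) = b" "b - t2 \<le> d" using sum da by auto
      moreover have "s = 0 \<or> s = 1" using True by auto
      ultimately show ?thesis using z[of "b - t2"] by auto
    next
      case False
      then show ?thesis using MnD(1,2)[OF f] van[OF fM] by (meson not_le)
    qed
    have "f (s, a, b, c) = 0" for s a b c
    proof (cases "c < t3")
      case True
      then show ?thesis using van[OF fM] by blast
    next
      case False
      show ?thesis
        by (rule determined_by_row[where P = "\<lambda>_ _. True", OF f]) (use False row in auto)
    qed
    then have "f = vzero" by (auto simp: vzero_def fun_eq_iff)
    then show "f \<in> {vzero}" by simp
  qed
  have onto: "\<exists>f\<in>M. row_map k t3 a0 t2 d 0 f = x \<and> row_map k t3 a0 t2 d 1 f = y"
    if xy: "x \<in> car modM" "y \<in> car modM" for x y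
  proof -
    have "\<exists>f\<in>Mx k n 3. (\<forall>s a b c. f (s, a, b, c) \<noteq> 0 \<longrightarrow> t1 \<le> a \<and> t2 \<le> b)
      \<and> row_map k t3 a0 t2 d 0 f = x \<and> row_map k t3 a0 t2 d 1 f = y"
      by (rule row_map_onto[OF nz da' sum]) (use xy da in \<open>auto simp: mM\<close>)
    then obtain f where f: "f \<in> Mx k n 3" "\<And>s a b c. f (s, a, b, c) \<noteq> 0 \<Longrightarrow> t1 \<le> a \<and> t2 \<le> b"
      "row_map k t3 a0 t2 d 0 f = x" "row_map k t3 a0 t2 d 1 f = y" by blast
    have "f \<in> Mn k n" using f(1) unfolding Mx_iff by blast
    then have "f \<in> M" unfolding M_def Int_iff using f(1,2) unfolding Mx_iff by (meson not_le)
    then show ?thesis using f by blast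
  qed
  show ?thesis
    unfolding quot_pair_def
    by (rule exI[of _ "row_map k t3 a0 t2 d 0"], rule exI[of _ "row_map k t3 a0 t2 d 1"])
      (use hom ker onto in \<open>simp add: restrict_mod_def\<close>)
qed

end

section \<open>Transpositions of the variables\<close>

text \<open>Transpositions of the variables, composed with the matrices sigma_1 - sigma_2 and
  sigma_1 - sigma_3, which anti-intertwine the corresponding Pauli matrices.\<close>

definition rho12 :: "pv \<Rightarrow> pv" where
  "rho12 f = (\<lambda>(s, a, b, c). if s = 0 then (1 + \<i>) * f (1, b, a, c)
     else if s = 1 then (1 - \<i>) * f (0, b, a, c) else 0)"

definition rho13 :: "pv \<Rightarrow> pv" where
  "rho13 f = (\<lambda>(s, a, b, c). if s = 0 then f (1, c, b, a) - f (0, c, b, a)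
     else if s = 1 then f (0, c, b, a) + f (1, c, b, a) else 0)"

lemma rho12_at:
  "rho12 f (0, a, b, c) = (1 + \<i>) * f (1, b, a, c)" "rho12 f (1, a, b, c) = (1 - \<i>) * f (0, b, a, c)"
  "\<not> s < 2 \<Longrightarrow> rho12 f (s, a, b, c) = 0"
  by (auto simp: rho12_def)

lemma rho13_at:
  "rho13 f (0, a, b, c) = f (1, c, b, a) - f (0, c, b, a)" "rho13 f (1, a, b, c) = f (0, c, b, a) + f (1, c, b, a)"
  "\<not> s < 2 \<Longrightarrow> rho13 f (s, a, b, c) = 0"
  by (auto simp: rho13_def)

lemma rho12_Mn:
  assumes f: "f \<in> Mn k n"
  shows "rho12 f \<in> Mn (k(1 := k 2, 2 := k 1)) n"
  unfolding Mn_iff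
proof (intro conjI allI impI)
  fix s a b c assume "rho12 f (s, a, b, c) \<noteq> 0"
  then show "s < 2" "a + b + c = n"
    using MnD(2)[OF f] by (auto simp: rho12_def split: if_splits dest!: MnD(2)[OF f])
next
  fix a b c
  let ?k = "k(1 := k 2, 2 := k 1)"
  have k: "?k 1 = k 2" "?k 2 = k 1" "?k 3 = k 3" by auto
  have "nu (k 2) (Suc a) * ((1 - \<i>) * x) - \<i> * nu (k 1) (Suc b) * ((1 - \<i>) * y) + nu (k 3) (Suc c) * ((1 + \<i>) * z)
     = - (1 + \<i>) * (nu (k 1) (Suc b) * y + \<i> * nu (k 2) (Suc a) * x - nu (k 3) (Suc c) * z)" for x y z
    by (simp add: algebra_simps)
  then show "nu (?k 1) (Suc a) * rho12 f (1, Suc a, b, c) - \<i> * nu (?k 2) (Suc b) * rho12 f (1, a, Suc b, c)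
         + nu (?k 3) (Suc c) * rho12 f (0, a, b, Suc c) = 0"
    unfolding k rho12_at using MnD(4)[OF f, of b a c] by simp
  have "nu (k 2) (Suc a) * ((1 + \<i>) * x) + \<i> * nu (k 1) (Suc b) * ((1 + \<i>) * y) - nu (k 3) (Suc c) * ((1 - \<i>) * z)
     = (\<i> - 1) * (nu (k 1) (Suc b) * y - \<i> * nu (k 2) (Suc a) * x + nu (k 3) (Suc c) * z)" for x y z
    by (simp add: algebra_simps)
  then show "nu (?k 1) (Suc a) * rho12 f (0, Suc a, b, c) + \<i> * nu (?k 2) (Suc b) * rho12 f (0, a, Suc b, c)
         - nu (?k 3) (Suc c) * rho12 f (1, a, b, Suc c) = 0"
    unfolding k rho12_at using MnD(3)[OF f, of b a c] by simp
qed

lemma rho13_Mn: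
  assumes f: "f \<in> Mn k n"
  shows "rho13 f \<in> Mn (k(1 := k 3, 3 := k 1)) n"
  unfolding Mn_iff
proof (intro conjI allI impI)
  fix s a b c assume nz: "rho13 f (s, a, b, c) \<noteq> 0"
  then show "s < 2" by (auto simp: rho13_def split: if_splits)
  have "f (0, c, b, a) \<noteq> 0 \<or> f (1, c, b, a) \<noteq> 0" using nz by (auto simp: rho13_def split: if_splits)
  then show "a + b + c = n" using MnD(2)[OF f, of 0 c b a] MnD(2)[OF f, of 1 c b a] by auto
next
  fix a b c
  let ?k = "k(1 := k 3, 3 := k 1)"
  have k: "?k 1 = k 3" "?k 2 = k 2" "?k 3 = k 1" by auto
  have 1: "A * (x0 + x1) - \<i> * B * (y0 + y1) + C * (z1 - z0)
     = (C * z1 - \<i> * B * y1 + A * x0) - (C * z0 + \<i> * B * y0 - A * x1)" for A B C x0 x1 y0 y1 z0 z1 :: complex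
    by (simp add: algebra_simps)
  show "nu (?k 1) (Suc a) * rho13 f (1, Suc a, b, c) - \<i> * nu (?k 2) (Suc b) * rho13 f (1, a, Suc b, c)
         + nu (?k 3) (Suc c) * rho13 f (0, a, b, Suc c) = 0"
    unfolding k rho13_at 1 using MnD(3,4)[OF f, of c b a] by simp
  have 2: "A * (x1 - x0) + \<i> * B * (y1 - y0) - C * (z0 + z1)
     = - (C * z1 - \<i> * B * y1 + A * x0) - (C * z0 + \<i> * B * y0 - A * x1)" for A B C x0 x1 y0 y1 z0 z1 :: complex
    by (simp add: algebra_simps)
  show "nu (?k 1) (Suc a) * rho13 f (0, Suc a, b, c) + \<i> * nu (?k 2) (Suc b) * rho13 f (0, a, Suc b, c)
         - nu (?k 3) (Suc c) * rho13 f (1, a, b, Suc c) = 0"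
    unfolding k rho13_at 2 using MnD(3,4)[OF f, of c b a] by simp
qed

text \<open>Distinct Pauli matrices anticommute and square to 1, so a difference of two of them
  squares to 2. Half of the same map therefore serves as the inverse.\<close>

lemma rho_rho:
  assumes "f \<in> Mn k n"
  shows "rho12 (rho12 f) = smul 2 f" "rho13 (rho13 f) = smul 2 f"
proof -
  have "f (s, \<alpha>) = 0" if "\<not> s < 2" for s \<alpha> using MnD(1)[OF assms, of s] that by (cases \<alpha>) auto
  then show "rho12 (rho12 f) = smul 2 f" "rho13 (rho13 f) = smul 2 f"
    by (auto simp: rho12_def rho13_def smul_def fun_eq_iff algebra_simps)
qed

lemma rho_lin: "clin_on S rho12" "clin_on S rho13"
  by (intro clin_onI; auto simp: rho12_def rho13_def fun_eq_iff algebra_simps)+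

lemma rho_smul: "rho12 (smul c f) = smul c (rho12 f)" "rho13 (smul c f) = smul c (rho13 f)"
  using clin_on_smul[OF rho_lin(1)[of UNIV]] clin_on_smul[OF rho_lin(2)[of UNIV]] by auto

lemma upd_swap:
  "(k(1 := k 2, 2 := k 1))(1 := (k(1 := k 2, 2 := k 1)) 2, 2 := (k(1 := k 2, 2 := k 1)) 1) = (k :: nat \<Rightarrow> real)"
  "(k(1 := k 3, 3 := k 1))(1 := (k(1 := k 3, 3 := k 1)) 3, 3 := (k(1 := k 3, 3 := k 1)) 1) = (k :: nat \<Rightarrow> real)"
  by auto

lemma rho_bij:
  "bij_betw rho12 (Mn k n) (Mn (k(1 := k 2, 2 := k 1)) n)"
  "bij_betw rho13 (Mn k n) (Mn (k(1 := k 3, 3 := k 1)) n)"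
proof -
  have half: "smul (1/2) (smul 2 f) = f" for f :: pv by (simp add: smul_def)
  show "bij_betw rho12 (Mn k n) (Mn (k(1 := k 2, 2 := k 1)) n)"
  proof (rule bij_betw_byWitness[where f' = "\<lambda>f. smul (1/2) (rho12 f)"])
    show "rho12 ` Mn k n \<subseteq> Mn (k(1 := k 2, 2 := k 1)) n" using rho12_Mn by blast
    show "(\<lambda>f. smul (1/2) (rho12 f)) ` Mn (k(1 := k 2, 2 := k 1)) n \<subseteq> Mn k n"
      using rho12_Mn[of _ "k(1 := k 2, 2 := k 1)" n] subspace_smul[OF Mn_subspace] unfolding upd_swap by blast
  qed (use rho_rho(1) in \<open>auto simp: rho_smul half\<close>)
  show "bij_betw rho13 (Mn k n) (Mn (k(1 := k 3, 3 := k 1)) n)"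
  proof (rule bij_betw_byWitness[where f' = "\<lambda>f. smul (1/2) (rho13 f)"])
    show "rho13 ` Mn k n \<subseteq> Mn (k(1 := k 3, 3 := k 1)) n" using rho13_Mn by blast
    show "(\<lambda>f. smul (1/2) (rho13 f)) ` Mn (k(1 := k 3, 3 := k 1)) n \<subseteq> Mn k n"
      using rho13_Mn[of _ "k(1 := k 3, 3 := k 1)" n] subspace_smul[OF Mn_subspace] unfolding upd_swap by blast
  qed (use rho_rho(2) in \<open>auto simp: rho_smul half\<close>)
qed

lemma ops_outside:
  assumes "f \<in> Mn k n" "\<not> s < 2"
  shows "opX (Mmod k n) f (s, a, b, c) = 0" "opY (Mmod k n) f (s, a, b, c) = 0" "opZ (Mmod k n) f (s, a, b, c) = 0"
proof -
  have "f (s, a, b, c) = 0" using MnD(1)[OF assms(1)] assms(2) by blast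
  then show "opX (Mmod k n) f (s, a, b, c) = 0" "opY (Mmod k n) f (s, a, b, c) = 0" "opZ (Mmod k n) f (s, a, b, c) = 0"
    unfolding opX_Mmod opY_Mmod opZ_Mmod using assms(2) by simp_all
qed

lemma pv_eqI:
  fixes f g :: pv
  assumes "\<And>a b c. f (0, a, b, c) = g (0, a, b, c)" "\<And>a b c. f (1, a, b, c) = g (1, a, b, c)"
    and "\<And>s a b c. \<not> s < 2 \<Longrightarrow> f (s, a, b, c) = 0" "\<And>s a b c. \<not> s < 2 \<Longrightarrow> g (s, a, b, c) = 0"
  shows "f = g"
proof
  fix x obtain s :: nat and a b c :: nat where x: "x = (s, a, b, c)" by (cases x) auto
  have "s = 0 \<or> s = 1 \<or> \<not> s < 2" by auto
  then show "f x = g x" using assms unfolding x by auto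
qed

text \<open>The transposition reverses the sign of the angular operators such as x_3 T_2 - x_2 T_3
  besides permuting them. Anti-intertwining the Pauli matrices supplies the compensating sign, so
  the generators are permuted without signs.\<close>

lemma rho12_hom: "bi_hom (Mmod k n) (swapXY (Mmod (k(1 := k 2, 2 := k 1)) n)) rho12"
proof -
  let ?k = "k(1 := k 2, 2 := k 1)"
  have k: "?k 1 = k 2" "?k 2 = k 1" "?k 3 = k 3" by auto
  have car: "car (Mmod k n) = Mn k n" for k by (simp add: Mmod_def)
  have "rho12 (opX (Mmod k n) f) = opY (Mmod ?k n) (rho12 f)
      \<and> rho12 (opY (Mmod k n) f) = opX (Mmod ?k n) (rho12 f)
      \<and> rho12 (opZ (Mmod k n) f) = opZ (Mmod ?k n) (rho12 f)" if f: "f \<in> Mn k n" for f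
  proof (intro conjI)
    show "rho12 (opX (Mmod k n) f) = opY (Mmod ?k n) (rho12 f)"
      by (rule pv_eqI; (simp only: rho12_at(3) ops_outside[OF rho12_Mn[OF f]])?)
        (simp_all add: rho12_at opX_Mmod opY_Mmod field_simps)
    show "rho12 (opY (Mmod k n) f) = opX (Mmod ?k n) (rho12 f)"
      by (rule pv_eqI; (simp only: rho12_at(3) ops_outside[OF rho12_Mn[OF f]])?)
        (simp_all add: rho12_at opY_Mmod opX_Mmod field_simps)
    show "rho12 (opZ (Mmod k n) f) = opZ (Mmod ?k n) (rho12 f)"
      by (rule pv_eqI; (simp only: rho12_at(3) ops_outside[OF rho12_Mn[OF f]])?)
        (simp_all add: rho12_at opZ_Mmod field_simps)
  qed
  then show ?thesis
    using rho_lin(1) rho12_Mn unfolding bi_hom_def intertwines_def swapXY_simps car by auto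
qed

lemma rho13_hom: "bi_hom (Mmod k n) (swapXZ (Mmod (k(1 := k 3, 3 := k 1)) n)) rho13"
proof -
  let ?k = "k(1 := k 3, 3 := k 1)"
  have k: "?k 1 = k 3" "?k 2 = k 2" "?k 3 = k 1" by auto
  have car: "car (Mmod k n) = Mn k n" for k by (simp add: Mmod_def)
  have "rho13 (opX (Mmod k n) f) = opZ (Mmod ?k n) (rho13 f)
      \<and> rho13 (opY (Mmod k n) f) = opY (Mmod ?k n) (rho13 f)
      \<and> rho13 (opZ (Mmod k n) f) = opX (Mmod ?k n) (rho13 f)" if f: "f \<in> Mn k n" for f
  proof (intro conjI)
    show "rho13 (opX (Mmod k n) f) = opZ (Mmod ?k n) (rho13 f)"
      by (rule pv_eqI; (simp only: rho13_at(3) ops_outside[OF rho13_Mn[OF f]])?)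
        (simp_all add: rho13_at opX_Mmod opZ_Mmod algebra_simps)
    show "rho13 (opY (Mmod k n) f) = opY (Mmod ?k n) (rho13 f)"
      by (rule pv_eqI; (simp only: rho13_at(3) ops_outside[OF rho13_Mn[OF f]])?)
        (simp_all add: rho13_at opY_Mmod algebra_simps)
    show "rho13 (opZ (Mmod k n) f) = opX (Mmod ?k n) (rho13 f)"
      by (rule pv_eqI; (simp only: rho13_at(3) ops_outside[OF rho13_Mn[OF f]])?)
        (simp_all add: rho13_at opZ_Mmod opX_Mmod algebra_simps)
  qed
  then show ?thesis
    using rho_lin(2) rho13_Mn unfolding bi_hom_def intertwines_def swapXZ_simps car by auto
qed

text \<open>The vanishing condition ranges over all s because \<open>rho13\<close> mixes the two
  spinor components. The converse directions use that each map squares to 2.\<close>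

lemma rho_vanish:
  assumes f: "f \<in> Mn k n"
  shows "(\<forall>s a b c. P a b c \<longrightarrow> rho12 f (s, a, b, c) = 0) \<longleftrightarrow> (\<forall>s a b c. P b a c \<longrightarrow> f (s, a, b, c) = 0)"
    and "(\<forall>s a b c. P a b c \<longrightarrow> rho13 f (s, a, b, c) = 0) \<longleftrightarrow> (\<forall>s a b c. P c b a \<longrightarrow> f (s, a, b, c) = 0)"
proof -
  have 2: "2 * f (s, a, b, c) = rho12 (rho12 f) (s, a, b, c)" "2 * f (s, a, b, c) = rho13 (rho13 f) (s, a, b, c)" for s a b c
    unfolding rho_rho[OF f] by (simp_all add: smul_def)
  have 0: "rho12 g (s, a, b, c) = 0" if "\<And>s. g (s, b, a, c) = 0" for g s a b c
    using that by (simp add: rho12_def)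
  have 1: "rho13 g (s, a, b, c) = 0" if "\<And>s. g (s, c, b, a) = 0" for g s a b c
    using that by (simp add: rho13_def)
  show "(\<forall>s a b c. P a b c \<longrightarrow> rho12 f (s, a, b, c) = 0) \<longleftrightarrow> (\<forall>s a b c. P b a c \<longrightarrow> f (s, a, b, c) = 0)"
  proof (intro iffI allI impI)
    fix s a b c assume "\<forall>s a b c. P a b c \<longrightarrow> rho12 f (s, a, b, c) = 0" "P b a c"
    then have v: "rho12 f (s', b, a, c) = 0" for s' by blast
    have "2 * f (s, a, b, c) = 0" unfolding 2(1) by (rule 0) (rule v)
    then show "f (s, a, b, c) = 0" by simp
  qed (rule 0, blast)
  show "(\<forall>s a b c. P a b c \<longrightarrow> rho13 f (s, a, b, c) = 0) \<longleftrightarrow> (\<forall>s a b c. P c b a \<longrightarrow> f (s, a, b, c) = 0)"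
  proof (intro iffI allI impI)
    fix s a b c assume "\<forall>s a b c. P a b c \<longrightarrow> rho13 f (s, a, b, c) = 0" "P c b a"
    then have v: "rho13 f (s', c, b, a) = 0" for s' by blast
    have "2 * f (s, a, b, c) = 0" unfolding 2(2) by (rule 1) (rule v)
    then show "f (s, a, b, c) = 0" by simp
  qed (rule 1, blast)
qed

section \<open>The other two quotients by transposition, and irreducibility\<close>

context dunkl
begin

lemma dunkl12: "dunkl (k(1 := k 2, 2 := k 1)) n t2 t1 t3"
  by unfold_locales (use t_odd k n_even n_ge in auto)

lemma dunkl13: "dunkl (k(1 := k 3, 3 := k 1)) n t3 t2 t1"
  by unfold_locales (use t_odd k n_even n_ge in auto)

definition modB :: "nat bimod" where
  "modB = Omod (t2 - 1) (complex_of_real (k 3)) (kap + of_nat n + 1) (complex_of_real (k 1))"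

definition modC :: "nat bimod" where
  "modC = Omod (t3 - 1) (complex_of_real (k 2)) (complex_of_real (k 1)) (kap + of_nat n + 1)"

definition modW :: "nat bimod" where
  "modW = Emod (n - t1 - t2 - t3) (complex_of_real (k 1) + (of_nat n + 1) / 2)
     (complex_of_real (k 2) + (of_nat n + 1) / 2) (complex_of_real (k 3) + (of_nat n + 1) / 2)"

lemma bimodule_mod: "bimodule modA" "bimodule modB" "bimodule modC" "bimodule modW" "bimodule modM"
  unfolding modA_def modB_def modC_def modW_def modM_def Omod_bimat Emod_bimat
  by (rule bimat_bimodule)+

lemma pred_C: "(of_nat (t1 - 1) :: complex) = of_nat t1 - 1" "(of_nat (t2 - 1) :: complex) = of_nat t2 - 1"
  "(of_nat (t3 - 1) :: complex) = of_nat t3 - 1"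
  using t_pos by (simp_all add: of_nat_diff)

text \<open>With k_i = -t_i/2 each entry of both split sequences is, up to sign, a product of two
  natural numbers, which are positive by n >= t1 + t2 + t3 and i < t1.\<close>

lemma modA_irreducible: "irreducible_mod modA"
proof -
  let ?d = "t1 - 1" and ?a = "kap + of_nat n + 1" and ?b = "complex_of_real (k 3)" and ?c = "complex_of_real (k 2)"
  define h where "h = 2 * real n + 3 - 2 * real t1 - real t2 - real t3"
  show ?thesis
    unfolding modA_def
  proof (rule O_irreducible[where h = h])
    show "even ?d" using t_odd by simp
    show "2 * ?a - of_nat ?d = complex_of_real h"
      unfolding kap pred_C h_def by (simp add: field_simps)
    show "h > 0" using n_ge by (simp add: h_def)
  next
    fix i assume i: "1 \<le> i" "i \<le> ?d"
    show "phiO ?d ?a ?b ?c i \<noteq> 0"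
    proof (cases "even i")
      case True
      have "phiO ?d ?a ?b ?c i = - (of_nat i * of_nat (n + 1 + i - (t1 + t2 + t3)))"
        using True n_ge unfolding phiO_def kap pred_C k_complex by (simp add: of_nat_diff field_simps)
      moreover have "0 < i" "0 < n + 1 + i - (t1 + t2 + t3)" using i n_ge by auto
      ultimately show ?thesis by (simp del: of_nat_add of_nat_diff)
    next
      case False
      have "phiO ?d ?a ?b ?c i = of_nat (t1 - i) * of_nat (n + 1 + i - (t1 + t3))"
        using False i n_ge unfolding phiO_def kap pred_C k_complex by (simp add: of_nat_diff field_simps)
      moreover have "0 < t1 - i" "0 < n + 1 + i - (t1 + t3)" using i n_ge t_pos by auto
      ultimately show ?thesis by (simp del: of_nat_add of_nat_diff)
    qed
    show "phiO ?d (- ?a) ?b (- ?c) i \<noteq> 0"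
    proof (cases "even i")
      case True
      have "phiO ?d (- ?a) ?b (- ?c) i = of_nat i * of_nat (n + 1 - (t2 + i))"
        using True i n_ge unfolding phiO_def kap pred_C k_complex by (simp add: of_nat_diff field_simps)
      moreover have "0 < i" "0 < n + 1 - (t2 + i)" using i n_ge by auto
      ultimately show ?thesis by (simp del: of_nat_add of_nat_diff)
    next
      case False
      have "phiO ?d (- ?a) ?b (- ?c) i = - (of_nat (t1 - i) * of_nat (n + 1 - i))"
        using False i n_ge unfolding phiO_def kap pred_C k_complex by (simp add: of_nat_diff field_simps)
      moreover have "0 < t1 - i" "0 < n + 1 - i" using i n_ge t_pos by auto
      ultimately show ?thesis by (simp del: of_nat_add of_nat_diff)
    qed
  qed
qed

text \<open>Transposing the variables 1 and 2 turns A into the module O with parameters K + n + 1,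
  k_3, k_1, which is B with its first two parameters interchanged.\<close>

lemma modB_iso: "bi_iso modB (swapXY (dunkl.modA (k(1 := k 2, 2 := k 1)) n t2))"
proof -
  let ?d = "t2 - 1" and ?a = "complex_of_real (k 3)" and ?b = "kap + of_nat n + 1" and ?c = "complex_of_real (k 1)"
  have "dunkl.modA (k(1 := k 2, 2 := k 1)) n t2 = Omod ?d ?b ?a ?c"
    unfolding dunkl.modA_def[OF dunkl12] by (simp add: add_ac)
  moreover have "bi_iso (Omod ?d ?a ?b ?c) (swapXY (Omod ?d ?b ?a ?c))"
  proof (rule O_swap_XY)
    show "even ?d" using t_odd by simp
    fix i assume i: "1 \<le> i" "i \<le> ?d"
    show "phiO ?d (- ?a) ?b (- ?c) i \<noteq> 0"
    proof (cases "even i")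
      case True
      have "phiO ?d (- ?a) ?b (- ?c) i = - (of_nat i * of_nat (n + 1 + i - t2))"
        using True i n_ge unfolding phiO_def kap pred_C k_complex by (simp add: of_nat_diff field_simps)
      moreover have "0 < i" "0 < n + 1 + i - t2" using i n_ge by auto
      ultimately show ?thesis by (simp del: of_nat_add of_nat_diff)
    next
      case False
      have "phiO ?d (- ?a) ?b (- ?c) i = of_nat (t2 - i) * of_nat (n + 1 + i - (t1 + t2))"
        using False i n_ge unfolding phiO_def kap pred_C k_complex by (simp add: of_nat_diff field_simps)
      moreover have "0 < t2 - i" "0 < n + 1 + i - (t1 + t2)" using i n_ge t_pos by auto
      ultimately show ?thesis by (simp del: of_nat_add of_nat_diff)
    qed
  qed
  ultimately show ?thesis unfolding modB_def by simp
qed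

text \<open>Transposing the variables 1 and 3 turns A into the module O with parameters K + n + 1,
  k_1, k_2, which is C with its outer parameters interchanged.\<close>

lemma modC_iso: "bi_iso modC (swapXZ (dunkl.modA (k(1 := k 3, 3 := k 1)) n t3))"
proof -
  have "dunkl.modA (k(1 := k 3, 3 := k 1)) n t3
      = Omod (t3 - 1) (kap + of_nat n + 1) (complex_of_real (k 1)) (complex_of_real (k 2))"
    unfolding dunkl.modA_def[OF dunkl13] by (simp add: add_ac)
  then show ?thesis unfolding modC_def using O_swap_XZ t_odd by simp
qed

lemma modB_irreducible: "irreducible_mod modB"
  by (rule irreducible_iso[OF modB_iso bimodule_mod(2)])
    (intro irreducible_swap dunkl.modA_irreducible[OF dunkl12])

lemma modC_irreducible: "irreducible_mod modC"
  by (rule irreducible_iso[OF modC_iso bimodule_mod(3)])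
    (intro irreducible_swap dunkl.modA_irreducible[OF dunkl13])

lemma Mx_subset: "Mx k n i \<subseteq> Mn k n"
  unfolding Mx_def by blast

lemma Mmod_car: "car (Mmod k n) = Mn k n"
  by (simp add: Mmod_def)

lemma quot_pair_B: "quot_pair (Mmod k n) (Mx k n 2) (Mx k n 1 \<inter> Mx k n 3) modB"
proof -
  interpret D: dunkl "k(1 := k 2, 2 := k 1)" n t2 t1 t3 by (rule dunkl12)
  have mem: "rho12 u \<in> Mx (k(1 := k 2, 2 := k 1)) n 1 \<longleftrightarrow> u \<in> Mx k n 2"
    "rho12 u \<in> Mx (k(1 := k 2, 2 := k 1)) n 2 \<longleftrightarrow> u \<in> Mx k n 1"
    "rho12 u \<in> Mx (k(1 := k 2, 2 := k 1)) n 3 \<longleftrightarrow> u \<in> Mx k n 3" if "u \<in> Mn k n" for u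
    unfolding Mx_iff D.Mx_iff using rho12_Mn[OF that] that
      rho_vanish(1)[OF that, where P = "\<lambda>a b c. a < t2"] rho_vanish(1)[OF that, where P = "\<lambda>a b c. b < t1"]
      rho_vanish(1)[OF that, where P = "\<lambda>a b c. c < t3"] by simp_all
  have "quot_pair (Mmod k n) (Mx k n 2) (Mx k n 1 \<inter> Mx k n 3) (swapXY D.modA)"
  proof (rule quot_pair_pullback[OF quot_pair_swap(1)[OF D.quot_pair_A] rho12_hom])
    show "bij_betw rho12 (car (Mmod k n)) (car (swapXY (Mmod (k(1 := k 2, 2 := k 1)) n)))"
      using rho_bij(1)[of k n] by (simp add: Mmod_def)
    show "Mx k n 2 = {u \<in> car (Mmod k n). rho12 u \<in> Mx (k(1 := k 2, 2 := k 1)) n 1}"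
      using mem(1) Mx_subset unfolding Mmod_car by blast
    show "u \<in> Mx k n 1 \<inter> Mx k n 3" if "u \<in> car (Mmod k n)"
      "rho12 u \<in> Mx (k(1 := k 2, 2 := k 1)) n 2 \<inter> Mx (k(1 := k 2, 2 := k 1)) n 3" for u
      using mem[of u] that unfolding Mmod_car by blast
  qed
  then show ?thesis
    by (rule quot_pair_iso[OF _ bi_iso_sym[OF modB_iso bimodule_mod(2)] bimodule_swap(1)[OF D.bimodule_mod(1)]])
qed

lemma quot_pair_C: "quot_pair (Mmod k n) (Mx k n 3) (Mx k n 1 \<inter> Mx k n 2) modC"
proof -
  interpret D: dunkl "k(1 := k 3, 3 := k 1)" n t3 t2 t1 by (rule dunkl13)
  have mem: "rho13 u \<in> Mx (k(1 := k 3, 3 := k 1)) n 1 \<longleftrightarrow> u \<in> Mx k n 3"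
    "rho13 u \<in> Mx (k(1 := k 3, 3 := k 1)) n 2 \<longleftrightarrow> u \<in> Mx k n 2"
    "rho13 u \<in> Mx (k(1 := k 3, 3 := k 1)) n 3 \<longleftrightarrow> u \<in> Mx k n 1" if "u \<in> Mn k n" for u
    unfolding Mx_iff D.Mx_iff using rho13_Mn[OF that] that
      rho_vanish(2)[OF that, where P = "\<lambda>a b c. a < t3"] rho_vanish(2)[OF that, where P = "\<lambda>a b c. b < t2"]
      rho_vanish(2)[OF that, where P = "\<lambda>a b c. c < t1"] by simp_all
  have "quot_pair (Mmod k n) (Mx k n 3) (Mx k n 1 \<inter> Mx k n 2) (swapXZ D.modA)"
  proof (rule quot_pair_pullback[OF quot_pair_swap(2)[OF D.quot_pair_A] rho13_hom])
    show "bij_betw rho13 (car (Mmod k n)) (car (swapXZ (Mmod (k(1 := k 3, 3 := k 1)) n)))"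
      using rho_bij(2)[of k n] by (simp add: Mmod_def)
    show "Mx k n 3 = {u \<in> car (Mmod k n). rho13 u \<in> Mx (k(1 := k 3, 3 := k 1)) n 1}"
      using mem(1) Mx_subset unfolding Mmod_car by blast
    show "u \<in> Mx k n 1 \<inter> Mx k n 2" if "u \<in> car (Mmod k n)"
      "rho13 u \<in> Mx (k(1 := k 3, 3 := k 1)) n 2 \<inter> Mx (k(1 := k 3, 3 := k 1)) n 3" for u
      using mem[of u] that unfolding Mmod_car by blast
  qed
  then show ?thesis
    by (rule quot_pair_iso[OF _ bi_iso_sym[OF modC_iso bimodule_mod(3)] bimodule_swap(2)[OF D.bimodule_mod(1)]])
qed

text \<open>The even entries of the split sequences are i (d + 1 - i). The odd ones are differences
  of squares and factor into integers that stay nonzero for 1 <= i <= d.\<close>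

lemma modW_props: "irreducible_mod modW" "bi_iso modW modM"
proof -
  let ?d = "n - t1 - t2 - t3"
  let ?a = "complex_of_real (k 1) + (of_nat n + 1) / 2" and ?b = "complex_of_real (k 2) + (of_nat n + 1) / 2"
    and ?c = "complex_of_real (k 3) + (of_nat n + 1) / 2"
  have dC: "(of_nat ?d :: complex) = of_nat n - of_nat t1 - of_nat t2 - of_nat t3"
    using n_ge by (simp add: of_nat_diff)
  have od: "odd ?d" using t_odd n_even n_ge by auto
  have p: "phiE ?d ?a ?b ?c i \<noteq> 0" if i: "1 \<le> i" "i \<le> ?d" for i
  proof (cases "even i")
    case True
    have "phiE ?d ?a ?b ?c i = of_nat i * of_nat (Suc ?d - i)"
      using True i by (simp add: phiE_def of_nat_diff)
    then show ?thesis using i by (simp del: of_nat_add of_nat_diff)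
  next
    case False
    have "phiE ?d ?a ?b ?c i = - (of_nat (t3 + i) * of_nat (n + 1 + i))"
      using False unfolding phiE_def dC k_complex by (simp add: field_simps power2_eq_square)
    then show ?thesis using i by (simp del: of_nat_add of_nat_diff)
  qed
  have q: "phiE ?d (- ?a) ?b ?c i \<noteq> 0" "phiE ?d ?b (- ?a) ?c i \<noteq> 0" if i: "1 \<le> i" "i \<le> ?d" for i
  proof -
    have "phiE ?d (- ?a) ?b ?c i \<noteq> 0"
    proof (cases "even i")
      case True
      have "phiE ?d (- ?a) ?b ?c i = of_nat i * of_nat (Suc ?d - i)"
        using True i by (simp add: phiE_def of_nat_diff)
      then show ?thesis using i by (simp del: of_nat_add of_nat_diff)
    next
      case False
      have "phiE ?d (- ?a) ?b ?c i = of_nat (t1 + i) * of_nat (n + 1 - (t1 + t3 + i))"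
        using False i n_ge unfolding phiE_def dC k_complex
        by (simp add: of_nat_diff field_simps power2_eq_square)
      moreover have "0 < t1 + i" "0 < n + 1 - (t1 + t3 + i)" using i n_ge by auto
      ultimately show ?thesis by (simp del: of_nat_add of_nat_diff)
    qed
    \<comment> \<open>The first two parameters enter the split sequence of E only through their
      sum.\<close>
    moreover have "phiE ?d ?b (- ?a) ?c i = phiE ?d (- ?a) ?b ?c i" unfolding phiE_def by (simp add: algebra_simps)
    ultimately show "phiE ?d (- ?a) ?b ?c i \<noteq> 0" "phiE ?d ?b (- ?a) ?c i \<noteq> 0" by simp_all
  qed
  show "irreducible_mod modW"
    unfolding modW_def
  proof (rule E_irreducible[OF od, where h = "1 + real t2 + real t3"])
    show "2 * ?a - of_nat ?d = complex_of_real (1 + real t2 + real t3)"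
      unfolding dC k_complex by (simp add: field_simps)
  qed (use p q(1) in auto)
  show "bi_iso modW modM"
    unfolding modW_def modM_def by (rule E_reverse_Y[OF od p q(2)])
qed

end

section \<open>Finiteness of the exceptional exponents and conclusion\<close>

lemma tt_finite:
  assumes "tt r \<noteq> \<infinity>"
  obtains t where "odd t" "2 * r = - real t" "tt r = enat t"
proof -
  obtain m :: nat where "odd m" "2 * r = - real m"
    using assms unfolding tt_def by (auto split: if_splits)
  then have "\<exists>m::nat. odd m \<and> 2 * r = - real m" "- 2 * r = real m" by auto
  then have "tt r = enat m" by (simp add: tt_def)
  with \<open>odd m\<close> \<open>2 * r = - real m\<close> show ?thesis by (rule that)
qed

theorem theorem9p16:
  fixes k :: "nat \<Rightarrow> real" and n :: nat
  assumes "even n"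
    and "tt (k 1) + tt (k 2) + tt (k 3) \<le> enat n"
  shows
   "let t1 = the_enat (tt (k 1)); t2 = the_enat (tt (k 2)); t3 = the_enat (tt (k 3));
        K = complex_of_real (k 1 + k 2 + k 3);
        N = (of_nat n + 1) / 2 :: complex;
        k1 = complex_of_real (k 1); k2 = complex_of_real (k 2); k3 = complex_of_real (k 3);
        M = Mx k n 1 \<inter> Mx k n 2 \<inter> Mx k n 3;
        W0 = Emod (n - t1 - t2 - t3) (k1 + N) (k2 + N) (k3 + N);
        A = Omod (t1 - 1) (K + of_nat n + 1) k3 k2;
        B = Omod (t2 - 1) k3 (K + of_nat n + 1) k1;
        C = Omod (t3 - 1) k2 k1 (K + of_nat n + 1)
    in bi_iso (restrict_mod (Mmod k n) M) (dsum [W0, W0])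
     \<and> quot_iso (Mmod k n) (Mx k n 1) (dsum [A, A])
     \<and> quot_iso (Mmod k n) (Mx k n 2) (dsum [B, B])
     \<and> quot_iso (Mmod k n) (Mx k n 3) (dsum [C, C])
     \<and> quot_iso (restrict_mod (Mmod k n) (Mx k n 1)) M (dsum [B, B, C, C])
     \<and> quot_iso (restrict_mod (Mmod k n) (Mx k n 2)) M (dsum [A, A, C, C])
     \<and> quot_iso (restrict_mod (Mmod k n) (Mx k n 3)) M (dsum [A, A, B, B])
     \<and> irreducible_mod W0 \<and> irreducible_mod A \<and> irreducible_mod B \<and> irreducible_mod C"
proof -
  have fin: "tt (k 1) \<noteq> \<infinity>" "tt (k 2) \<noteq> \<infinity>" "tt (k 3) \<noteq> \<infinity>"
    using assms(2) by (cases "tt (k 1)"; cases "tt (k 2)"; cases "tt (k 3)"; simp)+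
  obtain t1 where t1: "odd t1" "2 * k 1 = - real t1" "tt (k 1) = enat t1"
    by (rule tt_finite[OF fin(1)])
  obtain t2 where t2: "odd t2" "2 * k 2 = - real t2" "tt (k 2) = enat t2"
    by (rule tt_finite[OF fin(2)])
  obtain t3 where t3: "odd t3" "2 * k 3 = - real t3" "tt (k 3) = enat t3"
    by (rule tt_finite[OF fin(3)])
  have "t1 + t2 + t3 \<le> n" using assms(2) unfolding t1(3) t2(3) t3(3) by simp
  then interpret dunkl k n t1 t2 t3
    by unfold_locales (use assms(1) t1 t2 t3 in auto)
  let ?M = "Mx k n 1 \<inter> Mx k n 2 \<inter> Mx k n 3" and ?U = "Mmod k n"
  have sub: "Mx k n i \<subseteq> car ?U" for i using Mx_subset by (simp add: Mmod_car)
  have M_sub: "subspace_in ?M"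
    using Mx_subspace unfolding subspace_in_def by blast
  note mods = modA_def[symmetric] modB_def[symmetric] modC_def[symmetric] modW_def[symmetric]
  \<comment> \<open>The intersection is handled as its quotient by zero, after the sign of the
    second parameter has been removed.\<close>
  have pair: "quot_pair (restrict_mod ?U ?M) {vzero} ?M modW"
    by (rule quot_pair_iso[OF quot_pair_M bi_iso_sym[OF modW_props(2) bimodule_mod(4)] bimodule_mod(5)])
  have i: "bi_iso (restrict_mod ?U ?M) (dsum [modW, modW])"
    by (rule quot_iso_bi_iso[OF quot_pair_quot_iso[OF pair]]) (use M_sub in \<open>simp add: restrict_mod_def\<close>)
  \<comment> \<open>The pair for one variable is onto already on the intersection of the two other
    submodules. That intersection lies in the submodule under consideration and in the kernel of the
    other pair involved.\<close>
  note restr = quot_pair_quot_iso_restrict[OF _ _ Mx_subspace sub]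
  have v: "quot_iso (restrict_mod ?U (Mx k n 1)) (Mx k n 1 \<inter> Mx k n 2 \<inter> Mx k n 3) (dsum [modB, modB, modC, modC])"
    by (rule restr[OF quot_pair_B quot_pair_C]) auto
  have "quot_iso (restrict_mod ?U (Mx k n 2)) (Mx k n 2 \<inter> Mx k n 1 \<inter> Mx k n 3) (dsum [modA, modA, modC, modC])"
    by (rule restr[OF quot_pair_A quot_pair_C]) auto
  then have vi: "quot_iso (restrict_mod ?U (Mx k n 2)) ?M (dsum [modA, modA, modC, modC])"
    by (simp only: Int_commute[of "Mx k n 2"])
  have "quot_iso (restrict_mod ?U (Mx k n 3)) (Mx k n 3 \<inter> Mx k n 1 \<inter> Mx k n 2) (dsum [modA, modA, modB, modB])"
    by (rule restr[OF quot_pair_A quot_pair_B]) auto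
  then have vii: "quot_iso (restrict_mod ?U (Mx k n 3)) ?M (dsum [modA, modA, modB, modB])"
    by (simp only: Int_assoc Int_commute[of "Mx k n 3"])
  show ?thesis
    unfolding Let_def t1(3) t2(3) t3(3) the_enat.simps mods
    using i v vi vii quot_pair_quot_iso[OF quot_pair_A] quot_pair_quot_iso[OF quot_pair_B]
      quot_pair_quot_iso[OF quot_pair_C] modW_props(1) modA_irreducible modB_irreducible modC_irreducible
    by blast
qed

end
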